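(* Assume that for every $\check\delta>0$ $$\lim_{n\to\infty}\frac{\varsigma(n)}{n^{\check\delta}}=0\quad\text{and}\quad\lim_{n\to\infty}\frac{\nu(n)}{n^{\check\delta}}=0 .$$ Then there is a sequence $\mathbf B^*_n$ with $\lim_{n\to\infty}\mathbf B^*_n/n^{\check\delta}=0$ for every $\check\delta>0$, such that for any $n\ge3$, any $S\in\Theta_{\epsilon,L}$ and any $0<\delta\le1/12$, the sequential model selection procedure $\widehat S_*$ (with penalty coefficient $\delta$) for the autoregressive model described in the context satisfies $$\mathcal{R}^*(\widehat S_*,S)\le\frac{(1+4\delta)(1+\delta)^2}{1-6\delta}\min_{\lambda\in\Lambda}\mathcal{R}^*(\widehat S_\lambda,S)+\frac{\mathbf B^*_n}{\delta n}.$$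
   Context: **Model.** $a<b$, $0<\epsilon<1$, $L>0$ and $y_0\in\mathbb{R}$ are fixed. For $1\le k\le n$, $y_k=S(x_k)y_{k-1}+\xi_k$, $x_k=a+\frac{k(b-a)}{n}$, with $(\xi_k)$ i.i.d. with density $p$. $\mathbf{P}_{p,S},\mathbf{E}_{p,S}$ are the corresponding probability and expectation. $\mathcal{P}$ is the set of densities $p$ on $\mathbb{R}$ with $\int xp=0$, $\int x^2p=1$, $\sup_{k\ge1}\frac{\int|x|^{2k}p(x)dx}{\varsigma^k(2k-1)!!}\le1$, where $\varsigma=\varsigma(n)\ge1$ may depend on $n$. $\Theta_{\epsilon,L}=\{S\in C^1([a,b],\mathbb{R}):\sup|S|\le1-\epsilon,\ \sup|\dot S|\le L\}$. Robust risk: $\mathcal{R}^*(\widehat S,S)=\sup_{p\in\mathcal{P}}\mathbf{E}_{p,S}\int_a^b(\widehat S(x)-S(x))^2dx$. $[\cdot]$ is the integer part. **Sequential procedures.** Let $d=[\sqrt n]$, $z_l=a+\frac ld(b-a)$ ($1\le l\le d$), $h=\frac{b-a}{2d}$, $\tilde z_l=\frac{z_l-a}{b-a}$, $\tilde h=\frac{h}{b-a}$, $Q_{l,j}=\mathbf{1}_{\{|x_j-z_l|\le h\}}$, $k_{1,l}=[n\tilde z_l-n\tilde h]+1$, $k_{2,l}=[n\tilde z_l+n\tilde h]\wedge n$, $\mathbf q=[(n\tilde h)^{\mu_0}]$ for a fixed $0<\mu_0<1$, $\iota_l=k_{1,l}+\mathbf q$. Put $A_{k,m}=\sum_{j=k+1}^mQ_{l,j}y_{j-1}^2$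 (with $l$ understood), $\tilde\epsilon=\frac1{2+\ln n}$, $$\widehat S_{\iota_l}=\frac{\sum_{j=1}^{\iota_l}Q_{l,j}y_{j-1}y_j}{A_{0,\iota_l}},\quad\widetilde S_{\iota_l}=\min(\max(\widehat S_{\iota_l},-1+\tilde\epsilon),1-\tilde\epsilon),\quad\tilde\gamma_l=1-\widetilde S_{\iota_l}^2,\quad H_l=\frac{1-\tilde\epsilon}{\tilde\gamma_l}(k_{2,l}-\iota_l-1),$$ where the threshold $H_l$ is understood to be positive. Let $\tau_l=\inf\{\iota_l+1\le k\le k_{2,l}:A_{\iota_l,k}\ge H_l\}$ ($\inf\emptyset=k_{2,l}$), $\Gamma_l=\{A_{\iota_l,k_{2,l}-1}\ge H_l\}$, and on $\Gamma_l$ let $0<\varkappa_l\le1$ be defined by $A_{\iota_l,\tau_l-1}+\varkappa_l^2Q_{l,\tau_l}y_{\tau_l-1}^2=H_l$. Set $$S_l^*=\frac1{H_l}\Big(\sum_{j=\iota_l+1}^{\tau_l-1}Q_{l,j}y_{j-1}y_j+\varkappa_lQ_{l,\tau_l}y_{\tau_l-1}y_{\tau_l}\Big)\mathbf{1}_{\Gamma_l},\quad\Gamma=\bigcap_{l=1}^d\Gamma_l,\quad Y_l=S_l^*\mathbf{1}_\Gamma,\quad\sigma_l=H_l^{-1/2}.$$ **Model selection.** $(\phi_j)_{1\le j\le d}$ is a system of functions on $[a,b]$ with $\frac{b-a}d\sum_{l=1}^d\phi_i(z_l)\phi_j(z_l)=\mathbf{1}_{\{i=j\}}$. $\Lambda=\Lambda_n\subset[0,1]^d$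 is a finite set of weight vectors with cardinality $\nu=\nu(n)$. Let $\widehat\theta_{j,d}=\frac{b-a}d\sum_{l=1}^dY_l\phi_j(z_l)$; for $\lambda\in\Lambda$, $\widehat S_\lambda(z_l)=\sum_{j=1}^d\lambda(j)\widehat\theta_{j,d}\phi_j(z_l)\mathbf{1}_\Gamma$, extended to $[a,b]$ by $\widehat S_\lambda(t)=\widehat S_\lambda(z_1)$ for $a\le t\le z_1$ and $\widehat S_\lambda(t)=\widehat S_\lambda(z_l)$ for $z_{l-1}<t\le z_l$, $l\ge2$. Let $\mathbf s_{j,d}=\frac{b-a}d\sum_{l=1}^d\sigma_l^2\phi_j^2(z_l)$, $\widetilde\theta_{j,d}=\widehat\theta_{j,d}^2-\frac{b-a}d\mathbf s_{j,d}$, $P_d(\lambda)=\frac{b-a}d\sum_{j=1}^d\lambda^2(j)\mathbf s_{j,d}$, $$J_d(\lambda)=\sum_{j=1}^d\lambda^2(j)\widehat\theta_{j,d}^2-2\sum_{j=1}^d\lambda(j)\widetilde\theta_{j,d}+\delta P_d(\lambda),$$ $\widehat\lambda\in\operatorname{argmin}_{\lambda\in\Lambda}J_d(\lambda)$ and $\widehat S_*=\widehat S_{\widehat\lambda}$. *)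

theory Defs
  imports "HOL-Probability.Probability"
begin

section \<open>The autoregressive model\<close>

definition design :: "real \<Rightarrow> real \<Rightarrow> nat \<Rightarrow> nat \<Rightarrow> real" where
  "design a b n k = a + real k * (b - a) / real n"

primrec ar_path :: "real \<Rightarrow> real \<Rightarrow> nat \<Rightarrow> real \<Rightarrow> (real \<Rightarrow> real) \<Rightarrow> (nat \<Rightarrow> real) \<Rightarrow> nat \<Rightarrow> real" where
  "ar_path a b n y0 S \<xi> 0 = y0"
| "ar_path a b n y0 S \<xi> (Suc k) =
     S (design a b n (Suc k)) * ar_path a b n y0 S \<xi> k + \<xi> (Suc k)"

text \<open>Observations are vectors indexed by \<open>{0..n}\<close>; the coordinate \<open>0\<close> carries the initial value.\<close>

definition obs_space :: "nat \<Rightarrow> (nat \<Rightarrow> real) measure" where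
  "obs_space n = PiM {0..n} (\<lambda>_. borel)"

text \<open>\<open>ar_law a b n y0 p S\<close> is the probability $P_{p,S}$, realised as the law of
  $(y_0,\dots,y_n)$ when $\xi_1,\dots,\xi_n$ are i.i.d. with density \<open>p\<close>.\<close>

definition ar_law ::
  "real \<Rightarrow> real \<Rightarrow> nat \<Rightarrow> real \<Rightarrow> (real \<Rightarrow> real) \<Rightarrow> (real \<Rightarrow> real) \<Rightarrow> (nat \<Rightarrow> real) measure" where
  "ar_law a b n y0 p S =
     distr (PiM {1..n} (\<lambda>_. density lborel (\<lambda>x. ennreal (p x)))) (obs_space n)
           (\<lambda>\<xi>. restrict (ar_path a b n y0 S \<xi>) {0..n})"

text \<open>$(2k-1)!! = 1\cdot 3\cdots(2k-1)$\<close>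

definition odd_double_fact :: "nat \<Rightarrow> real" where
  "odd_double_fact k = (\<Prod>i=1..k. 2 * real i - 1)"

definition noise_densities :: "real \<Rightarrow> (real \<Rightarrow> real) set" where
  "noise_densities s =
     {p. p \<in> borel_measurable borel \<and> (\<forall>x. 0 \<le> p x) \<and>
         has_bochner_integral lborel p 1 \<and>
         has_bochner_integral lborel (\<lambda>x. x * p x) 0 \<and>
         has_bochner_integral lborel (\<lambda>x. x\<^sup>2 * p x) 1 \<and>
         (SUP k\<in>{1..}. (\<integral>\<^sup>+ x. ennreal (\<bar>x\<bar> ^ (2 * k) * p x) \<partial>lborel)
                          / ennreal (s ^ k * odd_double_fact k)) \<le> 1}"

text \<open>Only the values of \<open>S\<close> on \<open>{a..b}\<close> matter; derivatives at the end points are one-sided.\<close>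

definition smooth_class :: "real \<Rightarrow> real \<Rightarrow> real \<Rightarrow> real \<Rightarrow> (real \<Rightarrow> real) set" where
  "smooth_class a b \<epsilon> L =
     {S. (\<forall>x\<in>{a..b}. \<bar>S x\<bar> \<le> 1 - \<epsilon>) \<and>
         (\<exists>S'. continuous_on {a..b} S' \<and>
               (\<forall>x\<in>{a..b}. (S has_real_derivative S' x) (at x within {a..b}) \<and> \<bar>S' x\<bar> \<le> L))}"

text \<open>An estimator maps an observation vector to a function on \<open>{a..b}\<close>. The risk takes values in
  \<open>[0,\<infinity>]\<close>.\<close>

definition robust_risk ::
  "real \<Rightarrow> real \<Rightarrow> nat \<Rightarrow> real \<Rightarrow> real \<Rightarrow> ((nat \<Rightarrow> real) \<Rightarrow> real \<Rightarrow> real) \<Rightarrow> (real \<Rightarrow> real) \<Rightarrow> ennreal" where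
  "robust_risk a b n y0 s est S =
     (SUP p\<in>noise_densities s.
        \<integral>\<^sup>+ y. (\<integral>\<^sup>+ t\<in>{a..b}. ennreal ((est y t - S t)\<^sup>2) \<partial>lborel) \<partial>ar_law a b n y0 p S)"


section \<open>The sequential procedures\<close>

definition num_pts :: "nat \<Rightarrow> nat" where
  "num_pts n = nat \<lfloor>sqrt (real n)\<rfloor>"

definition zpt :: "real \<Rightarrow> real \<Rightarrow> nat \<Rightarrow> nat \<Rightarrow> real" where
  "zpt a b n l = a + real l / real (num_pts n) * (b - a)"

definition bandw :: "real \<Rightarrow> real \<Rightarrow> nat \<Rightarrow> real" where
  "bandw a b n = (b - a) / (2 * real (num_pts n))"

definition zpt_rel :: "real \<Rightarrow> real \<Rightarrow> nat \<Rightarrow> nat \<Rightarrow> real" where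
  "zpt_rel a b n l = (zpt a b n l - a) / (b - a)"

definition bandw_rel :: "real \<Rightarrow> real \<Rightarrow> nat \<Rightarrow> real" where
  "bandw_rel a b n = bandw a b n / (b - a)"

definition Qw :: "real \<Rightarrow> real \<Rightarrow> nat \<Rightarrow> nat \<Rightarrow> nat \<Rightarrow> real" where
  "Qw a b n l j = of_bool (\<bar>design a b n j - zpt a b n l\<bar> \<le> bandw a b n)"

definition k_first :: "real \<Rightarrow> real \<Rightarrow> nat \<Rightarrow> nat \<Rightarrow> nat" where
  "k_first a b n l = nat (\<lfloor>real n * zpt_rel a b n l - real n * bandw_rel a b n\<rfloor> + 1)"

definition k_last :: "real \<Rightarrow> real \<Rightarrow> nat \<Rightarrow> nat \<Rightarrow> nat" where
  "k_last a b n l = min (nat \<lfloor>real n * zpt_rel a b n l + real n * bandw_rel a b n\<rfloor>) n"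

definition burn_in :: "real \<Rightarrow> real \<Rightarrow> real \<Rightarrow> nat \<Rightarrow> nat" where
  "burn_in a b \<mu>0 n = nat \<lfloor>(real n * bandw_rel a b n) powr \<mu>0\<rfloor>"

definition \<iota>idx :: "real \<Rightarrow> real \<Rightarrow> real \<Rightarrow> nat \<Rightarrow> nat \<Rightarrow> nat" where
  "\<iota>idx a b \<mu>0 n l = k_first a b n l + burn_in a b \<mu>0 n"

definition Asum :: "real \<Rightarrow> real \<Rightarrow> nat \<Rightarrow> nat \<Rightarrow> (nat \<Rightarrow> real) \<Rightarrow> nat \<Rightarrow> nat \<Rightarrow> real" where
  "Asum a b n l y k m = (\<Sum>j=k+1..m. Qw a b n l j * (y (j - 1))\<^sup>2)"

definition eps_tilde :: "nat \<Rightarrow> real" where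
  "eps_tilde n = 1 / (2 + ln (real n))"

definition S_init :: "real \<Rightarrow> real \<Rightarrow> real \<Rightarrow> nat \<Rightarrow> nat \<Rightarrow> (nat \<Rightarrow> real) \<Rightarrow> real" where
  "S_init a b \<mu>0 n l y =
     (\<Sum>j=1..\<iota>idx a b \<mu>0 n l. Qw a b n l j * y (j - 1) * y j) / Asum a b n l y 0 (\<iota>idx a b \<mu>0 n l)"

definition S_trunc :: "real \<Rightarrow> real \<Rightarrow> real \<Rightarrow> nat \<Rightarrow> nat \<Rightarrow> (nat \<Rightarrow> real) \<Rightarrow> real" where
  "S_trunc a b \<mu>0 n l y = min (max (S_init a b \<mu>0 n l y) (- 1 + eps_tilde n)) (1 - eps_tilde n)"

definition gamma_tilde :: "real \<Rightarrow> real \<Rightarrow> real \<Rightarrow> nat \<Rightarrow> nat \<Rightarrow> (nat \<Rightarrow> real) \<Rightarrow> real" where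
  "gamma_tilde a b \<mu>0 n l y = 1 - (S_trunc a b \<mu>0 n l y)\<^sup>2"

definition Hthr :: "real \<Rightarrow> real \<Rightarrow> real \<Rightarrow> nat \<Rightarrow> nat \<Rightarrow> (nat \<Rightarrow> real) \<Rightarrow> real" where
  "Hthr a b \<mu>0 n l y =
     (1 - eps_tilde n) / gamma_tilde a b \<mu>0 n l y * (real (k_last a b n l) - real (\<iota>idx a b \<mu>0 n l) - 1)"

definition stop_time :: "real \<Rightarrow> real \<Rightarrow> real \<Rightarrow> nat \<Rightarrow> nat \<Rightarrow> (nat \<Rightarrow> real) \<Rightarrow> nat" where
  "stop_time a b \<mu>0 n l y =
     (let T = {k \<in> {\<iota>idx a b \<mu>0 n l + 1..k_last a b n l}.
                 Hthr a b \<mu>0 n l y \<le> Asum a b n l y (\<iota>idx a b \<mu>0 n l) k}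
      in if T = {} then k_last a b n l else Inf T)"

text \<open>The procedures only make sense for a positive threshold. The sign of \<open>Hthr\<close> does not depend
  on the observations, and the threshold is positive for all \<open>l\<close> once \<open>n\<close> is large. For the finitely
  many \<open>n\<close> where it is not, the event below is empty by convention, so that the resulting
  estimators vanish.\<close>

definition Gam_l :: "real \<Rightarrow> real \<Rightarrow> real \<Rightarrow> nat \<Rightarrow> nat \<Rightarrow> (nat \<Rightarrow> real) \<Rightarrow> bool" where
  "Gam_l a b \<mu>0 n l y \<longleftrightarrow>
     0 < Hthr a b \<mu>0 n l y \<and>
     Hthr a b \<mu>0 n l y \<le> Asum a b n l y (\<iota>idx a b \<mu>0 n l) (k_last a b n l - 1)"

text \<open>Uniquely determined on the event \<open>Gam_l\<close>, and used only there.\<close>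

definition kap :: "real \<Rightarrow> real \<Rightarrow> real \<Rightarrow> nat \<Rightarrow> nat \<Rightarrow> (nat \<Rightarrow> real) \<Rightarrow> real" where
  "kap a b \<mu>0 n l y =
     (let \<tau> = stop_time a b \<mu>0 n l y in
      THE \<kappa>. 0 < \<kappa> \<and> \<kappa> \<le> 1 \<and>
             Asum a b n l y (\<iota>idx a b \<mu>0 n l) (\<tau> - 1) + \<kappa>\<^sup>2 * Qw a b n l \<tau> * (y (\<tau> - 1))\<^sup>2
               = Hthr a b \<mu>0 n l y)"

definition S_seq :: "real \<Rightarrow> real \<Rightarrow> real \<Rightarrow> nat \<Rightarrow> nat \<Rightarrow> (nat \<Rightarrow> real) \<Rightarrow> real" where
  "S_seq a b \<mu>0 n l y =
     (let \<tau> = stop_time a b \<mu>0 n l y in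
      1 / Hthr a b \<mu>0 n l y *
        ((\<Sum>j=\<iota>idx a b \<mu>0 n l + 1..\<tau> - 1. Qw a b n l j * y (j - 1) * y j)
         + kap a b \<mu>0 n l y * Qw a b n l \<tau> * y (\<tau> - 1) * y \<tau>)
      * of_bool (Gam_l a b \<mu>0 n l y))"

definition Gam :: "real \<Rightarrow> real \<Rightarrow> real \<Rightarrow> nat \<Rightarrow> (nat \<Rightarrow> real) \<Rightarrow> bool" where
  "Gam a b \<mu>0 n y \<longleftrightarrow> (\<forall>l\<in>{1..num_pts n}. Gam_l a b \<mu>0 n l y)"

definition Yreg :: "real \<Rightarrow> real \<Rightarrow> real \<Rightarrow> nat \<Rightarrow> nat \<Rightarrow> (nat \<Rightarrow> real) \<Rightarrow> real" where
  "Yreg a b \<mu>0 n l y = S_seq a b \<mu>0 n l y * of_bool (Gam a b \<mu>0 n y)"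

definition sig :: "real \<Rightarrow> real \<Rightarrow> real \<Rightarrow> nat \<Rightarrow> nat \<Rightarrow> (nat \<Rightarrow> real) \<Rightarrow> real" where
  "sig a b \<mu>0 n l y = Hthr a b \<mu>0 n l y powr (- 1 / 2)"


section \<open>Model selection\<close>

definition orthonormal_system :: "real \<Rightarrow> real \<Rightarrow> nat \<Rightarrow> (nat \<Rightarrow> real \<Rightarrow> real) \<Rightarrow> bool" where
  "orthonormal_system a b n \<phi> \<longleftrightarrow>
     (\<forall>i\<in>{1..num_pts n}. \<forall>j\<in>{1..num_pts n}.
        (b - a) / real (num_pts n) * (\<Sum>l=1..num_pts n. \<phi> i (zpt a b n l) * \<phi> j (zpt a b n l))
          = of_bool (i = j))"

text \<open>The cube $[0,1]^d$, as extensional functions so that distinct elements are distinct vectors.\<close>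

definition weight_cube :: "nat \<Rightarrow> (nat \<Rightarrow> real) set" where
  "weight_cube n = {1..num_pts n} \<rightarrow>\<^sub>E {0..1}"

definition theta_hat ::
  "real \<Rightarrow> real \<Rightarrow> real \<Rightarrow> nat \<Rightarrow> (nat \<Rightarrow> real \<Rightarrow> real) \<Rightarrow> nat \<Rightarrow> (nat \<Rightarrow> real) \<Rightarrow> real" where
  "theta_hat a b \<mu>0 n \<phi> j y =
     (b - a) / real (num_pts n) * (\<Sum>l=1..num_pts n. Yreg a b \<mu>0 n l y * \<phi> j (zpt a b n l))"

definition S_lam_pt ::
  "real \<Rightarrow> real \<Rightarrow> real \<Rightarrow> nat \<Rightarrow> (nat \<Rightarrow> real \<Rightarrow> real) \<Rightarrow> (nat \<Rightarrow> real) \<Rightarrow> (nat \<Rightarrow> real) \<Rightarrow> nat \<Rightarrow> real" where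
  "S_lam_pt a b \<mu>0 n \<phi> lam y l =
     (\<Sum>j=1..num_pts n. lam j * theta_hat a b \<mu>0 n \<phi> j y * \<phi> j (zpt a b n l) * of_bool (Gam a b \<mu>0 n y))"

definition S_lam ::
  "real \<Rightarrow> real \<Rightarrow> real \<Rightarrow> nat \<Rightarrow> (nat \<Rightarrow> real \<Rightarrow> real) \<Rightarrow> (nat \<Rightarrow> real) \<Rightarrow> (nat \<Rightarrow> real) \<Rightarrow> real \<Rightarrow> real" where
  "S_lam a b \<mu>0 n \<phi> lam y t =
     indicator {a..zpt a b n 1} t * S_lam_pt a b \<mu>0 n \<phi> lam y 1 +
     (\<Sum>l=2..num_pts n. indicator {zpt a b n (l - 1)<..zpt a b n l} t * S_lam_pt a b \<mu>0 n \<phi> lam y l)"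

definition s_var ::
  "real \<Rightarrow> real \<Rightarrow> real \<Rightarrow> nat \<Rightarrow> (nat \<Rightarrow> real \<Rightarrow> real) \<Rightarrow> nat \<Rightarrow> (nat \<Rightarrow> real) \<Rightarrow> real" where
  "s_var a b \<mu>0 n \<phi> j y =
     (b - a) / real (num_pts n) *
       (\<Sum>l=1..num_pts n. (sig a b \<mu>0 n l y)\<^sup>2 * (\<phi> j (zpt a b n l))\<^sup>2)"

definition theta_tilde ::
  "real \<Rightarrow> real \<Rightarrow> real \<Rightarrow> nat \<Rightarrow> (nat \<Rightarrow> real \<Rightarrow> real) \<Rightarrow> nat \<Rightarrow> (nat \<Rightarrow> real) \<Rightarrow> real" where
  "theta_tilde a b \<mu>0 n \<phi> j y =
     (theta_hat a b \<mu>0 n \<phi> j y)\<^sup>2 - (b - a) / real (num_pts n) * s_var a b \<mu>0 n \<phi> j y"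

definition penalty ::
  "real \<Rightarrow> real \<Rightarrow> real \<Rightarrow> nat \<Rightarrow> (nat \<Rightarrow> real \<Rightarrow> real) \<Rightarrow> (nat \<Rightarrow> real) \<Rightarrow> (nat \<Rightarrow> real) \<Rightarrow> real" where
  "penalty a b \<mu>0 n \<phi> y lam =
     (b - a) / real (num_pts n) * (\<Sum>j=1..num_pts n. (lam j)\<^sup>2 * s_var a b \<mu>0 n \<phi> j y)"

definition cost ::
  "real \<Rightarrow> real \<Rightarrow> real \<Rightarrow> nat \<Rightarrow> (nat \<Rightarrow> real \<Rightarrow> real) \<Rightarrow> real \<Rightarrow> (nat \<Rightarrow> real) \<Rightarrow> (nat \<Rightarrow> real) \<Rightarrow> real" where
  "cost a b \<mu>0 n \<phi> \<delta> y lam =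
     (\<Sum>j=1..num_pts n. (lam j)\<^sup>2 * (theta_hat a b \<mu>0 n \<phi> j y)\<^sup>2)
     - 2 * (\<Sum>j=1..num_pts n. lam j * theta_tilde a b \<mu>0 n \<phi> j y)
     + \<delta> * penalty a b \<mu>0 n \<phi> y lam"

text \<open>A measurable choice, from the observations, of a minimiser of the cost over \<open>\<Lambda>\<close>.\<close>

definition cost_minimiser ::
  "real \<Rightarrow> real \<Rightarrow> real \<Rightarrow> nat \<Rightarrow> (nat \<Rightarrow> real \<Rightarrow> real) \<Rightarrow> (nat \<Rightarrow> real) set \<Rightarrow> real \<Rightarrow>
     ((nat \<Rightarrow> real) \<Rightarrow> nat \<Rightarrow> real) \<Rightarrow> bool" where
  "cost_minimiser a b \<mu>0 n \<phi> \<Lambda> \<delta> lamhat \<longleftrightarrow>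
     lamhat \<in> obs_space n \<rightarrow>\<^sub>M count_space \<Lambda> \<and>
     (\<forall>y\<in>space (obs_space n). is_arg_min (cost a b \<mu>0 n \<phi> \<delta> y) (\<lambda>lam. lam \<in> \<Lambda>) (lamhat y))"

end

theory Submission
  imports Defs "HOL-Real_Asymp.Real_Asymp"
begin

text \<open>On the event \<open>\<Gamma>\<close> each \<open>Y\<^sub>l\<close> equals \<open>S(z\<^sub>l)\<close> plus a weighted sum of the noise with predictable weights plus
  a bias of squared order \<open>1/n\<close>; the weights are such that the predictable variance is exactly
  \<open>\<sigma>\<^sub>l\<^sup>2 = 1/H\<^sub>l\<close>. Writing \<open>\<theta>\<close>, \<open>U\<close>, \<open>\<beta>\<close> for the Fourier coefficients of signal, noise and bias, the comparison of
  the costs of the selected and of a fixed weight vector gives, pathwise, an oracle inequality whose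
  remainder consists of \<open>\<Sum> \<beta>\<^sub>j\<^sup>2\<close> and of the normalised squares of the linear form \<open>\<Sum> w\<^sub>j \<theta>\<^sub>j U\<^sub>j\<close> and of the centred
  quadratic form \<open>\<Sum> w\<^sub>j (U\<^sub>j\<^sup>2 - E U\<^sub>j\<^sup>2)\<close>. Both forms are martingales in the observation index, because
  the windows are disjoint, so their second moments are of order \<open>1/n\<close> up to powers of \<open>\<varsigma>\<close> and \<open>ln n\<close>.
  Off \<open>\<Gamma>\<close> all estimators vanish and there is nothing to compare. Passing between the integrated and the
  discrete error costs the factor \<open>(1 + \<delta>)\<^sup>2\<close>.\<close>

text \<open>Each form is split off by \<open>2 * x \<le> s * D + x\<^sup>2 / D / s\<close>, where
  \<open>D\<close> is the squared length of its coefficients, up to the variance scale, and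
  \<open>s\<close> is proportional to \<delta> wherever the error itself is at stake. The term
  \<open>s * D\<close> is paid by the penalty or by a small multiple of the two errors; the other
  term has mean of order \<open>1 / (\<delta> * n)\<close> up to subpolynomial factors. This is
  where the loss in the leading factor and the \<delta> in the denominator come from. The selected
  weights are functions of the noise, so an expectation can be taken only after the pathwise bound,
  term by term over \<Lambda>; because second moments already have the right order, this union bound
  costs only the subpolynomial cardinality. All bounds are uniform in \<open>S\<close> and
  \<open>p\<close>, as the supremum over densities requires. The order estimates presuppose
  thresholds of order \<surd>n up to a logarithm; for the remaining finitely many \<open>n\<close>
  any finite uniform bound suffices, since only the growth of \<open>B n\<close> is
  restricted.\<close>

section \<open>The pathwise oracle inequality\<close>

text \<open>Division by zero is harmless here: \<open>D = 0\<close> forces \<open>x = 0\<close>.\<close>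

lemma two_mult_le_quotient:
  fixes x D s :: real
  assumes "D = 0 \<Longrightarrow> x = 0" "0 < s" "0 \<le> D"
  shows "2 * x \<le> s * D + x\<^sup>2 / D / s"
proof (cases "D = 0")
  case False
  have "0 \<le> (s * D - x)\<^sup>2 / (s * D)" using assms by auto
  also have "\<dots> = s * D + x\<^sup>2 / D / s - 2 * x"
    using False assms by (simp add: field_simps power2_eq_square)
  finally show ?thesis by simp
qed (use assms in auto)

text \<open>\<open>v\<close> is the selected and \<open>v0\<close> a fixed weight vector,
  \<open>t\<close> the variances and \<open>Z\<close> the squared norm of the signal, so that
  \<open>Err\<close> is the squared error. \<open>Err - J\<close> is affine in the weights except
  for the penalty, hence \<open>J v \<le> J v0\<close> leaves the random forms at
  \<open>v - v0\<close>, \<open>v\<close> and \<open>v0\<close>. The penalty of \<open>v\<close>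
  absorbs the quadratic form at \<open>v\<close>; the penalty of \<open>v0\<close> has the wrong
  sign and is bounded by \<open>Err v0\<close>.\<close>

lemma oracle_inequality_pathwise:
  fixes \<theta> U \<beta> t v v0 :: "nat \<Rightarrow> real" and Z t0 \<delta> :: real and I :: "nat set"
  defines "\<theta>h \<equiv> \<lambda>j. \<theta> j + U j + \<beta> j"
  defines "Err \<equiv> \<lambda>w. (\<Sum>j\<in>I. (w j)\<^sup>2 * (\<theta>h j)\<^sup>2) - 2 * (\<Sum>j\<in>I. w j * \<theta>h j * \<theta> j) + Z"
  defines "J \<equiv> \<lambda>w. (\<Sum>j\<in>I. (w j)\<^sup>2 * (\<theta>h j)\<^sup>2) - 2 * (\<Sum>j\<in>I. w j * ((\<theta>h j)\<^sup>2 - t j)) + \<delta> * (\<Sum>j\<in>I. (w j)\<^sup>2 * t j)"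
  defines "M \<equiv> \<lambda>w. (\<Sum>j\<in>I. w j * \<theta> j * U j)\<^sup>2 / (\<Sum>j\<in>I. (w j)\<^sup>2 * (\<theta> j)\<^sup>2)"
  defines "N \<equiv> \<lambda>w. (\<Sum>j\<in>I. w j * ((U j)\<^sup>2 - t j))\<^sup>2 / (t0 * (\<Sum>j\<in>I. (w j)\<^sup>2))"
  assumes fin: "finite I"
    and v: "\<And>j. j \<in> I \<Longrightarrow> 0 \<le> v j \<and> v j \<le> 1"
    and v0: "\<And>j. j \<in> I \<Longrightarrow> 0 \<le> v0 j \<and> v0 j \<le> 1"
    and t0: "0 < t0" and t: "\<And>j. j \<in> I \<Longrightarrow> t0 \<le> t j"
    and Z: "(\<Sum>j\<in>I. (\<theta> j)\<^sup>2) \<le> Z"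
    and \<delta>: "0 < \<delta>" "\<delta> \<le> 1 / 12"
    and J: "J v \<le> J v0"
  shows "Err v \<le> (1 + 4 * \<delta>) / (1 - 6 * \<delta>) * Err v0
     + 70 / \<delta> * ((\<Sum>j\<in>I. (\<beta> j)\<^sup>2) + M (\<lambda>x. v x - v0 x) + M (\<lambda>x. (v x - v0 x)\<^sup>2)
       + M (\<lambda>x. v0 x * (1 - v0 x)) + N v + N v0 + N (\<lambda>x. (v0 x)\<^sup>2))"
proof -
  define \<mu> where "\<mu> = (\<lambda>x. v x - v0 x)"
  define \<omega> where "\<omega> = (\<lambda>x. v0 x * (1 - v0 x))"
  define m where "m = (\<lambda>w. \<Sum>j\<in>I. w j * \<theta> j * U j)"
  define D where "D = (\<lambda>w. \<Sum>j\<in>I. (w j)\<^sup>2 * (\<theta> j)\<^sup>2)"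
  define nn where "nn = (\<lambda>w. \<Sum>j\<in>I. w j * ((U j)\<^sup>2 - t j))"
  define P where "P = (\<lambda>w. \<Sum>j\<in>I. (w j)\<^sup>2 * t j)"
  define B where "B = (\<Sum>j\<in>I. (\<beta> j)\<^sup>2)"
  have Dnn: "0 \<le> D w" for w by (auto simp: D_def intro!: sum_nonneg)
  have Mq: "M w = (m w)\<^sup>2 / D w" for w by (simp add: M_def m_def D_def)
  have Nq: "N w = (nn w)\<^sup>2 / (t0 * (\<Sum>j\<in>I. (w j)\<^sup>2))" for w by (simp add: N_def nn_def)
  have M0: "0 \<le> M w" and N0: "0 \<le> N w" for w
    using t0 Dnn by (auto simp: Mq Nq intro!: divide_nonneg_nonneg mult_nonneg_nonneg sum_nonneg)
  have B0: "0 \<le> B" by (auto simp: B_def intro!: sum_nonneg)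
  have mz: "m w = 0" if "D w = 0" for w
  proof -
    have "\<forall>j\<in>I. (w j)\<^sup>2 * (\<theta> j)\<^sup>2 = 0"
      using that fin unfolding D_def by (subst (asm) sum_nonneg_eq_0_iff) auto
    then show ?thesis unfolding m_def by (intro sum.neutral) auto
  qed
  have nz: "nn w = 0" if "t0 * (\<Sum>j\<in>I. (w j)\<^sup>2) = 0" for w
  proof -
    have "(\<Sum>j\<in>I. (w j)\<^sup>2) = 0" using that t0 by auto
    then have "\<forall>j\<in>I. (w j)\<^sup>2 = 0" using fin by (subst (asm) sum_nonneg_eq_0_iff) auto
    then show ?thesis unfolding nn_def by (intro sum.neutral) auto
  qed
  have mle: "2 * m w \<le> s * D w + M w / s" if "0 < s" for s w
    unfolding Mq using that mz Dnn by (intro two_mult_le_quotient) auto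
  have mle': "- 2 * m w \<le> s * D w + M w / s" if "0 < s" for s w
    using two_mult_le_quotient[of "D w" "- m w" s] that mz Dnn unfolding Mq by auto
  have Pge: "t0 * (\<Sum>j\<in>I. (w j)\<^sup>2) \<le> P w" for w
    unfolding P_def sum_distrib_left using t by (intro sum_mono) (metis mult.commute mult_left_mono zero_le_power2)
  have nle: "2 * nn w \<le> s * P w + N w / s" "- 2 * nn w \<le> s * P w + N w / s" if "0 < s" for s w
  proof -
    let ?d = "t0 * (\<Sum>j\<in>I. (w j)\<^sup>2)"
    have d0: "0 \<le> ?d" using t0 by (auto intro!: mult_nonneg_nonneg sum_nonneg)
    have "2 * nn w \<le> s * ?d + N w / s" unfolding Nq using that nz d0 by (intro two_mult_le_quotient) auto
    moreover have "2 * (- nn w) \<le> s * ?d + (- nn w)\<^sup>2 / ?d / s" using that nz[of w] d0 by (intro two_mult_le_quotient) auto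
    moreover have "s * ?d \<le> s * P w" using Pge that by (simp add: mult_left_mono)
    ultimately show "2 * nn w \<le> s * P w + N w / s" "- 2 * nn w \<le> s * P w + N w / s" unfolding Nq by auto
  qed
  have \<mu>1: "\<bar>\<mu> j\<bar> \<le> 1" if "j \<in> I" for j using v[OF that] v0[OF that] by (auto simp: \<mu>_def)
  have \<mu>2: "(\<mu> j)\<^sup>2 \<le> 1" if "j \<in> I" for j using \<mu>1[OF that] by (simp add: abs_square_le_1)
  define \<Xi> where "\<Xi> = (\<Sum>j\<in>I. (\<mu> j)\<^sup>2 * (\<theta>h j)\<^sup>2)"
  have \<Xi>0: "0 \<le> \<Xi>" by (auto simp: \<Xi>_def intro!: sum_nonneg)
  have Errge: "(\<Sum>j\<in>I. (w j * \<theta>h j - \<theta> j)\<^sup>2) \<le> Err w" for w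
    using Z unfolding Err_def
    by (simp add: power2_diff power_mult_distrib sum.distrib sum_subtractf sum_distrib_left mult_ac)
  \<comment> \<open>Per coordinate, \<open>(\<theta>h j)\<^sup>2 - \<theta>h j * \<theta> j\<close>
    is \<open>\<theta> j * U j + (U j)\<^sup>2\<close> plus terms with the factor
    \<open>\<beta> j\<close>.\<close>
  have ErrJ: "Err w = J w + 2 * m w + 2 * nn w + (\<Sum>j\<in>I. w j * (4 * \<theta>h j * \<beta> j - 2 * \<theta> j * \<beta> j - 2 * (\<beta> j)\<^sup>2)) + Z - \<delta> * P w" for w
  proof -
    have "Err w - J w - Z + \<delta> * P w = (\<Sum>j\<in>I. 2 * (w j * ((\<theta>h j)\<^sup>2 - t j)) - 2 * (w j * \<theta>h j * \<theta> j))"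
      unfolding Err_def J_def P_def by (simp add: sum_subtractf sum_distrib_left)
    also have "\<dots> = (\<Sum>j\<in>I. 2 * (w j * \<theta> j * U j) + 2 * (w j * ((U j)\<^sup>2 - t j)) + w j * (4 * \<theta>h j * \<beta> j - 2 * \<theta> j * \<beta> j - 2 * (\<beta> j)\<^sup>2))"
      by (intro sum.cong refl) (simp add: \<theta>h_def power2_eq_square algebra_simps)
    also have "\<dots> = 2 * m w + 2 * nn w + (\<Sum>j\<in>I. w j * (4 * \<theta>h j * \<beta> j - 2 * \<theta> j * \<beta> j - 2 * (\<beta> j)\<^sup>2))"
      unfolding m_def nn_def by (simp add: sum.distrib sum_distrib_left)
    finally show ?thesis by simp
  qed
  have m\<mu>: "m v - m v0 = m \<mu>" unfolding m_def \<mu>_def by (simp add: sum_subtractf algebra_simps)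
  have bias: "(\<Sum>j\<in>I. v j * (4 * \<theta>h j * \<beta> j - 2 * \<theta> j * \<beta> j - 2 * (\<beta> j)\<^sup>2))
      - (\<Sum>j\<in>I. v0 j * (4 * \<theta>h j * \<beta> j - 2 * \<theta> j * \<beta> j - 2 * (\<beta> j)\<^sup>2))
     \<le> (\<delta>/10) * \<Xi> + 40 / \<delta> * B + (\<delta>/10) * D \<mu> + 10 / \<delta> * B + 2 * B" (is "?L \<le> _")
  proof -
    have "?L = (\<Sum>j\<in>I. \<mu> j * (4 * \<theta>h j * \<beta> j - 2 * \<theta> j * \<beta> j - 2 * (\<beta> j)\<^sup>2))"
      unfolding \<mu>_def by (simp add: sum_subtractf left_diff_distrib)
    also have "\<dots> \<le> (\<Sum>j\<in>I. (\<delta>/10) * ((\<mu> j)\<^sup>2 * (\<theta>h j)\<^sup>2) + 40 / \<delta> * (\<beta> j)\<^sup>2 + (\<delta>/10) * ((\<mu> j)\<^sup>2 * (\<theta> j)\<^sup>2) + 10 / \<delta> * (\<beta> j)\<^sup>2 + 2 * (\<beta> j)\<^sup>2)"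
    proof (rule sum_mono)
      fix j assume j: "j \<in> I"
      have "0 \<le> (\<delta> * (\<mu> j * \<theta>h j) - 20 * \<beta> j)\<^sup>2 / (10 * \<delta>)" using \<delta> by auto
      then have 1: "4 * (\<mu> j * \<theta>h j * \<beta> j) \<le> (\<delta>/10) * ((\<mu> j)\<^sup>2 * (\<theta>h j)\<^sup>2) + 40 / \<delta> * (\<beta> j)\<^sup>2"
        using \<delta> by (simp add: field_simps power2_eq_square)
      have "0 \<le> (\<delta> * (\<mu> j * \<theta> j) + 10 * \<beta> j)\<^sup>2 / (10 * \<delta>)" using \<delta> by auto
      then have 2: "- 2 * (\<mu> j * \<theta> j * \<beta> j) \<le> (\<delta>/10) * ((\<mu> j)\<^sup>2 * (\<theta> j)\<^sup>2) + 10 / \<delta> * (\<beta> j)\<^sup>2"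
        using \<delta> by (simp add: field_simps power2_eq_square)
      have "- (\<mu> j) * (\<beta> j)\<^sup>2 \<le> 1 * (\<beta> j)\<^sup>2" using \<mu>1[OF j] by (intro mult_right_mono) auto
      with 1 2 show "\<mu> j * (4 * \<theta>h j * \<beta> j - 2 * \<theta> j * \<beta> j - 2 * (\<beta> j)\<^sup>2)
        \<le> (\<delta>/10) * ((\<mu> j)\<^sup>2 * (\<theta>h j)\<^sup>2) + 40 / \<delta> * (\<beta> j)\<^sup>2 + (\<delta>/10) * ((\<mu> j)\<^sup>2 * (\<theta> j)\<^sup>2) + 10 / \<delta> * (\<beta> j)\<^sup>2 + 2 * (\<beta> j)\<^sup>2"
        by (simp add: algebra_simps)
    qed
    also have "\<dots> = (\<delta>/10) * \<Xi> + 40 / \<delta> * B + (\<delta>/10) * D \<mu> + 10 / \<delta> * B + 2 * B"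
      unfolding \<Xi>_def B_def D_def by (simp only: sum.distrib sum_distrib_left)
    finally show ?thesis .
  qed
  have D\<mu>2: "D (\<lambda>x. (\<mu> x)\<^sup>2) \<le> D \<mu>"
    unfolding D_def
  proof (intro sum_mono mult_right_mono)
    fix j assume "j \<in> I"
    then have "(\<mu> j)\<^sup>2 * (\<mu> j)\<^sup>2 \<le> (\<mu> j)\<^sup>2 * 1" using \<mu>2 by (intro mult_left_mono) auto
    then show "((\<mu> j)\<^sup>2)\<^sup>2 \<le> (\<mu> j)\<^sup>2" by (simp add: power2_eq_square)
  qed auto
  have \<Xi>le: "\<Xi> \<le> 2 * (Err v + Err v0)"
  proof -
    have "\<Xi> \<le> (\<Sum>j\<in>I. 2 * (v j * \<theta>h j - \<theta> j)\<^sup>2 + 2 * (v0 j * \<theta>h j - \<theta> j)\<^sup>2)"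
      unfolding \<Xi>_def
    proof (rule sum_mono)
      fix j
      have "0 \<le> ((v j * \<theta>h j - \<theta> j) + (v0 j * \<theta>h j - \<theta> j))\<^sup>2" by simp
      then show "(\<mu> j)\<^sup>2 * (\<theta>h j)\<^sup>2 \<le> 2 * (v j * \<theta>h j - \<theta> j)\<^sup>2 + 2 * (v0 j * \<theta>h j - \<theta> j)\<^sup>2"
        unfolding \<mu>_def by (simp add: power2_eq_square algebra_simps)
    qed
    also have "\<dots> \<le> 2 * (Err v + Err v0)"
      using Errge[of v] Errge[of v0] by (simp add: sum.distrib flip: sum_distrib_left)
    finally show ?thesis .
  qed
  \<comment> \<open>\<open>D \<mu>\<close> contains the unknown signal; \<open>\<Xi>\<close> has the
    estimate in its place. The cross term \<open>2 * ((\<mu> j)\<^sup>2 * \<theta> j * U j)\<close>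
    is a linear form again, which brings the weights \<open>(\<mu> j)\<^sup>2\<close> into the
    remainder.\<close>
  have Dle: "D \<mu> \<le> 2 * \<Xi> + 8 * (M (\<lambda>x. (\<mu> x)\<^sup>2) + B)"
  proof -
    have "D \<mu> + 2 * m (\<lambda>x. (\<mu> x)\<^sup>2) - (1/4) * D (\<lambda>x. (\<mu> x)\<^sup>2) - 4 * B
       = (\<Sum>j\<in>I. (\<mu> j)\<^sup>2 * (\<theta> j)\<^sup>2 + 2 * ((\<mu> j)\<^sup>2 * \<theta> j * U j) - (1/4) * (((\<mu> j)\<^sup>2)\<^sup>2 * (\<theta> j)\<^sup>2) - 4 * (\<beta> j)\<^sup>2)"
      unfolding D_def m_def B_def by (simp add: sum.distrib sum_subtractf sum_distrib_left)
    also have "\<dots> \<le> \<Xi>" unfolding \<Xi>_def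
    proof (rule sum_mono)
      fix j
      have "0 \<le> ((1/2) * (\<mu> j)\<^sup>2 * \<theta> j + 2 * \<beta> j)\<^sup>2 + (\<mu> j)\<^sup>2 * (U j + \<beta> j)\<^sup>2" by simp
      then show "(\<mu> j)\<^sup>2 * (\<theta> j)\<^sup>2 + 2 * ((\<mu> j)\<^sup>2 * \<theta> j * U j) - (1/4) * (((\<mu> j)\<^sup>2)\<^sup>2 * (\<theta> j)\<^sup>2) - 4 * (\<beta> j)\<^sup>2 \<le> (\<mu> j)\<^sup>2 * (\<theta>h j)\<^sup>2"
        unfolding \<theta>h_def by (simp add: power2_eq_square algebra_simps)
    qed
    finally show ?thesis using mle'[of "1/4" "\<lambda>x. (\<mu> x)\<^sup>2"] D\<mu>2 by simp
  qed
  \<comment> \<open>The error of \<open>v0\<close> contains its noise part \<open>V\<close>, and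
    \<open>P v0\<close> is \<open>V\<close> up to a quadratic form with weights
    \<open>(v0 j)\<^sup>2\<close>. Noise and shrinkage error \<open>(1 - v0 j) * \<theta> j\<close>
    interact through a linear form with weights \<open>\<omega>\<close>.\<close>
  have Perr: "P v0 \<le> 4 * Err v0 + 8 * M \<omega> + 12 * B + N (\<lambda>x. (v0 x)\<^sup>2)"
  proof -
    have P4: "P (\<lambda>x. (v0 x)\<^sup>2) \<le> P v0" unfolding P_def
    proof (intro sum_mono mult_right_mono)
      fix j assume "j \<in> I"
      then have "(v0 j)\<^sup>2 * (v0 j)\<^sup>2 \<le> (v0 j)\<^sup>2 * 1" using v0 by (intro mult_left_mono) (auto simp: power_le_one)
      then show "((v0 j)\<^sup>2)\<^sup>2 \<le> (v0 j)\<^sup>2" by (simp add: power2_eq_square)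
      show "0 \<le> t j" using t[OF \<open>j \<in> I\<close>] t0 by simp
    qed
    define V where "V = (\<Sum>j\<in>I. (v0 j)\<^sup>2 * (U j)\<^sup>2)"
    have PV: "P v0 = V - nn (\<lambda>x. (v0 x)\<^sup>2)"
      unfolding P_def V_def nn_def by (simp add: sum_subtractf right_diff_distrib)
    have 1: "P v0 \<le> 2 * V + N (\<lambda>x. (v0 x)\<^sup>2)"
      using nle(2)[of 1 "\<lambda>x. (v0 x)\<^sup>2"] P4 PV by simp
    define G where "G = (\<Sum>j\<in>I. (1 - v0 j)\<^sup>2 * (\<theta> j)\<^sup>2)"
    have DG: "D \<omega> \<le> G" unfolding D_def G_def \<omega>_def power_mult_distrib
    proof (intro sum_mono mult_right_mono)
      fix j assume "j \<in> I"
      then have "(v0 j)\<^sup>2 * (1 - v0 j)\<^sup>2 \<le> 1 * (1 - v0 j)\<^sup>2" using v0 by (intro mult_right_mono) (auto simp: power_le_one)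
      then show "(v0 j)\<^sup>2 * (1 - v0 j)\<^sup>2 \<le> (1 - v0 j)\<^sup>2" by simp
    qed auto
    have "V / 2 - B - 2 * m \<omega> + G - (1/2) * D \<omega> - 2 * B = (\<Sum>j\<in>I. (v0 j)\<^sup>2 * (U j)\<^sup>2 / 2 - (\<beta> j)\<^sup>2 - 2 * (\<omega> j * \<theta> j * U j) + (1 - v0 j)\<^sup>2 * (\<theta> j)\<^sup>2 - (1/2) * ((\<omega> j)\<^sup>2 * (\<theta> j)\<^sup>2) - 2 * (\<beta> j)\<^sup>2)"
      unfolding V_def B_def G_def D_def m_def by (simp only: sum.distrib sum_subtractf sum_distrib_left sum_divide_distrib)
    also have "\<dots> \<le> (\<Sum>j\<in>I. (v0 j * \<theta>h j - \<theta> j)\<^sup>2)"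
    proof (rule sum_mono)
      fix j assume j: "j \<in> I"
      have "0 \<le> ((v0 j) * U j + 2 * (v0 j * \<beta> j))\<^sup>2 / 2 + ((\<omega> j) * \<theta> j - 2 * \<beta> j)\<^sup>2 / 2" by simp
      moreover have "(v0 j)\<^sup>2 * (\<beta> j)\<^sup>2 \<le> 1 * (\<beta> j)\<^sup>2" using v0[OF j] by (intro mult_right_mono) (auto simp: power_le_one)
      ultimately show "(v0 j)\<^sup>2 * (U j)\<^sup>2 / 2 - (\<beta> j)\<^sup>2 - 2 * (\<omega> j * \<theta> j * U j) + (1 - v0 j)\<^sup>2 * (\<theta> j)\<^sup>2 - (1/2) * ((\<omega> j)\<^sup>2 * (\<theta> j)\<^sup>2) - 2 * (\<beta> j)\<^sup>2 \<le> (v0 j * \<theta>h j - \<theta> j)\<^sup>2"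
        unfolding \<theta>h_def \<omega>_def by (simp add: power2_eq_square field_simps)
    qed
    also have "\<dots> \<le> Err v0" by (rule Errge)
    finally have "V \<le> 2 * (Err v0 + 3 * B + 2 * m \<omega> - G + D \<omega> / 2)" by simp
    moreover have "2 * m \<omega> \<le> (1/2) * D \<omega> + 2 * M \<omega>" using mle[of "1/2" \<omega>] by simp
    ultimately have "V \<le> 2 * (Err v0 + 3 * B + 2 * M \<omega>)" using DG by simp
    with 1 show ?thesis by simp
  qed
  have E0: "0 \<le> Err w" for w using Errge[of w] by (rule order_trans[rotated]) (auto intro!: sum_nonneg)
  have D\<Xi>: "2 * D \<mu> + \<Xi> \<le> 10 * (Err v + Err v0) + 16 * (M (\<lambda>x. (\<mu> x)\<^sup>2) + B)" using Dle \<Xi>le by simp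
  \<comment> \<open>Of \<open>9 * \<delta>\<close>, one \<delta> comes from \<open>D\<Xi>\<close>
    and \<open>8 * \<delta>\<close> from \<open>Perr\<close>.\<close>
  have main: "(1 - \<delta>) * Err v \<le> (1 + 9 * \<delta>) * Err v0
     + (10 / \<delta> * M \<mu> + 50 / \<delta> * B + N v / \<delta> + N v0 / \<delta>) + 2 * \<delta> * (M (\<lambda>x. (\<mu> x)\<^sup>2) + B) + 2 * B
     + 2 * \<delta> * (8 * M \<omega> + 12 * B + N (\<lambda>x. (v0 x)\<^sup>2))"
  proof -
    have "Err v \<le> Err v0 + 2 * m \<mu> + 2 * nn v - 2 * nn v0
       + ((\<delta>/10) * \<Xi> + 40 / \<delta> * B + (\<delta>/10) * D \<mu> + 10 / \<delta> * B + 2 * B) - \<delta> * P v + \<delta> * P v0"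
      using bias J ErrJ[of v] ErrJ[of v0] m\<mu> by (simp add: algebra_simps)
    also have "\<dots> \<le> Err v0 + ((\<delta>/10) * D \<mu> + M \<mu> / (\<delta>/10)) + (\<delta> * P v + N v / \<delta>) + (\<delta> * P v0 + N v0 / \<delta>)
       + ((\<delta>/10) * \<Xi> + 40 / \<delta> * B + (\<delta>/10) * D \<mu> + 10 / \<delta> * B + 2 * B) - \<delta> * P v + \<delta> * P v0"
      using mle[of "\<delta>/10" \<mu>] nle(1)[of \<delta> v] nle(2)[of \<delta> v0] \<delta> by simp
    also have "\<dots> = Err v0 + (\<delta>/10) * (2 * D \<mu> + \<Xi>) + 2 * \<delta> * P v0 + (10 / \<delta> * M \<mu> + 50 / \<delta> * B + N v / \<delta> + N v0 / \<delta>) + 2 * B"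
      using \<delta> by (simp add: field_simps)
    also have "\<dots> \<le> Err v0 + (\<delta>/10) * (10 * (Err v + Err v0) + 16 * (M (\<lambda>x. (\<mu> x)\<^sup>2) + B)) + 2 * \<delta> * (4 * Err v0 + 8 * M \<omega> + 12 * B + N (\<lambda>x. (v0 x)\<^sup>2)) + (10 / \<delta> * M \<mu> + 50 / \<delta> * B + N v / \<delta> + N v0 / \<delta>) + 2 * B"
      using \<delta> Perr D\<Xi> by (intro add_mono[where a = "Err v0 + _ + _ + _"] add_mono[where a = "Err v0 + _ + _"] add_mono[where a = "Err v0 + _"] add_mono[where a = "Err v0"] order_refl mult_left_mono) auto
    also have "\<dots> \<le> Err v0 + (\<delta>/10) * (10 * (Err v + Err v0)) + 2 * \<delta> * (M (\<lambda>x. (\<mu> x)\<^sup>2) + B) + 2 * \<delta> * (4 * Err v0 + 8 * M \<omega> + 12 * B + N (\<lambda>x. (v0 x)\<^sup>2)) + (10 / \<delta> * M \<mu> + 50 / \<delta> * B + N v / \<delta> + N v0 / \<delta>) + 2 * B"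
    proof -
      have "(\<delta>/10) * (16 * (M (\<lambda>x. (\<mu> x)\<^sup>2) + B)) \<le> 2 * \<delta> * (M (\<lambda>x. (\<mu> x)\<^sup>2) + B)"
        using mult_right_mono[of "\<delta> * (16/10)" "2 * \<delta>" "M (\<lambda>x. (\<mu> x)\<^sup>2) + B"] M0[of "\<lambda>x. (\<mu> x)\<^sup>2"] B0 \<delta> by simp
      then show ?thesis unfolding distrib_left[of "\<delta>/10" _ "16 * _"] by linarith
    qed
    finally show ?thesis by (simp add: algebra_simps)
  qed
  define R where "R = B + M \<mu> + M (\<lambda>x. (\<mu> x)\<^sup>2) + M \<omega> + N v + N v0 + N (\<lambda>x. (v0 x)\<^sup>2)"
  have small: "c * x \<le> k / \<delta> * x" if "0 \<le> x" "c \<le> k * 12" "0 \<le> k" for c x k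
  proof -
    have "12 \<le> 1 / \<delta>" using \<delta> by (simp add: field_simps)
    then have "k * 12 \<le> k * (1 / \<delta>)" using that by (intro mult_left_mono) auto
    then show ?thesis using that by (intro mult_right_mono) auto
  qed
  have "10 / \<delta> * M \<mu> \<le> 60 / \<delta> * M \<mu>" "N v / \<delta> \<le> 60 / \<delta> * N v" "N v0 / \<delta> \<le> 60 / \<delta> * N v0"
    using M0 N0 \<delta> by (auto simp: field_simps)
  moreover have "2 * \<delta> * M (\<lambda>x. (\<mu> x)\<^sup>2) \<le> 60 / \<delta> * M (\<lambda>x. (\<mu> x)\<^sup>2)"
    "2 * \<delta> * (8 * M \<omega>) \<le> 60 / \<delta> * M \<omega>" "2 * \<delta> * N (\<lambda>x. (v0 x)\<^sup>2) \<le> 60 / \<delta> * N (\<lambda>x. (v0 x)\<^sup>2)"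
    "2 * \<delta> * B + 2 * B + 2 * \<delta> * (12 * B) \<le> 10 / \<delta> * B"
    using small[OF M0, of "2 * \<delta>" 60 "\<lambda>x. (\<mu> x)\<^sup>2"] small[OF M0, of "16 * \<delta>" 60 \<omega>] small[OF N0, of "2 * \<delta>" 60 "\<lambda>x. (v0 x)\<^sup>2"]
      small[OF B0, of "2 * \<delta> + 2 + 24 * \<delta>" 10] \<delta> by (auto simp: algebra_simps)
  moreover have "60 / \<delta> * R = 60 / \<delta> * B + 60 / \<delta> * M \<mu> + 60 / \<delta> * M (\<lambda>x. (\<mu> x)\<^sup>2) + 60 / \<delta> * M \<omega> + 60 / \<delta> * N v + 60 / \<delta> * N v0 + 60 / \<delta> * N (\<lambda>x. (v0 x)\<^sup>2)"
    unfolding R_def by (simp add: distrib_left add_ac)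
  moreover have "50 / \<delta> * B + 10 / \<delta> * B = 60 / \<delta> * B" by (simp add: field_simps)
  ultimately have m2: "(1 - \<delta>) * Err v \<le> (1 + 9 * \<delta>) * Err v0 + 60 / \<delta> * R"
    using main unfolding distrib_left by linarith
  have R0: "0 \<le> R" unfolding R_def using M0 N0 B0 by (intro add_nonneg_nonneg)
  have "Err v \<le> ((1 + 9 * \<delta>) * Err v0 + 60 / \<delta> * R) / (1 - \<delta>)"
    using m2 \<delta> by (simp add: field_simps)
  also have "\<dots> = (1 + 9 * \<delta>) / (1 - \<delta>) * Err v0 + (60 / (1 - \<delta>)) / \<delta> * R"
    unfolding add_divide_distrib[of "_ * _"] by (simp add: mult.commute)
  \<comment> \<open>Both leading factors are \<open>1 + 10 * \<delta>\<close> to first order, so the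
    room is in the quadratic terms only. For the remainder, \<open>\<delta> \<le> 1 / 12\<close>
    gives \<open>60 / (1 - \<delta>) \<le> 720 / 11\<close>.\<close>
  also have "\<dots> \<le> (1 + 4 * \<delta>) / (1 - 6 * \<delta>) * Err v0 + 70 / \<delta> * R"
  proof (intro add_mono mult_right_mono E0 R0 divide_right_mono)
    have "(1 + 9 * \<delta>) * (1 - 6 * \<delta>) \<le> (1 + 4 * \<delta>) * (1 - \<delta>)" by (simp add: algebra_simps)
    then show "(1 + 9 * \<delta>) / (1 - \<delta>) \<le> (1 + 4 * \<delta>) / (1 - 6 * \<delta>)" using \<delta> by (simp add: frac_le_eq divide_le_0_iff frac_less_eq field_simps)
    show "60 / (1 - \<delta>) \<le> 70" using \<delta> by (simp add: field_simps)
  qed (use \<delta> in auto)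
  finally show ?thesis unfolding R_def B_def \<mu>_def \<omega>_def .
qed

section \<open>Moments of martingale sums\<close>

text \<open>Substituting \<open>d = s e\<close> with \<open>s\<^sup>2 = w / W \<le> 1\<close>, every binomial term of order at least two
  in \<open>d\<close> carries a factor \<open>s\<^sup>2\<close>.\<close>

lemma power_add_le_weighted:
  fixes x d w W :: real
  assumes m: "1 \<le> m" and w: "0 < w" "w \<le> W"
  shows "(x + d) ^ (2 * m) \<le> (1 + 4 ^ m * (w / W)) * x ^ (2 * m) + real (2 * m) * (x ^ (2 * m - 1) * d)
     + 4 ^ m * ((W / w) ^ (m - 1) * d ^ (2 * m))"
proof -
  define s where "s = sqrt (w / W)"
  define e where "e = d / s"
  have W: "0 < W" using w by simp
  have s: "0 < s" "s \<le> 1" "s\<^sup>2 = w / W" using w W by (auto simp: s_def)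
  have d: "d = s * e" using s by (simp add: e_def)
  define K where "K = x ^ (2 * m) + e ^ (2 * m)"
  have K0: "0 \<le> K" unfolding K_def by simp
  have hi: "(s * e) ^ i * x ^ (2 * m - i) \<le> s\<^sup>2 * K" if "2 \<le> i" "i \<le> 2 * m" for i
  proof -
    let ?M = "max \<bar>x\<bar> \<bar>e\<bar>"
    have "(s * e) ^ i * x ^ (2 * m - i) \<le> \<bar>(s * e) ^ i * x ^ (2 * m - i)\<bar>" by simp
    also have "\<dots> = s ^ i * (\<bar>e\<bar> ^ i * \<bar>x\<bar> ^ (2 * m - i))"
      using s by (simp add: abs_mult power_abs power_mult_distrib)
    also have "\<dots> \<le> s\<^sup>2 * (?M ^ i * ?M ^ (2 * m - i))"
      using s that w W by (intro mult_mono power_decreasing power_mono) (auto intro!: mult_nonneg_nonneg)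
    also have "?M ^ i * ?M ^ (2 * m - i) = ?M ^ (2 * m)"
      using that by (simp flip: power_add)
    also have "s\<^sup>2 * ?M ^ (2 * m) \<le> s\<^sup>2 * K"
      unfolding K_def by (intro mult_left_mono) (auto simp: max_def power_mult)
    finally show ?thesis .
  qed
  let ?f = "\<lambda>i. real (2 * m choose i) * (s * e) ^ i * x ^ (2 * m - i)"
  have "(x + d) ^ (2 * m) = (\<Sum>i\<le>2 * m. ?f i)"
    unfolding d by (subst add.commute) (rule binomial_ring)
  also have "{..2 * m} = insert 0 (insert 1 {2..2 * m})" using m by auto
  also have "(\<Sum>i\<in>\<dots>. ?f i) = x ^ (2 * m) + real (2 * m) * (x ^ (2 * m - 1) * d) + (\<Sum>i\<in>{2..2 * m}. ?f i)"
    by (simp add: d algebra_simps)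
  also have "(\<Sum>i\<in>{2..2 * m}. ?f i) \<le> (\<Sum>i\<in>{2..2 * m}. real (2 * m choose i) * (s\<^sup>2 * K))"
    using hi by (intro sum_mono) (auto simp: mult.assoc intro!: mult_left_mono)
  also have "\<dots> \<le> (\<Sum>i\<le>2 * m. real (2 * m choose i) * (s\<^sup>2 * K))"
    using K0 by (intro sum_mono2) auto
  also have "\<dots> = 4 ^ m * (s\<^sup>2 * K)"
    using choose_row_sum[of "2 * m"]
    by (simp add: power_mult flip: sum_distrib_right of_nat_sum)
  also have "s\<^sup>2 * K = w / W * x ^ (2 * m) + (W / w) ^ (m - 1) * d ^ (2 * m)"
  proof -
    have "s\<^sup>2 * e ^ (2 * m) = s\<^sup>2 * d ^ (2 * m) / (s\<^sup>2) ^ m"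
      unfolding e_def by (simp add: power_divide power_mult)
    also have "\<dots> = (W / w) ^ (m - 1) * d ^ (2 * m)"
      using m w W unfolding s(3) by (cases m) (auto simp: field_simps)
    finally show ?thesis unfolding K_def distrib_left s(3) by simp
  qed
  finally show ?thesis by (simp add: algebra_simps)
qed

text \<open>A discrete Gronwall argument. The weighted binomial bound gives growth factors
  \<open>1 + 4 ^ m * (w k / W)\<close>, with \<open>W\<close> the sum of all \<open>w k\<close>;
  their product is at most \<open>exp (4 ^ m)\<close> because the ratios sum to one. The constant is
  therefore independent of \<open>n\<close>. The term linear in the increment has mean zero by
  \<open>c0\<close>.\<close>

lemma (in prob_space) martingale_moment_le:
  fixes d :: "nat \<Rightarrow> 'a \<Rightarrow> real" and w :: "nat \<Rightarrow> real"
  assumes m: "1 \<le> m" and B: "0 \<le> B"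
    and w: "\<And>k. k \<in> {1..n} \<Longrightarrow> 0 \<le> w k"
    and w0: "\<And>k x. k \<in> {1..n} \<Longrightarrow> w k = 0 \<Longrightarrow> d k x = 0"
    and X: "\<And>k. k < n \<Longrightarrow> integrable M (\<lambda>x. (\<Sum>j=1..k. d j x) ^ (2 * m))"
    and d: "\<And>k. k \<in> {1..n} \<Longrightarrow> integrable M (\<lambda>x. d k x ^ (2 * m))"
    and dB: "\<And>k. k \<in> {1..n} \<Longrightarrow> expectation (\<lambda>x. d k x ^ (2 * m)) \<le> w k ^ m * B"
    and c: "\<And>k. k < n \<Longrightarrow> integrable M (\<lambda>x. (\<Sum>j=1..k. d j x) ^ (2 * m - 1) * d (Suc k) x)"
    and c0: "\<And>k. k < n \<Longrightarrow> expectation (\<lambda>x. (\<Sum>j=1..k. d j x) ^ (2 * m - 1) * d (Suc k) x) = 0"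
  shows "expectation (\<lambda>x. (\<Sum>j=1..n. d j x) ^ (2 * m)) \<le> exp (4 ^ m) * 4 ^ m * (\<Sum>j=1..n. w j) ^ m * B"
proof -
  define W where "W = (\<Sum>j=1..n. w j)"
  define s where "s = (\<lambda>k. \<Sum>j=1..k. w j)"
  have W0: "0 \<le> W" unfolding W_def using w by (intro sum_nonneg) auto
  show ?thesis
  proof (cases "W = 0")
    case True
    then have "\<forall>k\<in>{1..n}. w k = 0" unfolding W_def using w by (subst (asm) sum_nonneg_eq_0_iff) auto
    then have "(\<Sum>j=1..n. d j x) = 0" for x using w0 by (intro sum.neutral) auto
    then show ?thesis using m B W0 unfolding W_def by (auto simp: power_0_left)
  next
    case False
    then have Wp: "0 < W" using W0 by simp
    have s0: "0 \<le> s k" if "k \<le> n" for k unfolding s_def using w that by (intro sum_nonneg) auto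
    \<comment> \<open>The induction carries the factor \<open>s k\<close>, the part of
      \<open>W\<close> spent by time \<open>k\<close>; at the last step it completes
      \<open>W ^ (m - 1)\<close> to \<open>W ^ m\<close>.\<close>
    have "expectation (\<lambda>x. (\<Sum>j=1..k. d j x) ^ (2 * m)) \<le> exp (4 ^ m * (s k / W)) * (4 ^ m * W ^ (m - 1) * B * s k)"
      if "k \<le> n" for k
      using that
    proof (induction k)
      case 0
      then show ?case using m by (simp add: s_def power_0_left)
    next
      case (Suc k)
      then have k: "k < n" "Suc k \<in> {1..n}" "k \<le> n" by auto
      note IH = Suc.IH[OF k(3)]
      define X where "X = (\<lambda>x. \<Sum>j=1..k. d j x)"
      have sS: "s (Suc k) = s k + w (Suc k)" unfolding s_def by simp
      have XS: "(\<Sum>j=1..Suc k. d j x) = X x + d (Suc k) x" for x unfolding X_def by simp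
      show ?case
      proof (cases "w (Suc k) = 0")
        case True
        then have "d (Suc k) x = 0" for x using w0[OF k(2)] by simp
        then show ?thesis using IH True unfolding XS sS by (simp add: X_def)
      next
        case wn0: False
        define v where "v = w (Suc k)"
        have v: "0 < v" using wn0 w[OF k(2)] unfolding v_def by simp
        have vW: "v \<le> W" unfolding v_def W_def by (rule member_le_sum[OF k(2)]) (use w in auto)
        let ?R = "\<lambda>x. (1 + 4 ^ m * (v / W)) * X x ^ (2 * m) + real (2 * m) * (X x ^ (2 * m - 1) * d (Suc k) x)
           + 4 ^ m * ((W / v) ^ (m - 1) * d (Suc k) x ^ (2 * m))"
        have intR: "integrable M ?R"
          using X[OF k(1)] c[OF k(1)] d[OF k(2)] unfolding X_def by (intro Bochner_Integration.integrable_add integrable_mult_right) auto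
        have "expectation (\<lambda>x. (X x + d (Suc k) x) ^ (2 * m)) \<le> expectation ?R"
        proof (rule integral_mono'[OF intR])
          fix x
          show le: "(X x + d (Suc k) x) ^ (2 * m) \<le> ?R x" by (rule power_add_le_weighted[OF m v vW])
          have "0 \<le> (X x + d (Suc k) x) ^ (2 * m)" by simp
          then show "0 \<le> ?R x" using le by (rule order_trans)
        qed
        also have "\<dots> = (1 + 4 ^ m * (v / W)) * expectation (\<lambda>x. X x ^ (2 * m))
           + 4 ^ m * ((W / v) ^ (m - 1) * expectation (\<lambda>x. d (Suc k) x ^ (2 * m)))"
          using X[OF k(1)] c[OF k(1)] d[OF k(2)] c0[OF k(1)] unfolding X_def by simp
        also have "\<dots> \<le> exp (4 ^ m * (v / W)) * (exp (4 ^ m * (s k / W)) * (4 ^ m * W ^ (m - 1) * B * s k))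
           + 4 ^ m * ((W / v) ^ (m - 1) * (v ^ m * B))"
          using IH dB[OF k(2)] v Wp m unfolding X_def v_def
          by (intro add_mono mult_mono mult_left_mono exp_ge_add_one_self) (auto intro!: integral_nonneg_AE)
        also have "(W / v) ^ (m - 1) * (v ^ m * B) = W ^ (m - 1) * B * v"
          using v m by (cases m) (auto simp: field_simps)
        also have "exp (4 ^ m * (v / W)) * (exp (4 ^ m * (s k / W)) * (4 ^ m * W ^ (m - 1) * B * s k))
            = exp (4 ^ m * (s (Suc k) / W)) * (4 ^ m * W ^ (m - 1) * B * s k)"
          unfolding sS v_def by (simp add: add_divide_distrib distrib_left exp_add mult_ac)
        also have "exp (4 ^ m * (s (Suc k) / W)) * (4 ^ m * W ^ (m - 1) * B * s k) + 4 ^ m * (W ^ (m - 1) * B * v)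
           \<le> exp (4 ^ m * (s (Suc k) / W)) * (4 ^ m * W ^ (m - 1) * B * s k) + exp (4 ^ m * (s (Suc k) / W)) * (4 ^ m * (W ^ (m - 1) * B * v))"
          using mult_right_mono[of 1 "exp (4 ^ m * (s (Suc k) / W))" "4 ^ m * (W ^ (m - 1) * B * v)"] s0[OF Suc.prems] Wp v B
          by simp
        also have "\<dots> = exp (4 ^ m * (s (Suc k) / W)) * (4 ^ m * W ^ (m - 1) * B * s (Suc k))"
          unfolding sS v_def by (simp add: algebra_simps)
        finally show ?thesis unfolding XS .
      qed
    qed
    moreover have "s n = W" unfolding s_def W_def ..
    ultimately have "expectation (\<lambda>x. (\<Sum>j=1..n. d j x) ^ (2 * m)) \<le> exp (4 ^ m) * (4 ^ m * W ^ (m - 1) * B * W)"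
      using Wp by (metis div_self less_irrefl mult.right_neutral order_refl)
    also have "\<dots> = exp (4 ^ m) * 4 ^ m * W ^ m * B" using m by (cases m) auto
    finally show ?thesis unfolding W_def .
  qed
qed

section \<open>The law of the autoregression\<close>

lemma obs_component_measurable [measurable]: "(\<lambda>y. y i) \<in> borel_measurable (obs_space n)"
proof (cases "i \<in> {0..n}")
  case False
  then have "(\<lambda>y. y i) \<in> borel_measurable (obs_space n) \<longleftrightarrow> (\<lambda>_. undefined) \<in> obs_space n \<rightarrow>\<^sub>M (borel :: real measure)"
    by (intro measurable_cong) (auto simp: obs_space_def space_PiM PiE_def extensional_def)
  then show ?thesis by simp
qed (simp add: obs_space_def)

locale ar_model =
  fixes a b y0 :: real and n :: nat and p S :: "real \<Rightarrow> real" and vs \<epsilon> L :: real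
  assumes ab: "a < b" and n: "1 \<le> n" and p: "p \<in> noise_densities vs" and vs: "1 \<le> vs"
    and eps: "0 < \<epsilon>" "\<epsilon> < 1" and S: "S \<in> smooth_class a b \<epsilon> L" and L: "0 < L"
begin

abbreviation "D \<equiv> density lborel (\<lambda>x. ennreal (p x))"
definition "Mn = PiM {1..n} (\<lambda>_. D)"
abbreviation "P \<equiv> ar_law a b n y0 p S"
definition "Sj j = S (design a b n j)"
definition "xi j y = y j - Sj j * y (j - 1)" for j :: nat and y :: "nat \<Rightarrow> real"
definition "traj \<omega> = restrict (ar_path a b n y0 S \<omega>) {0..n}"

lemma p_props: "p \<in> borel_measurable borel" "0 \<le> p x" "has_bochner_integral lborel p 1"
  "has_bochner_integral lborel (\<lambda>x. x * p x) 0" "has_bochner_integral lborel (\<lambda>x. x\<^sup>2 * p x) 1"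
  using p by (auto simp: noise_densities_def)

lemma p_meas [measurable]: "p \<in> borel_measurable borel" by (rule p_props)

lemma prob_space_D: "prob_space D"
proof
  have "emeasure D (space D) = (\<integral>\<^sup>+ x. ennreal (p x) \<partial>lborel)"
    by (simp add: emeasure_density)
  also have "\<dots> = ennreal (integral\<^sup>L lborel p)"
    using p_props by (intro nn_integral_eq_integral) (auto simp: has_bochner_integral_iff)
  also have "\<dots> = 1" using p_props(3) by (simp add: has_bochner_integral_iff)
  finally show "emeasure D (space D) = 1" .
qed

lemma integral_D:
  assumes "g \<in> borel_measurable borel"
  shows "integrable D g \<longleftrightarrow> integrable lborel (\<lambda>x. g x * p x)" "integral\<^sup>L D g = (\<integral>x. g x * p x \<partial>lborel)"
  using assms p_props(2)
  by (simp_all add: integrable_density integral_density mult.commute)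

lemma noise_moment:
  assumes "1 \<le> k"
  shows "integrable D (\<lambda>x. \<bar>x\<bar> ^ (2 * k))" "(\<integral>x. \<bar>x\<bar> ^ (2 * k) \<partial>D) \<le> vs ^ k * odd_double_fact k"
proof -
  have df: "0 < odd_double_fact k" unfolding odd_double_fact_def by (intro prod_pos) auto
  have c: "0 < vs ^ k * odd_double_fact k" using vs df by simp
  have "(\<integral>\<^sup>+ x. ennreal (\<bar>x\<bar> ^ (2 * k) * p x) \<partial>lborel) / ennreal (vs ^ k * odd_double_fact k) \<le> 1"
    using p assms unfolding noise_densities_def by (auto simp: SUP_le_iff)
  then have "(\<integral>\<^sup>+ x. ennreal (\<bar>x\<bar> ^ (2 * k) * p x) \<partial>lborel) / ennreal (vs ^ k * odd_double_fact k) * ennreal (vs ^ k * odd_double_fact k)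
      \<le> 1 * ennreal (vs ^ k * odd_double_fact k)"
    by (rule mult_right_mono) simp
  then have le: "(\<integral>\<^sup>+ x. ennreal (\<bar>x\<bar> ^ (2 * k) * p x) \<partial>lborel) \<le> ennreal (vs ^ k * odd_double_fact k)"
    using c by (simp only: ennreal_divide_times) (subst (asm) ennreal_divide_self, auto simp del: power_eq_0_iff)
  show "integrable D (\<lambda>x. \<bar>x\<bar> ^ (2 * k))"
    unfolding integral_D(1)[of "\<lambda>x. \<bar>x\<bar> ^ (2 * k)", simplified]
    using le p_props(2) by (intro integrableI_nonneg) (auto intro: order_le_less_trans)
  then have i: "integrable lborel (\<lambda>x. \<bar>x\<bar> ^ (2 * k) * p x)" by (simp add: integral_D)
  have "ennreal (\<integral>x. \<bar>x\<bar> ^ (2 * k) * p x \<partial>lborel) \<le> ennreal (vs ^ k * odd_double_fact k)"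
    using le p_props(2) by (subst nn_integral_eq_integral[OF i, symmetric]) auto
  then show "(\<integral>x. \<bar>x\<bar> ^ (2 * k) \<partial>D) \<le> vs ^ k * odd_double_fact k"
    using c by (simp add: integral_D)
qed

lemma noise_abs_moment: "integrable D (\<lambda>x. \<bar>x\<bar> ^ k)"
proof (rule Bochner_Integration.integrable_bound)
  interpret D: prob_space D by (rule prob_space_D)
  show "integrable D (\<lambda>x. 1 + \<bar>x\<bar> ^ (2 * Suc k))"
    using noise_moment(1)[of "Suc k"] by (intro Bochner_Integration.integrable_add) auto
  show "AE x in D. norm (\<bar>x\<bar> ^ k) \<le> norm (1 + \<bar>x\<bar> ^ (2 * Suc k))"
  proof (rule AE_I2)
    fix x :: real
    have "\<bar>x\<bar> ^ k \<le> 1 + \<bar>x\<bar> ^ (2 * Suc k)"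
    proof (cases "\<bar>x\<bar> \<le> 1")
      case True
      then have "\<bar>x\<bar> ^ k \<le> 1" by (simp add: power_le_one)
      then show ?thesis by (rule order_trans) simp
    next
      case False
      then have "\<bar>x\<bar> ^ k \<le> \<bar>x\<bar> ^ (2 * Suc k)" by (intro power_increasing) auto
      then show ?thesis by simp
    qed
    then show "norm (\<bar>x\<bar> ^ k) \<le> norm (1 + \<bar>x\<bar> ^ (2 * Suc k))" by simp
  qed
qed simp

lemma noise_mean: "integrable D (\<lambda>x. x)" "(\<integral>x. x \<partial>D) = 0"
  and noise_var: "integrable D (\<lambda>x. x\<^sup>2)" "(\<integral>x. x\<^sup>2 \<partial>D) = 1"
  using p_props(4,5) by (auto simp: integral_D has_bochner_integral_iff)

lemma noise_centred_square: "integrable D (\<lambda>x. x\<^sup>2 - 1)" "(\<integral>x. x\<^sup>2 - 1 \<partial>D) = 0"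
proof -
  interpret D: prob_space D by (rule prob_space_D)
  show "integrable D (\<lambda>x. x\<^sup>2 - 1)" using noise_var by auto
  show "(\<integral>x. x\<^sup>2 - 1 \<partial>D) = 0" using noise_var D.prob_space by simp
qed

lemma design_mem: "j \<le> n \<Longrightarrow> design a b n j \<in> {a..b}"
proof -
  assume "j \<le> n"
  then have "real j * (b - a) / real n \<le> 1 * (b - a)" "0 \<le> real j * (b - a) / real n"
    using ab n mult_right_mono[of "real j" "real n" "b - a"] by (auto simp: divide_le_eq mult.commute)
  then show ?thesis unfolding design_def by auto
qed

lemma Sj_le: "j \<le> n \<Longrightarrow> \<bar>Sj j\<bar> \<le> 1 - \<epsilon>"
  using design_mem S unfolding Sj_def smooth_class_def by blast

lemma S_lipschitz:
  assumes "x \<in> {a..b}" "y \<in> {a..b}" shows "\<bar>S x - S y\<bar> \<le> L * \<bar>x - y\<bar>"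
proof -
  obtain S' where "\<And>x. x \<in> {a..b} \<Longrightarrow> (S has_real_derivative S' x) (at x within {a..b}) \<and> \<bar>S' x\<bar> \<le> L"
    using S unfolding smooth_class_def by blast
  then show ?thesis
    using field_differentiable_bound[of "{a..b}" S S' L x y] assms by (auto simp: convex_real_interval)
qed

lemma sets_Mn [measurable_cong]: "sets Mn = sets (PiM {1..n} (\<lambda>_. borel))"
  unfolding Mn_def by (rule sets_PiM_cong) auto

lemma ar_path_measurable: "k \<le> n \<Longrightarrow> (\<lambda>\<omega>. ar_path a b n y0 S \<omega> k) \<in> borel_measurable Mn"
proof (induction k)
  case (Suc k)
  have "(\<lambda>\<omega>. \<omega> (Suc k)) \<in> borel_measurable Mn"
    unfolding measurable_cong_sets[OF sets_Mn refl] using Suc.prems by (intro measurable_component_singleton) auto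
  with Suc show ?case by simp
qed simp

lemma component_Mn: "j \<in> {1..n} \<Longrightarrow> (\<lambda>\<omega>. \<omega> j) \<in> borel_measurable Mn"
  unfolding measurable_cong_sets[OF sets_Mn refl] by (rule measurable_component_singleton)

lemma traj_measurable [measurable]: "traj \<in> Mn \<rightarrow>\<^sub>M obs_space n"
  unfolding traj_def obs_space_def by (intro measurable_restrict ar_path_measurable) auto

lemma P_eq: "P = distr Mn (obs_space n) traj"
  unfolding ar_law_def traj_def Mn_def ..

lemma prob_space_Mn: "prob_space Mn"
  unfolding Mn_def by (intro prob_space_PiM prob_space_D)

sublocale P: prob_space P
  unfolding P_eq using traj_measurable prob_space_Mn by (simp add: prob_space.prob_space_distr)

lemma sets_P [measurable_cong, simp]: "sets P = sets (obs_space n)"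
  unfolding P_eq by simp

lemma space_P [simp]: "space P = space (obs_space n)"
  unfolding P_eq by simp

lemma traj_xi: "j \<in> {1..n} \<Longrightarrow> xi j (traj \<omega>) = \<omega> j"
  by (cases j) (auto simp: xi_def traj_def Sj_def)

lemma traj_0: "traj \<omega> 0 = y0"
  by (simp add: traj_def)

lemma AE_y0: "AE y in P. y 0 = y0"
  unfolding P_eq by (subst AE_distr_iff) (auto simp: traj_0)

lemma ar_path_cong: "(\<And>i. 1 \<le> i \<Longrightarrow> i \<le> k \<Longrightarrow> \<omega> i = \<omega>' i) \<Longrightarrow> ar_path a b n y0 S \<omega> k = ar_path a b n y0 S \<omega>' k"
  by (induction k) auto

text \<open>Dependence on the coordinates before \<open>j\<close>, expressed without a filtration.
  For a function measurable on the whole observation space this is enough to factor it through the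
  earlier noise, and it is checked by plain congruence.\<close>

definition past :: "nat \<Rightarrow> ((nat \<Rightarrow> real) \<Rightarrow> real) \<Rightarrow> bool" where
  "past j F \<longleftrightarrow> (\<forall>y y'. (\<forall>i<j. y i = y' i) \<longrightarrow> F y = F y')"

lemma distr_coordinate: "j \<in> {1..n} \<Longrightarrow> distr Mn borel (\<lambda>\<omega>. \<omega> j) = D"
proof -
  assume j: "j \<in> {1..n}"
  have "distr Mn borel (\<lambda>\<omega>. \<omega> j) = distr Mn D (\<lambda>\<omega>. \<omega> j)" by (rule distr_cong) auto
  also have "\<dots> = D" using j prob_space_D unfolding Mn_def by (intro distr_PiM_component) auto
  finally show ?thesis .
qed

lemma indep_coordinates: "prob_space.indep_vars Mn (\<lambda>_. borel) (\<lambda>i \<omega>. \<omega> i) {1..n}"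
proof -
  interpret Mn: prob_space Mn by (rule prob_space_Mn)
  have m: "(\<lambda>\<omega>. \<omega> i) \<in> borel_measurable Mn" if "i \<in> {1..n}" for i using component_Mn that .
  have "distr Mn (PiM {1..n} (\<lambda>_. borel)) (\<lambda>x. \<lambda>i\<in>{1..n}. x i) = distr Mn Mn (\<lambda>x. x)"
    using sets_Mn by (intro distr_cong) (auto simp: Mn_def space_PiM PiE_def extensional_restrict)
  also have "\<dots> = PiM {1..n} (\<lambda>i. distr Mn borel (\<lambda>\<omega>. \<omega> i))"
    using distr_coordinate by (subst PiM_cong[of _ "{1..n}" _ "\<lambda>_. D"]) (auto simp: Mn_def)
  finally show ?thesis
    using n m by (subst Mn.indep_vars_iff_distr_eq_PiM') auto
qed

lemma indep_past_noise:
  assumes j: "j \<in> {1..n}" and F: "F \<in> borel_measurable (obs_space n)" "past j F"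
  shows "prob_space.indep_var Mn borel (\<lambda>\<omega>. F (traj \<omega>)) borel (\<lambda>\<omega>. \<omega> j)"
proof -
  interpret Mn: prob_space Mn by (rule prob_space_Mn)
  let ?A = "{1..<j}" and ?B = "{j}"
  have "Mn.indep_var (PiM ?A (\<lambda>_. borel)) (\<lambda>\<omega>. restrict (\<lambda>i. \<omega> i) ?A) (PiM ?B (\<lambda>_. borel)) (\<lambda>\<omega>. restrict (\<lambda>i. \<omega> i) ?B)"
    using j by (intro Mn.indep_var_restrict[OF indep_coordinates]) auto
  \<comment> \<open>\<open>G\<close> computes \<open>F\<close> from the noise before
    \<open>j\<close> alone: the later noise is frozen at \<open>0\<close>, which changes the
    trajectory only from time \<open>j\<close> on, where \<open>F\<close> does not look.\<close>
  moreover define G where "G = (\<lambda>\<eta>::nat \<Rightarrow> real. F (traj (\<lambda>i\<in>{1..n}. if i < j then \<eta> i else 0)))"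
  have "(\<lambda>\<eta>. \<lambda>i\<in>{1..n}. if i < j then \<eta> i else (0::real)) \<in> PiM ?A (\<lambda>_. borel) \<rightarrow>\<^sub>M Mn"
    unfolding measurable_cong_sets[OF refl sets_Mn]
  proof (rule measurable_restrict)
    fix i assume "i \<in> {1..n}"
    then show "(\<lambda>\<eta>. if i < j then \<eta> i else 0) \<in> PiM ?A (\<lambda>_. borel) \<rightarrow>\<^sub>M borel"
      by (cases "i < j") (auto intro!: measurable_component_singleton)
  qed
  then have "G \<in> borel_measurable (PiM ?A (\<lambda>_. borel))"
    unfolding G_def by (intro measurable_compose[OF _ F(1)] measurable_compose[OF _ traj_measurable])
  moreover have "(\<lambda>\<eta>. \<eta> j) \<in> borel_measurable (PiM ?B (\<lambda>_. borel))" by (intro measurable_component_singleton) auto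
  ultimately have "Mn.indep_var borel (G \<circ> (\<lambda>\<omega>. restrict (\<lambda>i. \<omega> i) ?A)) borel ((\<lambda>\<eta>. \<eta> j) \<circ> (\<lambda>\<omega>. restrict (\<lambda>i. \<omega> i) ?B))"
    by (rule Mn.indep_var_compose)
  moreover have "G \<circ> (\<lambda>\<omega>. restrict (\<lambda>i. \<omega> i) ?A) = (\<lambda>\<omega>. F (traj \<omega>))"
  proof
    fix \<omega>
    have "traj (\<lambda>i\<in>{1..n}. if i < j then restrict \<omega> ?A i else 0) k = traj \<omega> k" if "k < j" for k
      unfolding traj_def using that j by (auto intro!: ar_path_cong)
    then have "F (traj (\<lambda>i\<in>{1..n}. if i < j then restrict \<omega> ?A i else 0)) = F (traj \<omega>)"
      using F(2) unfolding past_def by blast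
    then show "(G \<circ> (\<lambda>\<omega>. restrict (\<lambda>i. \<omega> i) ?A)) \<omega> = F (traj \<omega>)"
      unfolding G_def comp_def .
  qed
  ultimately show ?thesis by (simp add: comp_def)
qed

lemma integral_P: "F \<in> borel_measurable (obs_space n) \<Longrightarrow> integral\<^sup>L P F = (\<integral>\<omega>. F (traj \<omega>) \<partial>Mn)" for F :: "_ \<Rightarrow> real"
  unfolding P_eq by (rule integral_distr) auto

lemma integrable_P: "F \<in> borel_measurable (obs_space n) \<Longrightarrow> integrable P F \<longleftrightarrow> integrable Mn (\<lambda>\<omega>. F (traj \<omega>))" for F :: "_ \<Rightarrow> real"
  unfolding P_eq by (rule integrable_distr_eq) auto

lemma xi_measurable [measurable]: "xi j \<in> borel_measurable (obs_space n)"
  unfolding xi_def by measurable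

lemma noise_transfer:
  fixes g :: "real \<Rightarrow> real"
  assumes j: "j \<in> {1..n}" and [measurable]: "g \<in> borel_measurable borel"
  shows "integrable P (\<lambda>y. g (xi j y)) \<longleftrightarrow> integrable D g" "(\<integral>y. g (xi j y) \<partial>P) = integral\<^sup>L D g"
proof -
  note component_Mn[OF j, measurable]
  show "integrable P (\<lambda>y. g (xi j y)) \<longleftrightarrow> integrable D g"
    by (subst distr_coordinate[OF j, symmetric], subst integrable_distr_eq) (auto simp: integrable_P traj_xi[OF j])
  show "(\<integral>y. g (xi j y) \<partial>P) = integral\<^sup>L D g"
    by (subst distr_coordinate[OF j, symmetric], subst integral_distr) (auto simp: integral_P traj_xi[OF j])
qed

text \<open>Plays the part of conditioning on the past: the current noise integrates out of any
  product with an earlier quantity.\<close>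

lemma past_noise_integral:
  fixes g :: "real \<Rightarrow> real"
  assumes j: "j \<in> {1..n}" and [measurable]: "F \<in> borel_measurable (obs_space n)" and F: "past j F"
    and [measurable]: "g \<in> borel_measurable borel" and "integrable P F" "integrable D g"
  shows "integrable P (\<lambda>y. F y * g (xi j y))" "(\<integral>y. F y * g (xi j y) \<partial>P) = integral\<^sup>L P F * integral\<^sup>L D g"
proof -
  interpret Mn: prob_space Mn by (rule prob_space_Mn)
  have gm: "(\<lambda>y. g (xi j y)) \<in> borel_measurable (obs_space n)" "(\<lambda>y. F y * g (xi j y)) \<in> borel_measurable (obs_space n)"
    by measurable
  have iF: "integrable Mn (\<lambda>\<omega>. F (traj \<omega>))" using assms(5) integrable_P[OF assms(2)] by blast
  have ig: "integrable Mn (\<lambda>\<omega>. g (\<omega> j))"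
    using noise_transfer(1)[OF j assms(4)] assms(6) integrable_P[OF gm(1)] unfolding traj_xi[OF j] by blast
  have "Mn.indep_var borel ((\<lambda>x. x) \<circ> (\<lambda>\<omega>. F (traj \<omega>))) borel (g \<circ> (\<lambda>\<omega>. \<omega> j))"
    by (rule Mn.indep_var_compose[OF indep_past_noise[OF j assms(2) F]]) (use assms(4) in auto)
  then have ind: "Mn.indep_var borel (\<lambda>\<omega>. F (traj \<omega>)) borel (\<lambda>\<omega>. g (\<omega> j))" unfolding comp_def .
  show "integrable P (\<lambda>y. F y * g (xi j y))"
    using Mn.indep_var_integrable[OF ind iF ig] integrable_P[OF gm(2)] unfolding traj_xi[OF j] by blast
  have "(\<integral>y. F y * g (xi j y) \<partial>P) = (\<integral>\<omega>. F (traj \<omega>) * g (\<omega> j) \<partial>Mn)"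
    using integral_P[OF gm(2)] unfolding traj_xi[OF j] .
  also have "\<dots> = (\<integral>\<omega>. F (traj \<omega>) \<partial>Mn) * (\<integral>\<omega>. g (\<omega> j) \<partial>Mn)" by (rule Mn.indep_var_lebesgue_integral[OF ind iF ig])
  also have "(\<integral>\<omega>. g (\<omega> j) \<partial>Mn) = integral\<^sup>L D g"
    using noise_transfer(2)[OF j assms(4)] integral_P[OF gm(1)] unfolding traj_xi[OF j] by simp
  finally show "(\<integral>y. F y * g (xi j y) \<partial>P) = integral\<^sup>L P F * integral\<^sup>L D g" using integral_P[OF assms(2)] by simp
qed

end

section \<open>Functions with all moments, and predictability\<close>

lemma sum_power_le: "(x + y) ^ k \<le> 2 ^ k * (x ^ k + y ^ k)" if "0 \<le> x" "0 \<le> y" for x y :: real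
proof -
  have "(x + y) ^ k \<le> (2 * max x y) ^ k" using that by (intro power_mono) auto
  also have "\<dots> \<le> 2 ^ k * (x ^ k + y ^ k)" using that by (auto simp: power_mult_distrib max_def)
  finally show ?thesis .
qed

text \<open>Convexity of the power by induction: the defect is
  \<open>(1 - \<epsilon>) * \<epsilon>\<close> times \<open>(u - v) * (u ^ k - v ^ k)\<close>, and
  these two differences have the same sign.\<close>

lemma convex_combination_power_le:
  fixes u v \<epsilon> :: real
  assumes "0 \<le> u" "0 \<le> v" "0 \<le> \<epsilon>" "\<epsilon> \<le> 1"
  shows "((1 - \<epsilon>) * u + \<epsilon> * v) ^ k \<le> (1 - \<epsilon>) * u ^ k + \<epsilon> * v ^ k"
proof (induction k)
  case (Suc k)
  have "((1 - \<epsilon>) * u + \<epsilon> * v) ^ Suc k \<le> ((1 - \<epsilon>) * u + \<epsilon> * v) * ((1 - \<epsilon>) * u ^ k + \<epsilon> * v ^ k)"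
    using Suc assms by (auto intro!: mult_left_mono)
  also have "\<dots> = (1 - \<epsilon>) * u ^ Suc k + \<epsilon> * v ^ Suc k - (1 - \<epsilon>) * \<epsilon> * ((u - v) * (u ^ k - v ^ k))"
    by (simp add: algebra_simps)
  also have "0 \<le> (u - v) * (u ^ k - v ^ k)"
    using assms power_mono[of u v k] power_mono[of v u k] by (cases "u \<le> v") (simp_all add: mult_nonpos_nonpos)
  then have "(1 - \<epsilon>) * u ^ Suc k + \<epsilon> * v ^ Suc k - (1 - \<epsilon>) * \<epsilon> * ((u - v) * (u ^ k - v ^ k)) \<le> (1 - \<epsilon>) * u ^ Suc k + \<epsilon> * v ^ Suc k"
    using assms by (simp add: mult_nonneg_nonneg)
  finally show ?case .
qed simp

context ar_model
begin

text \<open>This class is closed under sums and products and contains the noise and the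
  observations, so integrability of any polynomial in them is a structural matter.
  \<open>moments_dom\<close> adds the weights of the estimators, which are not polynomial.\<close>

definition moments :: "((nat \<Rightarrow> real) \<Rightarrow> real) \<Rightarrow> bool" where
  "moments f \<longleftrightarrow> f \<in> borel_measurable (obs_space n) \<and> (\<forall>k. integrable P (\<lambda>y. \<bar>f y\<bar> ^ k))"

lemma moments_measurable: "moments f \<Longrightarrow> f \<in> borel_measurable (obs_space n)" by (simp add: moments_def)

lemma moments_integrable: "moments f \<Longrightarrow> integrable P f"
proof -
  assume f: "moments f"
  then have "integrable P (\<lambda>y. \<bar>f y\<bar> ^ 1)" unfolding moments_def by blast
  then show ?thesis using moments_measurable[OF f] by (simp add: integrable_abs_iff measurable_cong_sets[OF sets_P refl])
qed

lemma moments_const: "moments (\<lambda>_. c)" unfolding moments_def by simp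

lemma moments_dom:
  assumes g: "moments g" and [measurable]: "f \<in> borel_measurable (obs_space n)" and le: "\<And>y. \<bar>f y\<bar> \<le> C * \<bar>g y\<bar>"
  shows "moments f"
  unfolding moments_def
proof (intro conjI allI)
  fix k
  show "integrable P (\<lambda>y. \<bar>f y\<bar> ^ k)"
  proof (rule Bochner_Integration.integrable_bound)
    show "integrable P (\<lambda>y. C ^ k * \<bar>g y\<bar> ^ k)" using g by (simp add: moments_def)
    show "AE y in P. norm (\<bar>f y\<bar> ^ k) \<le> norm (C ^ k * \<bar>g y\<bar> ^ k)"
    proof (rule AE_I2)
      fix y
      have "\<bar>f y\<bar> ^ k \<le> (C * \<bar>g y\<bar>) ^ k" using le by (intro power_mono) auto
      also have "\<dots> \<le> \<bar>C ^ k * \<bar>g y\<bar> ^ k\<bar>" by (simp add: power_mult_distrib)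
      finally show "norm (\<bar>f y\<bar> ^ k) \<le> norm (C ^ k * \<bar>g y\<bar> ^ k)" by simp
    qed
  qed measurable
qed fact

lemma moments_add:
  assumes f: "moments f" and g: "moments g" shows "moments (\<lambda>y. f y + g y)"
  unfolding moments_def
proof (intro conjI allI)
  note [measurable] = moments_measurable[OF f] moments_measurable[OF g]
  show "(\<lambda>y. f y + g y) \<in> borel_measurable (obs_space n)" by measurable
  fix k
  show "integrable P (\<lambda>y. \<bar>f y + g y\<bar> ^ k)"
  proof (rule Bochner_Integration.integrable_bound)
    show "integrable P (\<lambda>y. 2 ^ k * (\<bar>f y\<bar> ^ k + \<bar>g y\<bar> ^ k))" using f g by (simp add: moments_def)
    show "AE y in P. norm (\<bar>f y + g y\<bar> ^ k) \<le> norm (2 ^ k * (\<bar>f y\<bar> ^ k + \<bar>g y\<bar> ^ k))"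
    proof (rule AE_I2)
      fix y
      have "\<bar>f y + g y\<bar> ^ k \<le> (\<bar>f y\<bar> + \<bar>g y\<bar>) ^ k" by (intro power_mono) auto
      also have "\<dots> \<le> 2 ^ k * (\<bar>f y\<bar> ^ k + \<bar>g y\<bar> ^ k)" by (rule sum_power_le) auto
      finally show "norm (\<bar>f y + g y\<bar> ^ k) \<le> norm (2 ^ k * (\<bar>f y\<bar> ^ k + \<bar>g y\<bar> ^ k))" by simp
    qed
  qed measurable
qed

lemma moments_mult:
  assumes f: "moments f" and g: "moments g" shows "moments (\<lambda>y. f y * g y)"
  unfolding moments_def
proof (intro conjI allI)
  note [measurable] = moments_measurable[OF f] moments_measurable[OF g]
  show "(\<lambda>y. f y * g y) \<in> borel_measurable (obs_space n)" by measurable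
  fix k
  show "integrable P (\<lambda>y. \<bar>f y * g y\<bar> ^ k)"
  proof (rule Bochner_Integration.integrable_bound)
    show "integrable P (\<lambda>y. \<bar>f y\<bar> ^ (2 * k) + \<bar>g y\<bar> ^ (2 * k))"
      using f g unfolding moments_def by (intro Bochner_Integration.integrable_add) blast+
    show "AE y in P. norm (\<bar>f y * g y\<bar> ^ k) \<le> norm (\<bar>f y\<bar> ^ (2 * k) + \<bar>g y\<bar> ^ (2 * k))"
    proof (rule AE_I2)
      fix y
      have "2 * (\<bar>f y\<bar> ^ k * \<bar>g y\<bar> ^ k) \<le> (\<bar>f y\<bar> ^ k)\<^sup>2 + (\<bar>g y\<bar> ^ k)\<^sup>2"
        using sum_squares_bound[of "\<bar>f y\<bar> ^ k" "\<bar>g y\<bar> ^ k"] by simp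
      moreover have "0 \<le> \<bar>f y\<bar> ^ k * \<bar>g y\<bar> ^ k" by simp
      ultimately have "\<bar>f y\<bar> ^ k * \<bar>g y\<bar> ^ k \<le> (\<bar>f y\<bar> ^ k)\<^sup>2 + (\<bar>g y\<bar> ^ k)\<^sup>2" by linarith
      then show "norm (\<bar>f y * g y\<bar> ^ k) \<le> norm (\<bar>f y\<bar> ^ (2 * k) + \<bar>g y\<bar> ^ (2 * k))"
        by (simp add: abs_mult power_mult_distrib flip: power_mult) (simp add: mult.commute)
    qed
  qed measurable
qed

lemma moments_sum: "(\<And>i. i \<in> I \<Longrightarrow> moments (f i)) \<Longrightarrow> moments (\<lambda>y. \<Sum>i\<in>I. f i y)"
  by (induction I rule: infinite_finite_induct) (auto intro: moments_const moments_add)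

lemma moments_power: "moments f \<Longrightarrow> moments (\<lambda>y. f y ^ k)"
  by (induction k) (auto intro: moments_const moments_mult)

lemma moments_uminus: "moments f \<Longrightarrow> moments (\<lambda>y. - f y)"
  using moments_mult[OF moments_const[of "-1"]] by simp

lemma moments_diff: "moments f \<Longrightarrow> moments g \<Longrightarrow> moments (\<lambda>y. f y - g y)"
  using moments_add[of f "\<lambda>y. - g y"] moments_uminus[of g] by simp

lemma moments_xi: "j \<in> {1..n} \<Longrightarrow> moments (xi j)"
  unfolding moments_def using noise_transfer(1)[of j "\<lambda>x. \<bar>x\<bar> ^ k" for k] noise_abs_moment by simp

lemma moments_y: "k \<le> n \<Longrightarrow> moments (\<lambda>y. y k)"
proof (induction k)
  case 0
  have "AE y in P. \<bar>y 0\<bar> ^ k = \<bar>y0\<bar> ^ k" for k using AE_y0 by eventually_elim simp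
  then have "integrable P (\<lambda>y. \<bar>y 0\<bar> ^ k)" for k
    by (subst integrable_cong_AE[where g = "\<lambda>_. \<bar>y0\<bar> ^ k"]) auto
  then show ?case unfolding moments_def by simp
next
  case (Suc k)
  have "moments (\<lambda>y. Sj (Suc k) * y k + xi (Suc k) y)"
    using Suc by (intro moments_add moments_mult moments_const moments_xi) auto
  then show ?case by (simp add: xi_def)
qed

definition predictable :: "nat \<Rightarrow> ((nat \<Rightarrow> real) \<Rightarrow> real) \<Rightarrow> bool" where
  "predictable j F \<longleftrightarrow> moments F \<and> past j F"

lemma past_mono: "past i F \<Longrightarrow> i \<le> j \<Longrightarrow> past j F" unfolding past_def by (meson less_le_trans)

lemma predictable_moments: "predictable j F \<Longrightarrow> moments F" by (simp add: predictable_def)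
lemma predictable_mono: "predictable i F \<Longrightarrow> i \<le> j \<Longrightarrow> predictable j F" unfolding predictable_def using past_mono by blast
lemma predictable_const: "predictable j (\<lambda>_. c)" unfolding predictable_def past_def by (simp add: moments_const)
lemma predictable_add: "predictable j F \<Longrightarrow> predictable j G \<Longrightarrow> predictable j (\<lambda>y. F y + G y)"
  unfolding predictable_def past_def by (metis moments_add)
lemma predictable_diff: "predictable j F \<Longrightarrow> predictable j G \<Longrightarrow> predictable j (\<lambda>y. F y - G y)"
  unfolding predictable_def past_def by (metis moments_diff)
lemma predictable_mult: "predictable j F \<Longrightarrow> predictable j G \<Longrightarrow> predictable j (\<lambda>y. F y * G y)"
  unfolding predictable_def past_def by (metis moments_mult)
lemma predictable_power: "predictable j F \<Longrightarrow> predictable j (\<lambda>y. F y ^ k)"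
  by (induction k) (auto intro: predictable_const predictable_mult)
lemma predictable_sum: "(\<And>i. i \<in> I \<Longrightarrow> predictable j (F i)) \<Longrightarrow> predictable j (\<lambda>y. \<Sum>i\<in>I. F i y)"
  by (induction I rule: infinite_finite_induct) (auto intro: predictable_const predictable_add)
lemma predictable_xi: "1 \<le> i \<Longrightarrow> i < j \<Longrightarrow> i \<le> n \<Longrightarrow> predictable j (xi i)"
  unfolding predictable_def past_def by (auto simp: moments_xi xi_def)

lemma predictable_noise_integral:
  assumes "j \<in> {1..n}" "predictable j F" "g \<in> borel_measurable borel" "integrable D g"
  shows "(\<integral>y. F y * g (xi j y) \<partial>P) = integral\<^sup>L P F * integral\<^sup>L D g"
  using assms unfolding predictable_def by (blast intro: past_noise_integral(2) moments_measurable moments_integrable)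

lemma noise_mult_moment:
  assumes j: "j \<in> {1..n}" and F: "predictable j F" and nn: "\<And>y. 0 \<le> F y" and k: "1 \<le> k"
  shows "(\<integral>y. F y * xi j y ^ (2 * k) \<partial>P) \<le> (\<integral>y. F y \<partial>P) * (vs ^ k * odd_double_fact k)"
proof -
  have i: "integrable D (\<lambda>x. x ^ (2 * k))" using noise_moment(1)[OF k] by (simp add: power_mult)
  have "(\<integral>y. F y * xi j y ^ (2 * k) \<partial>P) = (\<integral>y. F y \<partial>P) * (\<integral>x. x ^ (2 * k) \<partial>D)"
    by (rule predictable_noise_integral[OF j F _ i]) simp
  also have "\<dots> \<le> (\<integral>y. F y \<partial>P) * (vs ^ k * odd_double_fact k)"
    using noise_moment(2)[OF k] nn by (intro mult_left_mono integral_nonneg_AE) (auto simp: power_mult)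
  finally show ?thesis .
qed

text \<open>Orthogonality to all predictable factors replaces a vanishing conditional expectation.
  It is what the linear term in \<open>martingale_moment_le\<close> asks for, and it is stable under
  predictable multipliers. \<open>Suc j\<close> makes \<open>d\<close> a function of the coordinates
  up to and including \<open>j\<close>.\<close>

definition mart_diff :: "nat \<Rightarrow> ((nat \<Rightarrow> real) \<Rightarrow> real) \<Rightarrow> bool" where
  "mart_diff j d \<longleftrightarrow> predictable (Suc j) d \<and> (\<forall>F. predictable j F \<longrightarrow> (\<integral>y. F y * d y \<partial>P) = 0)"

lemma mart_diff_add: "mart_diff j d \<Longrightarrow> mart_diff j e \<Longrightarrow> mart_diff j (\<lambda>y. d y + e y)"
  unfolding mart_diff_def
  by (auto simp: distrib_left moments_integrable moments_mult predictable_moments Bochner_Integration.integral_add intro: predictable_add)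

lemma mart_diff_mult: "predictable j G \<Longrightarrow> mart_diff j d \<Longrightarrow> mart_diff j (\<lambda>y. G y * d y)"
  unfolding mart_diff_def
proof (intro conjI allI impI)
  fix F assume G: "predictable j G" and d: "predictable (Suc j) d \<and> (\<forall>F. predictable j F \<longrightarrow> (\<integral>y. F y * d y \<partial>P) = 0)"
  show "predictable (Suc j) (\<lambda>y. G y * d y)" using predictable_mult predictable_mono[OF G, of "Suc j"] d by auto
  assume F: "predictable j F"
  show "(\<integral>y. F y * (G y * d y) \<partial>P) = 0" using d predictable_mult[OF F G] by (auto simp: mult.assoc)
qed

lemma noise_mult_square:
  assumes j: "j \<in> {1..n}" and F: "predictable j F"
  shows "(\<integral>y. F y * (xi j y)\<^sup>2 \<partial>P) = (\<integral>y. F y \<partial>P)"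
  using predictable_noise_integral[OF j F _ noise_var(1)] noise_var(2) by simp

lemma mart_diff_xi: "j \<in> {1..n} \<Longrightarrow> mart_diff j (xi j)"
  unfolding mart_diff_def
proof (intro conjI allI impI)
  assume j: "j \<in> {1..n}"
  then show "predictable (Suc j) (xi j)" by (intro predictable_xi) auto
  fix F assume "predictable j F"
  from predictable_noise_integral[OF j this _ noise_mean(1)]
  show "(\<integral>y. F y * xi j y \<partial>P) = 0" by (simp add: noise_mean(2))
qed

lemma mart_diff_square: "j \<in> {1..n} \<Longrightarrow> mart_diff j (\<lambda>y. (xi j y)\<^sup>2 - 1)"
  unfolding mart_diff_def
proof (intro conjI allI impI)
  assume j: "j \<in> {1..n}"
  then show "predictable (Suc j) (\<lambda>y. (xi j y)\<^sup>2 - 1)" by (intro predictable_diff predictable_power predictable_const predictable_xi) auto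
  fix F assume "predictable j F"
  from predictable_noise_integral[OF j this _ noise_centred_square(1)]
  show "(\<integral>y. F y * ((xi j y)\<^sup>2 - 1) \<partial>P) = 0" by (simp add: noise_centred_square(2))
qed

lemma mart_diff_sum_moment_le:
  fixes w :: "nat \<Rightarrow> real"
  assumes m: "1 \<le> m" and B: "0 \<le> B"
    and d: "\<And>j. j \<in> {1..n} \<Longrightarrow> mart_diff j (d j)"
    and w: "\<And>j. j \<in> {1..n} \<Longrightarrow> 0 \<le> w j"
    and w0: "\<And>j y. j \<in> {1..n} \<Longrightarrow> w j = 0 \<Longrightarrow> d j y = 0"
    and dB: "\<And>j. j \<in> {1..n} \<Longrightarrow> 0 < w j \<Longrightarrow> (\<integral>y. d j y ^ (2 * m) \<partial>P) \<le> w j ^ m * B"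
  shows "(\<integral>y. (\<Sum>j=1..n. d j y) ^ (2 * m) \<partial>P) \<le> exp (4 ^ m) * 4 ^ m * (\<Sum>j=1..n. w j) ^ m * B"
proof (rule P.martingale_moment_le[OF m B w w0])
  have am: "moments (d j)" if "j \<in> {1..n}" for j using d[OF that] predictable_moments unfolding mart_diff_def by blast
  have ad: "predictable (Suc k) (\<lambda>y. \<Sum>j=1..k. d j y)" if "k < n" for k
    using d that unfolding mart_diff_def by (intro predictable_sum predictable_mono[of "Suc _" _ "Suc k"]) auto
  show "integrable P (\<lambda>x. (\<Sum>j=1..k. d j x) ^ (2 * m))" if "k < n" for k
    by (intro moments_integrable moments_power predictable_moments[OF ad[OF that]])
  show "integrable P (\<lambda>x. d k x ^ (2 * m))" if "k \<in> {1..n}" for k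
    by (intro moments_integrable moments_power am that)
  show "(\<integral>y. d k y ^ (2 * m) \<partial>P) \<le> w k ^ m * B" if "k \<in> {1..n}" for k
  proof (cases "w k = 0")
    case True
    then have "d k y = 0" for y using w0 that by blast
    then show ?thesis using True m by (simp add: power_0_left)
  qed (use w[OF that] dB[OF that] in auto)
  show "integrable P (\<lambda>x. (\<Sum>j=1..k. d j x) ^ (2 * m - 1) * d (Suc k) x)" if "k < n" for k
    using that by (intro moments_integrable moments_mult moments_power predictable_moments[OF ad[OF that]] am) auto
  show "(\<integral>x. (\<Sum>j=1..k. d j x) ^ (2 * m - 1) * d (Suc k) x \<partial>P) = 0" if "k < n" for k
  proof -
    have "mart_diff (Suc k) (d (Suc k))" using that by (intro d) auto
    then show ?thesis using predictable_power[OF ad[OF that]] unfolding mart_diff_def by blast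
  qed
qed

section \<open>Uniform moments of the observations\<close>

definition Cy :: "nat \<Rightarrow> real" where
  "Cy m = y0 ^ (2 * m) + odd_double_fact m / \<epsilon> ^ (2 * m)"

lemma df_pos: "0 < odd_double_fact k" unfolding odd_double_fact_def by (intro prod_pos) auto

lemma Cy_pos: "0 < Cy m" unfolding Cy_def using df_pos eps by (intro add_nonneg_pos divide_pos_pos) auto

text \<open>Since \<open>S\<close> is bounded by \<open>1 - \<epsilon>\<close>, the modulus of
  \<open>y k\<close> is at most a convex combination of the previous one and of the modulus of the
  noise divided by \<epsilon>. By convexity every level above the initial moment and above the
  moment of the noise over \<epsilon> is preserved; \<open>Cy m * vs ^ m\<close> is such a level,
  uniformly in \<open>k\<close>, \<open>S\<close> and \<open>p\<close>.\<close>

lemma y_moment: "k \<le> n \<Longrightarrow> 1 \<le> m \<Longrightarrow> (\<integral>y. y k ^ (2 * m) \<partial>P) \<le> Cy m * vs ^ m"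
proof (induction k)
  case 0
  have vm: "1 \<le> vs ^ m" using vs by (simp add: one_le_power)
  have "(\<integral>y. y 0 ^ (2 * m) \<partial>P) = (\<integral>y. y0 ^ (2 * m) \<partial>P)"
  proof (rule integral_cong_AE)
    show "AE y in P. y 0 ^ (2 * m) = y0 ^ (2 * m)" using AE_y0 by eventually_elim simp
  qed measurable
  also have "\<dots> = y0 ^ (2 * m)" using P.prob_space by simp
  also have "\<dots> \<le> Cy m * 1" unfolding Cy_def using df_pos[of m] eps by (simp add: less_imp_le)
  also have "\<dots> \<le> Cy m * vs ^ m" using Cy_pos[of m] vm by (intro mult_left_mono) auto
  finally show ?case .
next
  case (Suc k)
  then have k: "Suc k \<in> {1..n}" "k \<le> n" by auto
  have pw: "y (Suc k) ^ (2 * m) \<le> (1 - \<epsilon>) * y k ^ (2 * m) + \<epsilon> * (xi (Suc k) y ^ (2 * m) / \<epsilon> ^ (2 * m))" for y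
  proof -
    have "\<bar>y (Suc k)\<bar> = \<bar>Sj (Suc k) * y k + xi (Suc k) y\<bar>" by (simp add: xi_def)
    also have "\<dots> \<le> \<bar>Sj (Suc k)\<bar> * \<bar>y k\<bar> + \<bar>xi (Suc k) y\<bar>" by (metis abs_mult abs_triangle_ineq)
    also have "\<dots> \<le> (1 - \<epsilon>) * \<bar>y k\<bar> + \<epsilon> * (\<bar>xi (Suc k) y\<bar> / \<epsilon>)"
      using Sj_le[of "Suc k"] k eps by (intro add_mono mult_right_mono) auto
    finally have "\<bar>y (Suc k)\<bar> ^ (2 * m) \<le> ((1 - \<epsilon>) * \<bar>y k\<bar> + \<epsilon> * (\<bar>xi (Suc k) y\<bar> / \<epsilon>)) ^ (2 * m)"
      by (intro power_mono) auto
    also have "\<dots> \<le> (1 - \<epsilon>) * \<bar>y k\<bar> ^ (2 * m) + \<epsilon> * (\<bar>xi (Suc k) y\<bar> / \<epsilon>) ^ (2 * m)"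
      using eps by (intro convex_combination_power_le) auto
    finally show ?thesis by (simp add: power_divide power_mult)
  qed
  have i1: "integrable P (\<lambda>y. y k ^ (2 * m))" "integrable P (\<lambda>y. y (Suc k) ^ (2 * m))" "integrable P (\<lambda>y. xi (Suc k) y ^ (2 * m))"
    using k by (auto intro!: moments_integrable moments_power moments_y moments_xi)
  have "(\<integral>y. y (Suc k) ^ (2 * m) \<partial>P) \<le> (\<integral>y. (1 - \<epsilon>) * y k ^ (2 * m) + \<epsilon> * (xi (Suc k) y ^ (2 * m) / \<epsilon> ^ (2 * m)) \<partial>P)"
    using i1 by (intro integral_mono pw) auto
  also have "\<dots> = (1 - \<epsilon>) * (\<integral>y. y k ^ (2 * m) \<partial>P) + \<epsilon> * ((\<integral>y. xi (Suc k) y ^ (2 * m) \<partial>P) / \<epsilon> ^ (2 * m))"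
    using i1 by simp
  also have "\<dots> \<le> (1 - \<epsilon>) * (Cy m * vs ^ m) + \<epsilon> * (Cy m * vs ^ m)"
  proof (intro add_mono mult_left_mono)
    show "(\<integral>y. y k ^ (2 * m) \<partial>P) \<le> Cy m * vs ^ m" using Suc k by auto
    have "(\<integral>y. xi (Suc k) y ^ (2 * m) \<partial>P) \<le> vs ^ m * odd_double_fact m"
      using noise_mult_moment[OF k(1) predictable_const[of _ 1] _ Suc.prems(2)] P.prob_space by simp
    then have "(\<integral>y. xi (Suc k) y ^ (2 * m) \<partial>P) / \<epsilon> ^ (2 * m) \<le> vs ^ m * odd_double_fact m / \<epsilon> ^ (2 * m)"
      using eps by (intro divide_right_mono) auto
    also have "\<dots> \<le> Cy m * vs ^ m" unfolding Cy_def using vs by (simp add: algebra_simps power_mult)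
    finally show "(\<integral>y. xi (Suc k) y ^ (2 * m) \<partial>P) / \<epsilon> ^ (2 * m) \<le> Cy m * vs ^ m" .
  qed (use eps in auto)
  finally show ?case by (simp add: algebra_simps)
qed

end

text \<open>Pairs are grouped by their larger index: step \<open>j\<close> adds its diagonal term
  and twice the product with the earlier noise. Subtracting
  \<open>\<kappa> j j * (c j)\<^sup>2\<close> turns the diagonal term into a multiple of
  \<open>(v j)\<^sup>2 - 1\<close>.\<close>

lemma quadratic_form_increments:
  fixes v c :: "nat \<Rightarrow> real" and \<kappa> :: "nat \<Rightarrow> nat \<Rightarrow> real"
  assumes "\<And>i j. \<kappa> i j = \<kappa> j i"
  shows "(\<Sum>i=1..n. \<Sum>j=1..n. \<kappa> i j * (c i * v i) * (c j * v j)) - (\<Sum>j=1..n. \<kappa> j j * (c j)\<^sup>2)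
    = (\<Sum>j=1..n. \<kappa> j j * (c j)\<^sup>2 * ((v j)\<^sup>2 - 1) + 2 * c j * (\<Sum>i=1..<j. \<kappa> i j * (c i * v i)) * v j)"
proof (induction n)
  case (Suc n)
  let ?f = "\<lambda>i j. \<kappa> i j * (c i * v i) * (c j * v j)"
  have sym: "?f i j = ?f j i" for i j using assms[of i j] by simp
  have "(\<Sum>i=1..Suc n. \<Sum>j=1..Suc n. ?f i j) = (\<Sum>i=1..n. \<Sum>j=1..n. ?f i j) + (\<Sum>i=1..n. ?f i (Suc n)) + (\<Sum>j=1..n. ?f (Suc n) j) + ?f (Suc n) (Suc n)"
    by (simp add: sum.distrib)
  also have "(\<Sum>j=1..n. ?f (Suc n) j) = (\<Sum>i=1..n. ?f i (Suc n))"
    by (intro sum.cong refl sym)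
  also have "(\<Sum>i=1..n. ?f i (Suc n)) = (\<Sum>i=1..<Suc n. \<kappa> i (Suc n) * (c i * v i)) * c (Suc n) * v (Suc n)"
    unfolding atLeastLessThanSuc_atLeastAtMost sum_distrib_right by (simp add: mult_ac)
  finally show ?case using Suc.IH by (simp add: power2_eq_square algebra_simps)
qed simp

definition mart_const :: "nat \<Rightarrow> real" where "mart_const m = exp (4 ^ m) * 4 ^ m"

lemma mart_const_pos: "0 < mart_const m" by (simp add: mart_const_def)

context ar_model
begin

lemma coeff_moment_le:
  assumes j: "j \<in> {1..n}" and ad: "predictable j f" and le: "\<And>y. \<bar>f y\<bar> \<le> A * \<bar>y (j - 1)\<bar>" and A: "0 \<le> A" and k: "1 \<le> k"
  shows "(\<integral>y. f y ^ (2 * k) \<partial>P) \<le> A ^ (2 * k) * (Cy k * vs ^ k)"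
proof -
  have j1: "j - 1 \<le> n" using j by auto
  have "(\<integral>y. f y ^ (2 * k) \<partial>P) \<le> (\<integral>y. A ^ (2 * k) * y (j - 1) ^ (2 * k) \<partial>P)"
  proof (rule integral_mono)
    fix y
    have "\<bar>f y\<bar> ^ (2 * k) \<le> (A * \<bar>y (j - 1)\<bar>) ^ (2 * k)" by (intro power_mono le) auto
    then show "f y ^ (2 * k) \<le> A ^ (2 * k) * y (j - 1) ^ (2 * k)" by (simp add: power_mult_distrib power_mult)
  qed (intro moments_integrable moments_power moments_mult moments_const moments_y[OF j1] predictable_moments[OF ad])+
  also have "\<dots> \<le> A ^ (2 * k) * (Cy k * vs ^ k)"
    using y_moment[OF j1 k] by (simp add: mult_left_mono)
  finally show ?thesis .
qed

text \<open>Since \<open>c j\<close> is predictable, the moment of \<open>c j * xi j\<close> splits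
  into a moment of an observation and one of the noise, and \<open>(g j)\<^sup>2\<close> can serve
  as the weight of the increment. The index set \<open>I\<close> admits the truncated sums over
  \<open>{1..<j}\<close> inside the quadratic form.\<close>

lemma linear_noise_moment:
  assumes ad: "\<And>j. j \<in> {1..n} \<Longrightarrow> predictable j (c j)"
    and le: "\<And>j y. j \<in> {1..n} \<Longrightarrow> \<bar>c j y\<bar> \<le> A * \<bar>y (j - 1)\<bar>" and A: "0 \<le> A" and k: "1 \<le> k"
    and I: "I \<subseteq> {1..n}"
  shows "(\<integral>y. (\<Sum>j\<in>I. g j * (c j y * xi j y)) ^ (2 * k) \<partial>P)
    \<le> mart_const k * (\<Sum>j\<in>I. (g j)\<^sup>2) ^ k * (A ^ (2 * k) * (Cy k * vs ^ k) * (vs ^ k * odd_double_fact k))"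
proof -
  define h where "h j = (if j \<in> I then g j else 0)" for j
  let ?B = "A ^ (2 * k) * (Cy k * vs ^ k) * (vs ^ k * odd_double_fact k)"
  have B: "0 \<le> ?B" using A Cy_pos[of k] df_pos[of k] vs by (intro mult_nonneg_nonneg) auto
  have "(\<integral>y. (\<Sum>j=1..n. h j * (c j y * xi j y)) ^ (2 * k) \<partial>P) \<le> exp (4 ^ k) * 4 ^ k * (\<Sum>j=1..n. (h j)\<^sup>2) ^ k * ?B"
  proof (rule mart_diff_sum_moment_le[OF k B])
    fix j assume j: "j \<in> {1..n}"
    show "mart_diff j (\<lambda>y. h j * (c j y * xi j y))"
      by (intro mart_diff_mult predictable_const ad j mart_diff_xi)
    have "(\<integral>y. (h j * (c j y * xi j y)) ^ (2 * k) \<partial>P) = (h j)\<^sup>2 ^ k * (\<integral>y. c j y ^ (2 * k) * xi j y ^ (2 * k) \<partial>P)"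
      by (simp add: power_mult_distrib power_mult)
    also have "\<dots> \<le> (h j)\<^sup>2 ^ k * ((\<integral>y. c j y ^ (2 * k) \<partial>P) * (vs ^ k * odd_double_fact k))"
      by (intro mult_left_mono noise_mult_moment j predictable_power ad k) (auto simp: power_mult)
    also have "\<dots> \<le> (h j)\<^sup>2 ^ k * ?B"
      using coeff_moment_le[OF j ad[OF j] le[OF j] A k] vs df_pos[of k]
      by (intro mult_left_mono mult_right_mono) auto
    finally show "(\<integral>y. (h j * (c j y * xi j y)) ^ (2 * k) \<partial>P) \<le> (h j)\<^sup>2 ^ k * ?B" .
  qed auto
  moreover have "(\<Sum>j=1..n. h j * (c j y * xi j y)) = (\<Sum>j\<in>I. g j * (c j y * xi j y))" for y
    using I unfolding h_def by (intro sum.mono_neutral_cong_right) auto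
  moreover have "(\<Sum>j=1..n. (h j)\<^sup>2) = (\<Sum>j\<in>I. (g j)\<^sup>2)"
    using I unfolding h_def by (intro sum.mono_neutral_cong_right) auto
  ultimately show ?thesis by (simp add: mart_const_def)
qed

text \<open>The centred quadratic form is a sum of martingale differences, whose second one contains the linear
  form \<open>X\<^sub>j\<close> in the earlier noise; its fourth moment is controlled by \<open>linear_noise_moment\<close>.\<close>

lemma quadratic_noise_moment:
  assumes ad: "\<And>j. j \<in> {1..n} \<Longrightarrow> predictable j (c j)"
    and le: "\<And>j y. j \<in> {1..n} \<Longrightarrow> \<bar>c j y\<bar> \<le> A * \<bar>y (j - 1)\<bar>" and A: "0 < A"
    and sym: "\<And>i j. \<kappa> i j = \<kappa> j i"
  shows "(\<integral>y. ((\<Sum>i=1..n. \<Sum>j=1..n. \<kappa> i j * (c i y * xi i y) * (c j y * xi j y)) - (\<Sum>j=1..n. \<kappa> j j * (c j y)\<^sup>2))\<^sup>2 \<partial>P)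
    \<le> mart_const 1 * (Cy 2 * (10 + 12 * mart_const 2)) * A ^ 4 * vs ^ 4 * (\<Sum>i=1..n. \<Sum>j=1..n. (\<kappa> i j)\<^sup>2)"
proof -
  define X where "X j y = (\<Sum>i=1..<j. \<kappa> i j * (c i y * xi i y))" for j y
  define e where "e j y = (\<kappa> j j * (c j y)\<^sup>2) * ((xi j y)\<^sup>2 - 1) + (2 * c j y * X j y) * xi j y" for j y
  define w where "w j = (\<Sum>i=1..j. (\<kappa> i j)\<^sup>2)" for j
  \<comment> \<open>One constant for both kinds of increments, which come with \<open>8\<close>
    (diagonal) and \<open>4 + 12 * mart_const 2\<close> (cross terms).\<close>
  define K where "K = Cy 2 * (10 + 12 * mart_const 2)"
  have K0: "0 \<le> K" unfolding K_def using Cy_pos[of 2] mart_const_pos[of 2] by simp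
  have df2: "odd_double_fact 2 = 3" by (simp add: odd_double_fact_def numeral_2_eq_2)
  have wsplit: "w j = (\<kappa> j j)\<^sup>2 + (\<Sum>i=1..<j. (\<kappa> i j)\<^sup>2)" if "1 \<le> j" for j
  proof -
    have "{1..j} = insert j {1..<j}" using that by auto
    then show ?thesis unfolding w_def by simp
  qed
  have adX: "predictable j (X j)" if "j \<in> {1..n}" for j
    unfolding X_def using that by (intro predictable_sum predictable_mult predictable_const predictable_xi predictable_mono[OF ad]) auto
  have "(\<integral>y. (\<Sum>j=1..n. e j y) ^ (2 * 1) \<partial>P) \<le> exp (4 ^ 1) * 4 ^ 1 * (\<Sum>j=1..n. w j) ^ 1 * (K * A ^ 4 * vs ^ 4)"
  proof (rule mart_diff_sum_moment_le)
    show "0 \<le> K * A ^ 4 * vs ^ 4" using K0 A vs by simp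
    fix j assume j: "j \<in> {1..n}"
    show "mart_diff j (e j)" unfolding e_def
      by (intro mart_diff_add mart_diff_mult predictable_mult predictable_const predictable_power ad j mart_diff_xi mart_diff_square adX)
    show "0 \<le> w j" unfolding w_def by (intro sum_nonneg) auto
    {
      fix y assume "w j = 0"
      then have "\<forall>i\<in>{1..j}. (\<kappa> i j)\<^sup>2 = 0" unfolding w_def by (subst (asm) sum_nonneg_eq_0_iff) auto
      then have z: "\<kappa> i j = 0" if "i \<in> {1..j}" for i using that by simp
      have "X j y = 0" unfolding X_def using z by (intro sum.neutral) auto
      then show "e j y = 0" unfolding e_def using z[of j] j by simp
    }
    define W where "W = (\<Sum>i=1..<j. (\<kappa> i j)\<^sup>2)"
    have W0: "0 \<le> W" unfolding W_def by (intro sum_nonneg) auto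
    have amc: "moments (c j)" "moments (X j)" "moments (xi j)" using ad[OF j] adX[OF j] moments_xi[OF j] by (auto simp: predictable_moments)
    have c4: "(\<integral>y. c j y ^ 4 \<partial>P) \<le> A ^ 4 * (Cy 2 * vs\<^sup>2)"
      using coeff_moment_le[OF j ad[OF j] le[OF j], of 2] A by simp
    have first: "(\<integral>y. ((\<kappa> j j * (c j y)\<^sup>2) * ((xi j y)\<^sup>2 - 1))\<^sup>2 \<partial>P) \<le> (\<kappa> j j)\<^sup>2 * (A ^ 4 * (Cy 2 * vs\<^sup>2) * (4 * vs\<^sup>2))"
    proof -
      have v: "1 \<le> vs\<^sup>2" using vs by (simp add: one_le_power)
      have "(\<integral>y. ((\<kappa> j j * (c j y)\<^sup>2) * ((xi j y)\<^sup>2 - 1))\<^sup>2 \<partial>P) \<le> (\<integral>y. (\<kappa> j j)\<^sup>2 * (c j y ^ 4 * xi j y ^ (2 * 2) + c j y ^ 4) \<partial>P)"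
      proof (rule integral_mono)
        fix y
        have "((xi j y)\<^sup>2 - 1)\<^sup>2 \<le> xi j y ^ 4 + 1" by (simp add: power2_diff flip: power_mult)
        then have "(\<kappa> j j)\<^sup>2 * c j y ^ 4 * ((xi j y)\<^sup>2 - 1)\<^sup>2 \<le> (\<kappa> j j)\<^sup>2 * c j y ^ 4 * (xi j y ^ 4 + 1)"
          by (intro mult_left_mono) auto
        moreover have "((\<kappa> j j * (c j y)\<^sup>2) * ((xi j y)\<^sup>2 - 1))\<^sup>2 = (\<kappa> j j)\<^sup>2 * c j y ^ 4 * ((xi j y)\<^sup>2 - 1)\<^sup>2"
          by (simp add: power_mult_distrib flip: power_mult)
        ultimately show "((\<kappa> j j * (c j y)\<^sup>2) * ((xi j y)\<^sup>2 - 1))\<^sup>2 \<le> (\<kappa> j j)\<^sup>2 * (c j y ^ 4 * xi j y ^ (2 * 2) + c j y ^ 4)"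
          by (simp add: algebra_simps)
      qed (intro moments_integrable moments_power moments_mult moments_add moments_diff moments_const amc)+
      also have "\<dots> = (\<kappa> j j)\<^sup>2 * ((\<integral>y. c j y ^ 4 * xi j y ^ (2 * 2) \<partial>P) + (\<integral>y. c j y ^ 4 \<partial>P))"
        by (subst Bochner_Integration.integral_mult_right_zero, subst Bochner_Integration.integral_add)
           (auto intro!: moments_integrable moments_power moments_mult amc)
      also have "\<dots> \<le> (\<kappa> j j)\<^sup>2 * ((\<integral>y. c j y ^ 4 \<partial>P) * (vs\<^sup>2 * 3) + (\<integral>y. c j y ^ 4 \<partial>P) * vs\<^sup>2)"
      proof (intro mult_left_mono add_mono)
        show "(\<integral>y. c j y ^ 4 * xi j y ^ (2 * 2) \<partial>P) \<le> (\<integral>y. c j y ^ 4 \<partial>P) * (vs\<^sup>2 * 3)"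
          using noise_mult_moment[OF j predictable_power[OF ad[OF j]], of 4 2] df2 by simp
        have "0 \<le> (\<integral>y. c j y ^ 4 \<partial>P)" by (intro integral_nonneg_AE) auto
        then show "(\<integral>y. c j y ^ 4 \<partial>P) \<le> (\<integral>y. c j y ^ 4 \<partial>P) * vs\<^sup>2" using mult_left_mono[OF v] by fastforce
      qed auto
      also have "\<dots> = (\<kappa> j j)\<^sup>2 * ((\<integral>y. c j y ^ 4 \<partial>P) * (4 * vs\<^sup>2))" by simp
      also have "\<dots> \<le> (\<kappa> j j)\<^sup>2 * (A ^ 4 * (Cy 2 * vs\<^sup>2) * (4 * vs\<^sup>2))"
        by (intro mult_left_mono mult_right_mono c4) auto
      finally show ?thesis .
    qed
    have second: "(\<integral>y. ((2 * c j y * X j y) * xi j y)\<^sup>2 \<partial>P) \<le> 2 * A ^ 4 * W * vs ^ 3 * Cy 2 * (1 + 3 * mart_const 2)"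
    proof (cases "W = 0")
      case True
      then have "\<forall>i\<in>{1..<j}. (\<kappa> i j)\<^sup>2 = 0" unfolding W_def by (subst (asm) sum_nonneg_eq_0_iff) auto
      then have "X j y = 0" for y unfolding X_def by (intro sum.neutral) auto
      then show ?thesis using True by simp
    next
      case False
      \<comment> \<open>Balances \<open>T * y (j - 1) ^ 4\<close> against
        \<open>X j y ^ 4 / T\<close>: with this choice both have mean of order
        \<open>A\<^sup>2 * W * vs ^ 3\<close>, so that \<open>W\<close> enters only
        linearly.\<close>
      define T where "T = A\<^sup>2 * W * vs"
      have Tp: "0 < T" unfolding T_def using False W0 A vs by simp
      have X4: "(\<integral>y. X j y ^ 4 \<partial>P) \<le> mart_const 2 * W\<^sup>2 * (A ^ 4 * (Cy 2 * vs\<^sup>2) * (vs\<^sup>2 * 3))"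
      proof -
        have sub: "{1..<j} \<subseteq> {1..n}" using j by auto
        show ?thesis using linear_noise_moment[OF ad le _ _ sub, of 2 "\<lambda>i. \<kappa> i j"] A df2 unfolding X_def W_def by simp
      qed
      have y4: "(\<integral>y. y (j - 1) ^ 4 \<partial>P) \<le> Cy 2 * vs\<^sup>2"
        using y_moment[of "j - 1" 2] j by auto
      have amy: "moments (\<lambda>y. y (j - 1))" using j by (intro moments_y) auto
      have "(\<integral>y. ((2 * c j y * X j y) * xi j y)\<^sup>2 \<partial>P) = (\<integral>y. (2 * c j y * X j y)\<^sup>2 * (xi j y)\<^sup>2 \<partial>P)"
        by (simp add: power_mult_distrib)
      also have "\<dots> = (\<integral>y. (2 * c j y * X j y)\<^sup>2 \<partial>P)"
        by (intro noise_mult_square j predictable_power predictable_mult predictable_const ad adX)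
      also have "\<dots> \<le> (\<integral>y. 2 * A\<^sup>2 * (T * y (j - 1) ^ 4 + X j y ^ 4 / T) \<partial>P)"
      proof (rule integral_mono)
        fix y
        have "\<bar>c j y\<bar>\<^sup>2 \<le> (A * \<bar>y (j - 1)\<bar>)\<^sup>2" by (intro power_mono le j) auto
        then have "(2 * c j y * X j y)\<^sup>2 \<le> 4 * (A * \<bar>y (j - 1)\<bar>)\<^sup>2 * (X j y)\<^sup>2"
          unfolding power_mult_distrib by (intro mult_right_mono) auto
        also have "\<dots> = 2 * A\<^sup>2 * (2 * ((y (j - 1))\<^sup>2 * (X j y)\<^sup>2))" by (simp add: power_mult_distrib)
        also have "2 * ((y (j - 1))\<^sup>2 * (X j y)\<^sup>2) \<le> T * y (j - 1) ^ 4 + X j y ^ 4 / T"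
        proof -
          have "0 \<le> (T * (y (j - 1))\<^sup>2 - (X j y)\<^sup>2)\<^sup>2 / T" using Tp by simp
          also have "\<dots> = T * y (j - 1) ^ 4 + X j y ^ 4 / T - 2 * ((y (j - 1))\<^sup>2 * (X j y)\<^sup>2)"
            using Tp by (simp add: power2_diff power_mult_distrib field_simps flip: power_mult) (simp add: power2_eq_square)
          finally show ?thesis by simp
        qed
        finally show "(2 * c j y * X j y)\<^sup>2 \<le> 2 * A\<^sup>2 * (T * y (j - 1) ^ 4 + X j y ^ 4 / T)" by (simp add: mult_left_mono)
      qed (unfold divide_inverse, (intro moments_integrable moments_power moments_mult moments_add moments_const amc amy)+)
      also have "\<dots> = 2 * A\<^sup>2 * (T * (\<integral>y. y (j - 1) ^ 4 \<partial>P) + (\<integral>y. X j y ^ 4 \<partial>P) / T)"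
        by (subst Bochner_Integration.integral_mult_right_zero, subst Bochner_Integration.integral_add)
           (auto simp: divide_inverse intro!: moments_integrable moments_power moments_mult moments_const amc amy[unfolded One_nat_def])
      also have "\<dots> \<le> 2 * A\<^sup>2 * (T * (Cy 2 * vs\<^sup>2) + mart_const 2 * W\<^sup>2 * (A ^ 4 * (Cy 2 * vs\<^sup>2) * (vs\<^sup>2 * 3)) / T)"
        using Tp by (intro mult_left_mono add_mono divide_right_mono y4 X4) auto
      also have "mart_const 2 * W\<^sup>2 * (A ^ 4 * (Cy 2 * vs\<^sup>2) * (vs\<^sup>2 * 3)) / T = A\<^sup>2 * W * vs ^ 3 * Cy 2 * (3 * mart_const 2)"
        unfolding T_def using False A vs by (simp add: field_simps power2_eq_square power3_eq_cube power4_eq_xxxx)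
      also have "2 * A\<^sup>2 * (T * (Cy 2 * vs\<^sup>2) + A\<^sup>2 * W * vs ^ 3 * Cy 2 * (3 * mart_const 2)) = 2 * A ^ 4 * W * vs ^ 3 * Cy 2 * (1 + 3 * mart_const 2)"
        unfolding T_def by (simp add: algebra_simps power2_eq_square power3_eq_cube power4_eq_xxxx)
      finally show ?thesis .
    qed
    have "(\<integral>y. (e j y)\<^sup>2 \<partial>P) \<le> (\<integral>y. 2 * ((\<kappa> j j * (c j y)\<^sup>2) * ((xi j y)\<^sup>2 - 1))\<^sup>2 + 2 * ((2 * c j y * X j y) * xi j y)\<^sup>2 \<partial>P)"
    proof (rule integral_mono)
      fix y
      show "(e j y)\<^sup>2 \<le> 2 * ((\<kappa> j j * (c j y)\<^sup>2) * ((xi j y)\<^sup>2 - 1))\<^sup>2 + 2 * ((2 * c j y * X j y) * xi j y)\<^sup>2"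
        unfolding e_def using sum_squares_bound[of "(\<kappa> j j * (c j y)\<^sup>2) * ((xi j y)\<^sup>2 - 1)" "(2 * c j y * X j y) * xi j y"]
        by (simp only: power2_sum)
    qed (unfold e_def, (intro moments_integrable moments_power moments_mult moments_add moments_diff moments_const amc)+)
    also have "\<dots> = 2 * (\<integral>y. ((\<kappa> j j * (c j y)\<^sup>2) * ((xi j y)\<^sup>2 - 1))\<^sup>2 \<partial>P) + 2 * (\<integral>y. ((2 * c j y * X j y) * xi j y)\<^sup>2 \<partial>P)"
      by (subst Bochner_Integration.integral_add)
         (auto simp del: power_mult_distrib intro!: moments_integrable moments_power moments_mult moments_diff moments_const amc)
    also have "\<dots> \<le> 2 * ((\<kappa> j j)\<^sup>2 * (A ^ 4 * (Cy 2 * vs\<^sup>2) * (4 * vs\<^sup>2))) + 2 * (2 * A ^ 4 * W * vs ^ 3 * Cy 2 * (1 + 3 * mart_const 2))"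
      by (intro add_mono mult_left_mono first second) auto
    also have "\<dots> = Cy 2 * A ^ 4 * (8 * (\<kappa> j j)\<^sup>2 * vs ^ 4 + (4 + 12 * mart_const 2) * W * vs ^ 3)"
      by (simp add: algebra_simps power2_eq_square power4_eq_xxxx)
    also have "\<dots> \<le> Cy 2 * A ^ 4 * ((10 + 12 * mart_const 2) * (\<kappa> j j)\<^sup>2 * vs ^ 4 + (10 + 12 * mart_const 2) * W * vs ^ 4)"
      using Cy_pos[of 2] A vs W0 mart_const_pos[of 2] power_increasing[of 3 4 vs]
      by (intro mult_left_mono add_mono mult_right_mono mult_mono) auto
    also have "\<dots> = w j * (K * A ^ 4 * vs ^ 4)"
      using wsplit[of j] j unfolding W_def[symmetric] K_def by (simp add: algebra_simps)
    finally show "(\<integral>y. e j y ^ (2 * 1) \<partial>P) \<le> w j ^ 1 * (K * A ^ 4 * vs ^ 4)" by simp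
  qed auto
  also have "(\<Sum>j=1..n. w j) \<le> (\<Sum>j=1..n. \<Sum>i=1..n. (\<kappa> i j)\<^sup>2)"
    unfolding w_def by (intro sum_mono sum_mono2) auto
  also have "\<dots> = (\<Sum>i=1..n. \<Sum>j=1..n. (\<kappa> i j)\<^sup>2)" by (rule sum.swap)
  finally have "(\<integral>y. (\<Sum>j=1..n. e j y)\<^sup>2 \<partial>P) \<le> mart_const 1 * (\<Sum>i=1..n. \<Sum>j=1..n. (\<kappa> i j)\<^sup>2) * (K * A ^ 4 * vs ^ 4)"
    using K0 A vs by (simp add: mart_const_def mult_left_mono mult_right_mono)
  moreover have "(\<Sum>j=1..n. e j y) = (\<Sum>i=1..n. \<Sum>j=1..n. \<kappa> i j * (c i y * xi i y) * (c j y * xi j y)) - (\<Sum>j=1..n. \<kappa> j j * (c j y)\<^sup>2)" for y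
    unfolding e_def X_def quadratic_form_increments[of \<kappa> "\<lambda>i. c i y" "\<lambda>i. xi i y", OF sym] by simp
  ultimately show ?thesis by (simp add: K_def mult_ac)
qed

end

section \<open>The windows\<close>

text \<open>Half the length of a window counted in observations; window \<open>l\<close> is centred
  at \<open>2 * half_width n * real l\<close>.\<close>

definition half_width :: "nat \<Rightarrow> real" where
  "half_width n = real n / (2 * real (num_pts n))"

lemma num_pts_bounds:
  assumes "1 \<le> n"
  shows "1 \<le> num_pts n" "real (num_pts n) \<le> sqrt (real n)" "sqrt (real n) \<le> 2 * real (num_pts n)"
proof -
  have s: "1 \<le> sqrt (real n)" using assms by simp
  then have f: "1 \<le> \<lfloor>sqrt (real n)\<rfloor>" by simp
  then show d: "1 \<le> num_pts n" unfolding num_pts_def by linarith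
  have r: "real (num_pts n) = of_int \<lfloor>sqrt (real n)\<rfloor>" unfolding num_pts_def using f by simp
  show "real (num_pts n) \<le> sqrt (real n)" unfolding r by simp
  have "sqrt (real n) < real (num_pts n) + 1" unfolding r by linarith
  then show "sqrt (real n) \<le> 2 * real (num_pts n)" using d by linarith
qed

lemma half_width_bounds:
  assumes "1 \<le> n"
  shows "sqrt (real n) / 2 \<le> half_width n" "half_width n \<le> sqrt (real n)" "0 < half_width n"
proof -
  have d: "0 < real (num_pts n)" using num_pts_bounds(1)[OF assms] by simp
  have sq: "sqrt (real n) * sqrt (real n) = real n" by simp
  have "sqrt (real n) * real (num_pts n) \<le> real n"
    using mult_left_mono[OF num_pts_bounds(2)[OF assms], of "sqrt (real n)"] sq by simp
  then show "sqrt (real n) / 2 \<le> half_width n" unfolding half_width_def using d by (simp add: field_simps)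
  have "real n \<le> 2 * real (num_pts n) * sqrt (real n)"
    using mult_right_mono[OF num_pts_bounds(3)[OF assms], of "sqrt (real n)"] sq by simp
  then show "half_width n \<le> sqrt (real n)" unfolding half_width_def using d by (simp add: field_simps)
  show "0 < half_width n" unfolding half_width_def using d assms by simp
qed

locale windows =
  fixes a b :: real and n :: nat
  assumes wab: "a < b" and wn: "1 \<le> n"
begin

abbreviation "I \<equiv> {1..num_pts n}"
abbreviation "z \<equiv> zpt a b n"

lemma d_pos: "0 < real (num_pts n)" using num_pts_bounds(1)[OF wn] by simp

lemma zpt_rel_eq: "real n * zpt_rel a b n l = 2 * half_width n * real l"
  unfolding zpt_rel_def zpt_def half_width_def using wab d_pos by simp

lemma bandw_rel_eq: "real n * bandw_rel a b n = half_width n"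
  unfolding bandw_rel_def bandw_def half_width_def using wab d_pos by simp

lemma last_centre: "2 * half_width n * real (num_pts n) = real n"
  unfolding half_width_def using d_pos by simp

lemma k_first_bounds:
  assumes "1 \<le> l"
  shows "2 * half_width n * real l - half_width n < real (k_first a b n l)"
    "real (k_first a b n l) \<le> 2 * half_width n * real l - half_width n + 1"
proof -
  let ?x = "2 * half_width n * real l - half_width n"
  have "half_width n * 1 \<le> half_width n * real l" using assms half_width_bounds(3)[OF wn] by (intro mult_left_mono) auto
  then have x: "0 < ?x" using half_width_bounds(3)[OF wn] by simp
  have k: "k_first a b n l = nat (\<lfloor>?x\<rfloor> + 1)" unfolding k_first_def zpt_rel_eq bandw_rel_eq ..
  have r: "real (k_first a b n l) = of_int \<lfloor>?x\<rfloor> + 1" unfolding k using x by simp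
  show "?x < real (k_first a b n l)" "real (k_first a b n l) \<le> ?x + 1" unfolding r by linarith+
qed

lemma k_last_le: "k_last a b n l \<le> n" unfolding k_last_def by simp

lemma k_last_upper: "real (k_last a b n l) \<le> 2 * half_width n * real l + half_width n"
proof -
  have x: "0 \<le> 2 * half_width n * real l + half_width n" using half_width_bounds(3)[OF wn] by simp
  have "real (k_last a b n l) \<le> real (nat \<lfloor>2 * half_width n * real l + half_width n\<rfloor>)"
    unfolding k_last_def zpt_rel_eq bandw_rel_eq by simp
  also have "\<dots> \<le> 2 * half_width n * real l + half_width n" using x by simp
  finally show ?thesis .
qed

text \<open>Only the left half of a window is guaranteed: the last centre is \<open>n\<close>
  itself, where the minimum in \<open>k_last\<close> cuts off the right half.\<close>

lemma k_last_lower: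
  assumes "l \<le> num_pts n" "1 \<le> half_width n"
  shows "2 * half_width n * real l \<le> real (k_last a b n l)"
proof -
  have "2 * half_width n * real l \<le> 2 * half_width n * real (num_pts n)"
    using assms by (intro mult_left_mono) auto
  then have 1: "2 * half_width n * real l \<le> real n" unfolding last_centre .
  have "0 \<le> 2 * half_width n * real l" using assms by simp
  then have "2 * half_width n * real l \<le> real (nat \<lfloor>2 * half_width n * real l + half_width n\<rfloor>)"
    using assms by linarith
  with 1 show ?thesis unfolding k_last_def zpt_rel_eq bandw_rel_eq by (simp add: min_def)
qed

lemma Qw_iff: "Qw a b n l j = of_bool (\<bar>real j - 2 * half_width n * real l\<bar> \<le> half_width n)"
proof -
  have e: "design a b n j - z l = (real j - 2 * half_width n * real l) * ((b - a) / real n)"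
    unfolding design_def zpt_def half_width_def using d_pos wn by (simp add: field_simps)
  have b: "bandw a b n = half_width n * ((b - a) / real n)"
    unfolding bandw_def half_width_def using d_pos wn by (simp add: field_simps)
  have c: "0 < (b - a) / real n" using wab wn by simp
  have "\<bar>design a b n j - z l\<bar> = \<bar>real j - 2 * half_width n * real l\<bar> * ((b - a) / real n)"
    unfolding e abs_mult by (simp only: abs_of_pos[OF c])
  then show ?thesis unfolding Qw_def b by (simp only: mult_le_cancel_right_pos[OF c])
qed

lemma Qw_window: "1 \<le> l \<Longrightarrow> k_first a b n l \<le> j \<Longrightarrow> j \<le> k_last a b n l \<Longrightarrow> Qw a b n l j = 1"
  unfolding Qw_iff using k_first_bounds(1)[of l] k_last_upper[of l]
  by (simp add: abs_le_iff)

text \<open>Neighbouring windows touch at \<open>(2 * l + 1) * half_width n\<close>. If this is an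
  integer, the \<open>+ 1\<close> in \<open>k_first\<close> assigns it to the left window.\<close>

lemma windows_ordered:
  assumes "l < l'" shows "k_last a b n l < k_first a b n l'"
proof -
  have "half_width n * (real l + 1) \<le> half_width n * real l'"
    using assms half_width_bounds(3)[OF wn] by (intro mult_left_mono) auto
  then have "2 * half_width n * real l + half_width n \<le> 2 * half_width n * real l' - half_width n"
    by (simp add: algebra_simps)
  also have "\<dots> < real (k_first a b n l')" using assms by (intro k_first_bounds(1)) auto
  finally have "real (k_last a b n l) < real (k_first a b n l')" using k_last_upper[of l] by linarith
  then show ?thesis by simp
qed

lemma zpt_mem: "l \<le> num_pts n \<Longrightarrow> z l \<in> {a..b}"
proof -
  assume l: "l \<le> num_pts n"
  then have "0 \<le> real l / real (num_pts n)" "real l / real (num_pts n) \<le> 1" using d_pos by auto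
  then have "0 \<le> real l / real (num_pts n) * (b - a)" "real l / real (num_pts n) * (b - a) \<le> 1 * (b - a)"
    using wab mult_right_mono[of "real l / real (num_pts n)" 1 "b - a"] by (auto intro!: mult_nonneg_nonneg)
  then show ?thesis unfolding zpt_def by auto
qed

end

text \<open>No size condition on the windows at this level: the algebra of the stopping times also
  serves the finite risk bound for every \<open>n \<ge> 3\<close>, where thresholds may fail to be
  positive.\<close>

locale mid_windows = windows +
  fixes \<mu>0 :: real
  assumes mu: "0 < \<mu>0" "\<mu>0 < 1" and n3: "3 \<le> n"
begin

abbreviation "\<iota> l \<equiv> \<iota>idx a b \<mu>0 n l"
abbreviation "k2 l \<equiv> k_last a b n l"
definition "nterms l = real (k2 l) - real (\<iota> l) - 1"

lemma burn_in_le: "real (burn_in a b \<mu>0 n) \<le> half_width n powr \<mu>0"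
  unfolding burn_in_def bandw_rel_eq by (auto simp: of_nat_nat)

lemma window_card_le:
  assumes "1 \<le> l" shows "real (k2 l) - real (\<iota> l) \<le> 2 * sqrt (real n)"
  using k_last_upper[of l] k_first_bounds(1)[OF assms] half_width_bounds(2)[OF wn]
  unfolding \<iota>idx_def by simp

lemma Qw_one: "1 \<le> l \<Longrightarrow> \<iota> l < j \<Longrightarrow> j \<le> k2 l \<Longrightarrow> Qw a b n l j = 1"
  by (rule Qw_window) (auto simp: \<iota>idx_def)

lemma disjoint_windows: "1 \<le> l \<Longrightarrow> l < l' \<Longrightarrow> k2 l < \<iota> l'"
  using windows_ordered[of l l'] unfolding \<iota>idx_def by simp

lemma eps_tilde_bounds: "0 < eps_tilde n" "eps_tilde n \<le> 1 / 2"
proof -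
  have "0 \<le> ln (real n)" using wn by (intro ln_ge_zero) auto
  then show "0 < eps_tilde n" "eps_tilde n \<le> 1 / 2" unfolding eps_tilde_def by (auto simp: field_simps)
qed

lemma S_trunc_bounds: "\<bar>S_trunc a b \<mu>0 n l y\<bar> \<le> 1 - eps_tilde n"
  using eps_tilde_bounds unfolding S_trunc_def by (auto simp: abs_le_iff min_def max_def)

lemma gamma_tilde_bounds: "eps_tilde n \<le> gamma_tilde a b \<mu>0 n l y" "gamma_tilde a b \<mu>0 n l y \<le> 1"
proof -
  have "(S_trunc a b \<mu>0 n l y)\<^sup>2 \<le> (1 - eps_tilde n)\<^sup>2"
    using S_trunc_bounds[of l y] by (metis abs_ge_zero power2_abs power_mono)
  also have "(1 - eps_tilde n)\<^sup>2 \<le> (1 - eps_tilde n) * 1"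
    unfolding power2_eq_square using eps_tilde_bounds by (intro mult_left_mono) auto
  finally show "eps_tilde n \<le> gamma_tilde a b \<mu>0 n l y" unfolding gamma_tilde_def by simp
  show "gamma_tilde a b \<mu>0 n l y \<le> 1" unfolding gamma_tilde_def by simp
qed

lemma Hthr_eq: "Hthr a b \<mu>0 n l y = (1 - eps_tilde n) / gamma_tilde a b \<mu>0 n l y * nterms l"
  unfolding Hthr_def nterms_def ..

text \<open>\<open>nterms l\<close> takes integer values, so positivity of the threshold already
  forces \<open>nterms l \<ge> 1\<close> and a threshold of at least \<open>1 / 2\<close>. This
  stands in for \<open>H_bounds\<close> when the windows are short.\<close>

lemma iota_less_of_pos:
  assumes "0 < Hthr a b \<mu>0 n l y"
  shows "\<iota> l + 1 < k2 l" "1 / Hthr a b \<mu>0 n l y \<le> 2"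
proof -
  let ?g = "gamma_tilde a b \<mu>0 n l y"
  note g = gamma_tilde_bounds[of l y] and e = eps_tilde_bounds
  have g0: "0 < ?g" using g e by linarith
  have "0 < (1 - eps_tilde n) / ?g" using g0 e by simp
  then have "0 < nterms l" using assms unfolding Hthr_eq by (rule zero_less_mult_pos[rotated])
  then show w: "\<iota> l + 1 < k2 l" unfolding nterms_def by linarith
  have "1 / 2 * 1 \<le> Hthr a b \<mu>0 n l y"
    unfolding Hthr_eq
  proof (intro mult_mono)
    show "1 / 2 \<le> (1 - eps_tilde n) / ?g" using g g0 e frac_le[of "1 - eps_tilde n" "1 / 2" ?g 1] by simp
    show "1 \<le> nterms l" using w unfolding nterms_def by linarith
  qed (use g0 e in auto)
  then show "1 / Hthr a b \<mu>0 n l y \<le> 2" using assms by (simp add: divide_le_eq)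
qed

end

text \<open>Both assumptions hold for all large \<open>n\<close>; they make every threshold positive and of order \<open>\<surd>n\<close>.\<close>

locale large_windows = mid_windows +
  assumes hw1: "1 \<le> half_width n" and hw2: "half_width n powr \<mu>0 + 2 \<le> half_width n / 2"
begin

text \<open>Half a window is available, and \<open>hw2\<close> leaves half of that after the
  burn-in. Its summand \<open>2\<close> pays for the \<open>+ 1\<close> in the upper bound of
  \<open>k_first\<close> and the \<open>- 1\<close> in \<open>nterms\<close>.\<close>

lemma nterms_lower:
  assumes "1 \<le> l" "l \<le> num_pts n" shows "sqrt (real n) / 4 \<le> nterms l"
  using k_last_lower[OF assms(2) hw1] k_first_bounds(2)[OF assms(1)] burn_in_le hw2 half_width_bounds(1)[OF wn]
  unfolding nterms_def \<iota>idx_def by simp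

lemma iota_less: "1 \<le> l \<Longrightarrow> l \<le> num_pts n \<Longrightarrow> \<iota> l + 1 < k2 l"
  using nterms_lower[of l] wn unfolding nterms_def by (smt (verit) of_nat_1 of_nat_add of_nat_less_iff real_sqrt_gt_0_iff divide_pos_pos of_nat_0_less_iff less_le_trans zero_less_one)

text \<open>The truncation keeps \<open>gamma_tilde\<close> between \<open>eps_tilde n\<close> and
  \<open>1\<close>, so the threshold is of order \<surd>n up to a logarithm. The upper bound on its
  inverse controls the noise; the lower bound gives the floor for the variances by which the
  quadratic form is normalised.\<close>

lemma H_bounds:
  assumes l: "1 \<le> l" "l \<le> num_pts n"
  shows "0 < Hthr a b \<mu>0 n l y" "1 / Hthr a b \<mu>0 n l y \<le> 8 / sqrt (real n)"
    "eps_tilde n / (2 * sqrt (real n)) \<le> 1 / Hthr a b \<mu>0 n l y"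
proof -
  let ?g = "gamma_tilde a b \<mu>0 n l y" and ?H = "Hthr a b \<mu>0 n l y"
  have sn: "0 < sqrt (real n)" using wn by simp
  note g = gamma_tilde_bounds[of l y] and e = eps_tilde_bounds
  have g0: "0 < ?g" using g e by linarith
  have N: "sqrt (real n) / 4 \<le> nterms l" "nterms l \<le> 2 * sqrt (real n)"
    using nterms_lower[OF l] window_card_le[OF l(1)] unfolding nterms_def by auto
  then have N0: "0 < nterms l" using sn by linarith
  show H0: "0 < ?H" unfolding Hthr_eq using g0 e N0 by (intro mult_pos_pos divide_pos_pos) auto
  have inv: "1 / ?H = ?g / ((1 - eps_tilde n) * nterms l)" unfolding Hthr_eq by simp
  have "?g / ((1 - eps_tilde n) * nterms l) \<le> 1 / ((1/2) * (sqrt (real n) / 4))"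
    using g e N sn g0 by (intro frac_le mult_mono mult_pos_pos) auto
  then show "1 / ?H \<le> 8 / sqrt (real n)" unfolding inv by simp
  have "eps_tilde n / (1 * (2 * sqrt (real n))) \<le> ?g / ((1 - eps_tilde n) * nterms l)"
    using g e N sn N0 by (intro frac_le mult_mono mult_pos_pos) auto
  then show "eps_tilde n / (2 * sqrt (real n)) \<le> 1 / ?H" unfolding inv by simp
qed

end

section \<open>The sequential estimators\<close>

lemma Asum_measurable [measurable]: "(\<lambda>y. Asum a b n l y k m) \<in> borel_measurable (obs_space n)"
  unfolding Asum_def by measurable

lemma S_init_measurable [measurable]: "S_init a b \<mu>0 n l \<in> borel_measurable (obs_space n)"
  unfolding S_init_def by measurable

lemma Hthr_measurable [measurable]: "Hthr a b \<mu>0 n l \<in> borel_measurable (obs_space n)"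
  unfolding Hthr_def gamma_tilde_def S_trunc_def by measurable

lemma Gam_l_measurable [measurable]: "Measurable.pred (obs_space n) (Gam_l a b \<mu>0 n l)"
  unfolding Gam_l_def by (intro pred_intros_logic) (auto simp: pred_def intro!: borel_measurable_le borel_measurable_less)

lemma Gam_measurable [measurable]: "Measurable.pred (obs_space n) (Gam a b \<mu>0 n)"
  unfolding Gam_def by (intro pred_intros_finite Gam_l_measurable) auto

lemma min_add_diff_le: "0 \<le> d \<Longrightarrow> min (x + d) h - min x h \<le> d" for x d h :: real
  by (auto simp: min_def)

context mid_windows
begin

abbreviation "H l y \<equiv> Hthr a b \<mu>0 n l y"
definition "As l y m = Asum a b n l y (\<iota> l) m"

text \<open>The weight of \<open>\<xi>\<^sub>j\<close> in the \<open>l\<close>-th sequential estimator, times \<open>H\<^sub>l\<close>: it equals \<open>y\<^bsub>j-1\<^esub>\<close> before \<open>\<tau>\<^sub>l\<close>,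
  \<open>\<kappa>\<^sub>l y\<^bsub>j-1\<^esub>\<close> at \<open>\<tau>\<^sub>l\<close>, and vanishes afterwards. In this form it is visibly predictable and
  defined off \<open>\<Gamma>\<^sub>l\<close>.\<close>

definition "wt l j y = sgn (y (j - 1)) * sqrt (min (As l y j) (H l y) - min (As l y (j - 1)) (H l y))"

lemma As_zero: "m \<le> \<iota> l \<Longrightarrow> As l y m = 0" unfolding As_def Asum_def by simp

lemma As_step:
  assumes "1 \<le> l" "\<iota> l < j" "j \<le> k2 l"
  shows "As l y j = As l y (j - 1) + (y (j - 1))\<^sup>2"
proof -
  have "{\<iota> l + 1..j} = insert j {\<iota> l + 1..j - 1}" using assms by auto
  then show ?thesis unfolding As_def Asum_def using Qw_one[OF assms] assms by (simp add: add.commute)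
qed

lemma As_mono: "i \<le> j \<Longrightarrow> As l y i \<le> As l y j"
  unfolding As_def Asum_def by (intro sum_mono2) (auto simp: Qw_def)

lemma wt_square:
  assumes "1 \<le> l" "\<iota> l < j" "j \<le> k2 l"
  shows "(wt l j y)\<^sup>2 = min (As l y j) (H l y) - min (As l y (j - 1)) (H l y)"
proof (cases "y (j - 1) = 0")
  case True
  then show ?thesis unfolding wt_def using As_step[OF assms] by simp
next
  case False
  have "min (As l y (j - 1)) (H l y) \<le> min (As l y j) (H l y)"
    using As_mono[of "j - 1" j] by (intro min.mono) auto
  then show ?thesis unfolding wt_def using False by (simp add: power_mult_distrib sgn_if)
qed

lemma wt_abs_le:
  assumes "1 \<le> l" "\<iota> l < j" "j \<le> k2 l"
  shows "\<bar>wt l j y\<bar> \<le> \<bar>y (j - 1)\<bar>"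
proof -
  have "(wt l j y)\<^sup>2 \<le> (y (j - 1))\<^sup>2"
    unfolding wt_square[OF assms] As_step[OF assms, of y] by (rule min_add_diff_le) simp
  then show ?thesis by (simp add: abs_le_square_iff)
qed

text \<open>The squared weights are the increments of the clock \<open>As l y\<close> stopped at
  level \<open>H l y\<close>, so they telescope. On \<open>Gam_l\<close> the clock reaches its
  level, which is why the predictable variance is exactly the inverse threshold.\<close>

lemma wt_sum_square:
  assumes "1 \<le> l" "0 < H l y" "m \<le> k2 l"
  shows "(\<Sum>j=\<iota> l + 1..m. (wt l j y)\<^sup>2) = min (As l y m) (H l y)"
  using assms(3)
proof (induction m)
  case 0
  then show ?case using assms(2) by (simp add: As_zero)
next
  case (Suc m)
  show ?case
  proof (cases "\<iota> l < Suc m")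
    case True
    then have "{\<iota> l + 1..Suc m} = insert (Suc m) {\<iota> l + 1..m}" by auto
    then show ?thesis using Suc wt_square[OF assms(1) True Suc.prems] by simp
  next
    case False
    then show ?thesis using assms(2) by (simp add: As_zero)
  qed
qed

context
  fixes l :: nat and y :: "nat \<Rightarrow> real"
  assumes l: "1 \<le> l" "l \<le> num_pts n" and G: "Gam_l a b \<mu>0 n l y"
begin

abbreviation "\<tau> \<equiv> stop_time a b \<mu>0 n l y"

lemma H0: "0 < H l y" using G unfolding Gam_l_def by simp

lemma window_nonempty: "\<iota> l + 1 < k2 l" by (rule iota_less_of_pos(1)[OF H0])

lemma As_end: "H l y \<le> As l y (k2 l - 1)" using G unfolding Gam_l_def As_def by simp

lemma tau_props: "\<iota> l < \<tau>" "\<tau> \<le> k2 l - 1" "H l y \<le> As l y \<tau>" "As l y (\<tau> - 1) < H l y"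
proof -
  let ?T = "{k \<in> {\<iota> l + 1..k2 l}. H l y \<le> As l y k}"
  have "k2 l - 1 \<in> ?T" using As_end window_nonempty by auto
  then have ne: "?T \<noteq> {}" by blast
  then have t: "\<tau> = Inf ?T" unfolding stop_time_def Let_def As_def[symmetric] by (simp only: if_False)
  have in_T: "\<tau> \<in> ?T" unfolding t by (rule Inf_nat_def1[OF ne])
  show "\<iota> l < \<tau>" "H l y \<le> As l y \<tau>" using in_T by auto
  show "\<tau> \<le> k2 l - 1" unfolding t by (rule cInf_lower) (use \<open>k2 l - 1 \<in> ?T\<close> in auto)
  show "As l y (\<tau> - 1) < H l y"
  proof (rule ccontr)
    assume "\<not> As l y (\<tau> - 1) < H l y"
    then have ge: "H l y \<le> As l y (\<tau> - 1)" by simp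
    \<comment> \<open>At \<open>\<iota> l\<close> and before, the sum is \<open>0\<close>, hence
      below the positive threshold; so \<open>\<tau> - 1\<close> lies in the range over which the
      infimum is taken.\<close>
    have "\<iota> l < \<tau> - 1"
    proof (rule ccontr)
      assume "\<not> \<iota> l < \<tau> - 1"
      then have "As l y (\<tau> - 1) = 0" by (intro As_zero) simp
      then show False using ge H0 by simp
    qed
    then have "\<tau> - 1 \<in> ?T" using in_T ge by auto
    then have "\<tau> \<le> \<tau> - 1" unfolding t by (intro cInf_lower) auto
    then show False using in_T by auto
  qed
qed

lemma tau_k2: "\<tau> \<le> k2 l" using tau_props(2) by simp

lemma wt_before: "\<iota> l < j \<Longrightarrow> j < \<tau> \<Longrightarrow> wt l j y = y (j - 1)"
proof -
  assume j: "\<iota> l < j" "j < \<tau>"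
  have "As l y j \<le> As l y (\<tau> - 1)" using j by (intro As_mono) auto
  then have 1: "As l y j < H l y" using tau_props(4) by simp
  then have 2: "As l y (j - 1) < H l y" using As_mono[of "j - 1" j] by (meson diff_le_self le_less_trans)
  show "wt l j y = y (j - 1)"
    unfolding wt_def using 1 2 As_step[OF l(1) j(1), of y] j tau_k2 by (simp add: min_def sgn_mult_abs)
qed

lemma wt_after: "\<tau> < j \<Longrightarrow> wt l j y = 0"
proof -
  assume j: "\<tau> < j"
  then have "H l y \<le> As l y (j - 1)" "H l y \<le> As l y j"
    using tau_props(3) As_mono[of \<tau> "j - 1"] As_mono[of \<tau> j] by (simp_all add: order_trans)
  then show ?thesis unfolding wt_def by (simp add: min_def)
qed

text \<open>The partial sum is below the threshold before \<open>\<tau>\<close> and reaches it at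
  \<open>\<tau>\<close>. Hence the last increment is positive, and the equation defining
  \<open>kap\<close> has the single positive root \<open>r\<close>, which is at most
  \<open>1\<close>.\<close>

lemma kap_props:
  shows "kap a b \<mu>0 n l y * y (\<tau> - 1) = wt l \<tau> y" "0 < kap a b \<mu>0 n l y" "kap a b \<mu>0 n l y \<le> 1"
proof -
  let ?y2 = "(y (\<tau> - 1))\<^sup>2"
  define r where "r = sqrt ((H l y - As l y (\<tau> - 1)) / ?y2)"
  have step: "As l y \<tau> = As l y (\<tau> - 1) + ?y2" by (rule As_step[OF l(1) tau_props(1) tau_k2])
  have y2: "0 < ?y2" using step tau_props(3,4) by linarith
  then have yn: "y (\<tau> - 1) \<noteq> 0" by auto
  have le: "H l y - As l y (\<tau> - 1) \<le> ?y2" using step tau_props(3) by linarith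
  have pos: "0 < H l y - As l y (\<tau> - 1)" using tau_props(4) by simp
  have r2: "r\<^sup>2 = (H l y - As l y (\<tau> - 1)) / ?y2" unfolding r_def using pos y2 by simp
  have rp: "0 < r" unfolding r_def using pos y2 by simp
  have r1: "r \<le> 1" unfolding r_def using le y2 by (simp add: divide_le_eq_1)
  have Q: "Qw a b n l \<tau> = 1" by (rule Qw_one[OF l(1) tau_props(1) tau_k2])
  have eq: "As l y (\<tau> - 1) + \<kappa>\<^sup>2 * Qw a b n l \<tau> * ?y2 = H l y \<longleftrightarrow> \<kappa>\<^sup>2 = r\<^sup>2" for \<kappa>
    unfolding Q r2 using y2 by (auto simp: field_simps)
  have k: "kap a b \<mu>0 n l y = r"
    unfolding kap_def Let_def As_def[symmetric]
  proof (rule the_equality)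
    show "0 < r \<and> r \<le> 1 \<and> As l y (\<tau> - 1) + r\<^sup>2 * Qw a b n l \<tau> * ?y2 = H l y" using rp r1 eq by blast
    fix \<kappa> assume "0 < \<kappa> \<and> \<kappa> \<le> 1 \<and> As l y (\<tau> - 1) + \<kappa>\<^sup>2 * Qw a b n l \<tau> * ?y2 = H l y"
    then have "0 < \<kappa>" "\<kappa>\<^sup>2 = r\<^sup>2" using eq by auto
    then show "\<kappa> = r" using rp by (simp add: power2_eq_iff_nonneg)
  qed
  show "0 < kap a b \<mu>0 n l y" "kap a b \<mu>0 n l y \<le> 1" unfolding k by fact+
  have "wt l \<tau> y = sgn (y (\<tau> - 1)) * sqrt (H l y - As l y (\<tau> - 1))"
    unfolding wt_def using tau_props(3,4) by (simp add: min_def)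
  also have "\<dots> = r * y (\<tau> - 1)"
    unfolding r_def real_sqrt_divide using yn by (simp add: sgn_if)
  finally show "kap a b \<mu>0 n l y * y (\<tau> - 1) = wt l \<tau> y" unfolding k by simp
qed

lemma window_sum_split:
  "(\<Sum>j=\<iota> l + 1..k2 l. wt l j y * f j) = (\<Sum>j=\<iota> l + 1..\<tau> - 1. y (j - 1) * f j) + wt l \<tau> y * f \<tau>" for f :: "nat \<Rightarrow> real"
proof -
  have "{\<iota> l + 1..k2 l} = {\<iota> l + 1..\<tau> - 1} \<union> ({\<tau>} \<union> {\<tau> + 1..k2 l})" using tau_props tau_k2 by auto
  moreover have "(\<Sum>j\<in>{\<iota> l + 1..\<tau> - 1} \<union> ({\<tau>} \<union> {\<tau> + 1..k2 l}). wt l j y * f j)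
     = (\<Sum>j=\<iota> l + 1..\<tau> - 1. wt l j y * f j) + (\<Sum>j\<in>{\<tau>} \<union> {\<tau> + 1..k2 l}. wt l j y * f j)"
    using tau_props(1) by (intro sum.union_disjoint) auto
  moreover have "(\<Sum>j\<in>{\<tau>} \<union> {\<tau> + 1..k2 l}. wt l j y * f j) = wt l \<tau> y * f \<tau> + (\<Sum>j=\<tau> + 1..k2 l. wt l j y * f j)"
    by simp
  moreover have "(\<Sum>j=\<tau> + 1..k2 l. wt l j y * f j) = 0" using wt_after by (intro sum.neutral) auto
  moreover have "(\<Sum>j=\<iota> l + 1..\<tau> - 1. wt l j y * f j) = (\<Sum>j=\<iota> l + 1..\<tau> - 1. y (j - 1) * f j)"
    using wt_before by (intro sum.cong) auto
  ultimately show ?thesis by simp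
qed

lemma S_seq_eq: "S_seq a b \<mu>0 n l y = 1 / H l y * (\<Sum>j=\<iota> l + 1..k2 l. wt l j y * y j)"
proof -
  have "(\<Sum>j=\<iota> l + 1..\<tau> - 1. Qw a b n l j * y (j - 1) * y j) = (\<Sum>j=\<iota> l + 1..\<tau> - 1. y (j - 1) * y j)"
    using Qw_one[OF l(1)] tau_k2 by (intro sum.cong) auto
  moreover have "kap a b \<mu>0 n l y * Qw a b n l \<tau> * y (\<tau> - 1) * y \<tau> = wt l \<tau> y * y \<tau>"
    using Qw_one[OF l(1) tau_props(1) tau_k2] kap_props(1) by simp
  ultimately show ?thesis unfolding S_seq_def Let_def window_sum_split using G by simp
qed

text \<open>The sum differs from that of the squared weights, which is the threshold, only at
  \<open>\<tau>\<close>, by the factor \<open>kap\<close> minus its square times one squared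
  observation. The overshoot therefore costs at most one squared observation.\<close>

lemma wt_excess:
  assumes "\<And>j. j \<in> {\<iota> l + 1..k2 l} \<Longrightarrow> (y (j - 1))\<^sup>2 \<le> B"
  shows "H l y \<le> (\<Sum>j=\<iota> l + 1..k2 l. wt l j y * y (j - 1))" "(\<Sum>j=\<iota> l + 1..k2 l. wt l j y * y (j - 1)) \<le> H l y + B"
proof -
  let ?k = "kap a b \<mu>0 n l y"
  have e: "(\<Sum>j=\<iota> l + 1..k2 l. wt l j y * y (j - 1)) - (\<Sum>j=\<iota> l + 1..k2 l. wt l j y * wt l j y) = (?k - ?k\<^sup>2) * (y (\<tau> - 1))\<^sup>2"
  proof -
    have "(\<Sum>j=\<iota> l + 1..\<tau> - 1. y (j - 1) * wt l j y) = (\<Sum>j=\<iota> l + 1..\<tau> - 1. y (j - 1) * y (j - 1))"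
      using wt_before by (intro sum.cong) auto
    then show ?thesis unfolding window_sum_split kap_props(1)[symmetric] by (simp add: power2_eq_square algebra_simps)
  qed
  have "(\<Sum>j=\<iota> l + 1..k2 l. wt l j y * wt l j y) = min (As l y (k2 l)) (H l y)"
    using wt_sum_square[OF l(1) H0 order_refl] by (simp add: power2_eq_square)
  also have "\<dots> = H l y" using order_trans[OF As_end As_mono[of "k2 l - 1" "k2 l" l y]] by simp
  finally have s: "(\<Sum>j=\<iota> l + 1..k2 l. wt l j y * wt l j y) = H l y" .
  have "?k\<^sup>2 \<le> ?k" using kap_props(2,3) unfolding power2_eq_square by (intro mult_left_le) auto
  moreover have "0 \<le> ?k\<^sup>2" by simp
  ultimately have kk: "0 \<le> ?k - ?k\<^sup>2" "?k - ?k\<^sup>2 \<le> 1" using kap_props(3) by linarith+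
  have yB: "(y (\<tau> - 1))\<^sup>2 \<le> B" using tau_props tau_k2 by (intro assms) auto
  show "H l y \<le> (\<Sum>j=\<iota> l + 1..k2 l. wt l j y * y (j - 1))" using e s mult_nonneg_nonneg[OF kk(1), of "(y (\<tau> - 1))\<^sup>2"] by simp
  have "(?k - ?k\<^sup>2) * (y (\<tau> - 1))\<^sup>2 \<le> 1 * (y (\<tau> - 1))\<^sup>2" using kk by (intro mult_right_mono) auto
  then show "(\<Sum>j=\<iota> l + 1..k2 l. wt l j y * y (j - 1)) \<le> H l y + B" using e s yB by simp
qed

lemma wt_mult_nonneg: "0 \<le> wt l j y * y (j - 1)"
proof -
  have "min (As l y (j - 1)) (H l y) \<le> min (As l y j) (H l y)" by (intro min.mono As_mono) auto
  then have "0 \<le> \<bar>y (j - 1)\<bar> * sqrt (min (As l y j) (H l y) - min (As l y (j - 1)) (H l y))" by simp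
  also have "\<dots> = wt l j y * y (j - 1)" unfolding wt_def by (simp add: sgn_if)
  finally show ?thesis .
qed

end

end

locale ar_seq = ar_model a b y0 n p S vs \<epsilon> L + large_windows a b n \<mu>0
  for a b y0 :: real and n :: nat and p S :: "real \<Rightarrow> real" and vs \<epsilon> L \<mu>0 :: real
begin

lemma past_Asum: "past m (\<lambda>y. Asum a b n l y k m)"
  unfolding past_def Asum_def by (intro allI impI sum.cong refl) auto

text \<open>The preliminary estimate uses the observations up to \<open>\<iota> l\<close>, and the
  weights start at \<open>\<iota> l + 1\<close>; so the random threshold is known before it is first
  used.\<close>

lemma past_H: "past (\<iota> l + 1) (\<lambda>y. H l y)"
proof -
  have "S_init a b \<mu>0 n l y = S_init a b \<mu>0 n l y'" if y: "\<forall>i<\<iota> l + 1. y i = y' i" for y y'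
  proof -
    have "(\<Sum>j=1..\<iota> l. Qw a b n l j * y (j - 1) * y j) = (\<Sum>j=1..\<iota> l. Qw a b n l j * y' (j - 1) * y' j)"
      using y by (intro sum.cong) auto
    moreover have "Asum a b n l y 0 (\<iota> l) = Asum a b n l y' 0 (\<iota> l)"
      using y past_Asum[of "\<iota> l" l 0] unfolding past_def by auto
    ultimately show ?thesis unfolding S_init_def by simp
  qed
  then show ?thesis unfolding past_def Hthr_def gamma_tilde_def S_trunc_def by (intro allI impI arg_cong[where f = "\<lambda>x. _ / (1 - (min (max x _) _)\<^sup>2) * _"])
qed

definition "nwt l j y = wt l j y / H l y"

lemma nwt_abs_le:
  assumes l: "1 \<le> l" "l \<le> num_pts n" and j: "\<iota> l < j" "j \<le> k2 l"
  shows "\<bar>nwt l j y\<bar> \<le> 8 / sqrt (real n) * \<bar>y (j - 1)\<bar>"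
proof -
  have "\<bar>nwt l j y\<bar> = 1 / H l y * \<bar>wt l j y\<bar>" unfolding nwt_def using H_bounds(1)[OF l, of y] by simp
  also have "\<dots> \<le> 8 / sqrt (real n) * \<bar>y (j - 1)\<bar>"
    using H_bounds(1,2)[OF l, of y] wt_abs_le[OF l(1) j, of y] by (intro mult_mono) auto
  finally show ?thesis .
qed

lemma predictable_nwt:
  assumes l: "1 \<le> l" "l \<le> num_pts n" and j: "\<iota> l < j" "j \<le> k2 l"
  shows "predictable j (nwt l j)"
  unfolding predictable_def
proof
  have jn: "j - 1 \<le> n" using j k_last_le[of l] by simp
  show "moments (nwt l j)"
    proof (rule moments_dom[where g = "\<lambda>y. y (j - 1)" and C = "8 / sqrt (real n)"])
    show "nwt l j \<in> borel_measurable (obs_space n)" unfolding nwt_def wt_def As_def by measurable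
  qed (use moments_y[OF jn] nwt_abs_le[OF assms] in auto)
  have p: "past j (\<lambda>y. H l y)" "past j (\<lambda>y. As l y j)" "past j (\<lambda>y. As l y (j - 1))"
    using j by (auto simp: As_def intro: past_mono[OF past_H[of l]] past_mono[OF past_Asum])
  show "past j (nwt l j)"
    unfolding past_def
  proof (intro allI impI)
    fix y y' :: "nat \<Rightarrow> real" assume a: "\<forall>i<j. y i = y' i"
    then have "y (j - 1) = y' (j - 1)" using j by auto
    moreover have "H l y = H l y'" "As l y j = As l y' j" "As l y (j - 1) = As l y' (j - 1)"
      using p a unfolding past_def by blast+
    ultimately show "nwt l j y = nwt l j y'" unfolding nwt_def wt_def by (simp only:)
  qed
qed

lemma Sj_near:
  assumes "l \<le> num_pts n" "j \<le> n" "Qw a b n l j = 1"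
  shows "\<bar>Sj j - S (z l)\<bar> \<le> L * bandw a b n"
proof -
  have "\<bar>Sj j - S (z l)\<bar> \<le> L * \<bar>design a b n j - z l\<bar>"
    unfolding Sj_def using assms by (intro S_lipschitz design_mem zpt_mem)
  also have "\<dots> \<le> L * bandw a b n"
    using assms L unfolding Qw_def by (intro mult_left_mono) (auto split: if_splits)
  finally show ?thesis .
qed

lemma S_zpt_le: "l \<le> num_pts n \<Longrightarrow> \<bar>S (z l)\<bar> \<le> 1 - \<epsilon>"
  using zpt_mem S unfolding smooth_class_def by blast

lemma window_subset: "1 \<le> l \<Longrightarrow> l \<le> num_pts n \<Longrightarrow> {\<iota> l + 1..k2 l} \<subseteq> {1..n}"
  using k_last_le[of l] by auto

end

section \<open>From integrated to discrete errors\<close>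

lemma square_diff_le_weighted:
  fixes x s s' \<delta> :: real
  assumes "0 < \<delta>"
  shows "(x - s')\<^sup>2 \<le> (1 + \<delta>) * (x - s)\<^sup>2 + (1 + 1 / \<delta>) * (s - s')\<^sup>2"
proof -
  have "0 \<le> (\<delta> * (x - s) - (s - s'))\<^sup>2 / \<delta>" using assms by simp
  also have "\<dots> = (1 + \<delta>) * (x - s)\<^sup>2 + (1 + 1 / \<delta>) * (s - s')\<^sup>2 - (x - s')\<^sup>2"
    using assms by (simp add: power2_eq_square field_simps)
  finally show ?thesis by simp
qed

context windows
begin

definition "cell l = (if l = 1 then {a..z 1} else {z (l - 1)<..z l})"

lemma zpt_0: "z 0 = a" by (simp add: zpt_def)
lemma zpt_last: "z (num_pts n) = b" using d_pos by (simp add: zpt_def)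
lemma zpt_Suc: "z (Suc l) = z l + (b - a) / real (num_pts n)"
  by (simp add: zpt_def add_divide_distrib algebra_simps)
lemma zpt_mono: "l \<le> m \<Longrightarrow> z l \<le> z m"
  unfolding zpt_def using wab d_pos by (intro add_left_mono mult_right_mono divide_right_mono) auto

lemma cell_bounds: "1 \<le> l \<Longrightarrow> t \<in> cell l \<Longrightarrow> z (l - 1) \<le> t \<and> t \<le> z l"
  unfolding cell_def by (auto simp: zpt_0 split: if_splits)

lemma cell_disjoint: "1 \<le> l \<Longrightarrow> l < m \<Longrightarrow> t \<in> cell l \<Longrightarrow> t \<notin> cell m"
proof
  assume l: "1 \<le> l" "l < m" "t \<in> cell l" "t \<in> cell m"
  have "t \<le> z l" using cell_bounds[OF l(1,3)] by simp
  also have "\<dots> \<le> z (m - 1)" using l by (intro zpt_mono) auto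
  also have "\<dots> < t" using l by (auto simp: cell_def)
  finally show False by simp
qed

lemma cell_cover:
  assumes "t \<in> {a..b}" shows "\<exists>l\<in>I. t \<in> cell l"
proof -
  have d1: "1 \<le> num_pts n" using d_pos by simp
  define l where "l = (LEAST l. 1 \<le> l \<and> t \<le> z l)"
  have ex: "1 \<le> num_pts n \<and> t \<le> z (num_pts n)" using assms d1 zpt_last by simp
  have l: "1 \<le> l" "t \<le> z l" using LeastI[of "\<lambda>l. 1 \<le> l \<and> t \<le> z l", OF ex] unfolding l_def by auto
  have ld: "l \<le> num_pts n" unfolding l_def by (rule Least_le[of "\<lambda>l. 1 \<le> l \<and> t \<le> z l", OF ex])
  have "t \<in> cell l"
  proof (cases "l = 1")
    case False
    then have "\<not> (1 \<le> l - 1 \<and> t \<le> z (l - 1))" using not_less_Least[of "l - 1" "\<lambda>l. 1 \<le> l \<and> t \<le> z l"] l(1) unfolding l_def[symmetric] by linarith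
    then show ?thesis using False l unfolding cell_def by auto
  qed (use l assms in \<open>auto simp: cell_def\<close>)
  then show ?thesis using l ld by auto
qed

lemma cell_sub: "l \<in> I \<Longrightarrow> cell l \<subseteq> {a..b}"
  using cell_bounds[of l] zpt_mono[of 0 "l - 1"] zpt_mono[of l "num_pts n"] unfolding zpt_0 zpt_last by fastforce

lemma cell_measurable [measurable]: "cell l \<in> sets borel" unfolding cell_def by simp

lemma emeasure_cell: "1 \<le> l \<Longrightarrow> emeasure lborel (cell l) = ennreal ((b - a) / real (num_pts n))"
proof -
  assume l: "1 \<le> l"
  then have e: "z l - z (l - 1) = (b - a) / real (num_pts n)" using zpt_Suc[of "l - 1"] by simp
  moreover have "z (l - 1) \<le> z l" by (intro zpt_mono) simp
  ultimately show ?thesis using l unfolding cell_def by (auto simp: zpt_0)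
qed

lemma sum_indicator_cell:
  assumes "l \<in> I" "t \<in> cell l"
  shows "(\<Sum>m\<in>I. indicator (cell m) t * f m) = (f l :: 'a :: semiring_1)"
proof -
  have z: "indicator (cell m) t * f m = (0 :: 'a)" if m: "m \<in> I - {l}" for m
  proof -
    have "t \<notin> cell m"
      using cell_disjoint[of m l t] cell_disjoint[of l m t] assms m by (cases m l rule: linorder_cases) auto
    then show ?thesis by simp
  qed
  have "(\<Sum>m\<in>I. indicator (cell m) t * f m) = (\<Sum>m\<in>{l}. indicator (cell m) t * f m)"
    using assms(1) z by (intro sum.mono_neutral_right) auto
  then show ?thesis using assms(2) by simp
qed

lemma S_lam_eq: "S_lam a b \<mu>0 n \<phi> w y t = (\<Sum>l\<in>I. indicator (cell l) t * S_lam_pt a b \<mu>0 n \<phi> w y l)"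
proof -
  have i: "I = insert 1 {2..num_pts n}" using d_pos by auto
  have "(\<Sum>l\<in>I. indicator (cell l) t * S_lam_pt a b \<mu>0 n \<phi> w y l)
     = indicator (cell 1) t * S_lam_pt a b \<mu>0 n \<phi> w y 1 + (\<Sum>l\<in>{2..num_pts n}. indicator (cell l) t * S_lam_pt a b \<mu>0 n \<phi> w y l)"
    unfolding i by (rule sum.insert) auto
  also have "(\<Sum>l\<in>{2..num_pts n}. indicator (cell l) t * S_lam_pt a b \<mu>0 n \<phi> w y l)
      = (\<Sum>l=2..num_pts n. indicator {z (l - 1)<..z l} t * S_lam_pt a b \<mu>0 n \<phi> w y l)"
    by (intro sum.cong refl) (auto simp: cell_def)
  also have "cell 1 = {a..z 1}" by (simp add: cell_def)
  finally show ?thesis unfolding S_lam_def ..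
qed

end

context ar_model
begin

sublocale windows a b n by unfold_locales (rule ab, rule n)

definition "err \<mu>0 \<phi> w y = (\<integral>\<^sup>+ t\<in>{a..b}. ennreal ((S_lam a b \<mu>0 n \<phi> w y t - S t)\<^sup>2) \<partial>lborel)"
  for \<mu>0 :: real and \<phi> :: "nat \<Rightarrow> real \<Rightarrow> real" and w y :: "nat \<Rightarrow> real"

text \<open>Nothing is known about \<open>S\<close> outside the interval, not even measurability;
  the function cut off there is Borel.\<close>

definition "S' t = S t * indicator {a..b} t"

lemma S_continuous: "continuous_on {a..b} S"
proof -
  obtain D where "\<And>x. x \<in> {a..b} \<Longrightarrow> (S has_real_derivative D x) (at x within {a..b})"
    using S unfolding smooth_class_def by blast
  then show ?thesis by (rule DERIV_continuous_on)
qed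

lemma S'_measurable [measurable]: "S' \<in> borel_measurable borel"
  unfolding S'_def using borel_measurable_continuous_on_indicator[OF _ S_continuous] by (simp add: mult.commute)

lemma cell_integrand_measurable: "(\<lambda>t. ennreal ((c - S' t)\<^sup>2) * indicator (cell l) t) \<in> borel_measurable lborel"
proof -
  have "(\<lambda>t. (c - S' t)\<^sup>2) \<in> borel_measurable borel"
    by (intro borel_measurable_power borel_measurable_diff S'_measurable borel_measurable_const)
  then have "(\<lambda>t. ennreal ((c - S' t)\<^sup>2)) \<in> borel_measurable borel" by (rule measurable_compose[OF _ measurable_ennreal])
  then have "(\<lambda>t. ennreal ((c - S' t)\<^sup>2) * indicator (cell l) t) \<in> borel_measurable borel"
    by (intro borel_measurable_times_ennreal borel_measurable_indicator cell_measurable)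
  then show ?thesis by simp
qed

lemma err_cells: "err \<mu>0 \<phi> w y = (\<Sum>l\<in>I. \<integral>\<^sup>+ t. ennreal ((S_lam_pt a b \<mu>0 n \<phi> w y l - S' t)\<^sup>2) * indicator (cell l) t \<partial>lborel)"
proof -
  let ?p = "S_lam_pt a b \<mu>0 n \<phi> w y"
  have "err \<mu>0 \<phi> w y = (\<integral>\<^sup>+ t. (\<Sum>l\<in>I. ennreal ((?p l - S' t)\<^sup>2) * indicator (cell l) t) \<partial>lborel)"
    unfolding err_def
  proof (rule nn_integral_cong)
    fix t
    show "ennreal ((S_lam a b \<mu>0 n \<phi> w y t - S t)\<^sup>2) * indicator {a..b} t = (\<Sum>l\<in>I. ennreal ((?p l - S' t)\<^sup>2) * indicator (cell l) t)"
    proof (cases "t \<in> {a..b}")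
      case True
      obtain l where l: "l \<in> I" "t \<in> cell l" using cell_cover[OF True] by blast
      show ?thesis unfolding S_lam_eq sum_indicator_cell[OF l]
        using True sum_indicator_cell[OF l, of "\<lambda>l. ennreal ((?p l - S' t)\<^sup>2)"] by (simp add: S'_def mult.commute)
    next
      case False
      then have "t \<notin> cell l" if "l \<in> I" for l using cell_sub[OF that] by blast
      then show ?thesis using False by simp
    qed
  qed
  also have "\<dots> = (\<Sum>l\<in>I. \<integral>\<^sup>+ t. ennreal ((?p l - S' t)\<^sup>2) * indicator (cell l) t \<partial>lborel)"
    by (rule nn_integral_sum) (rule cell_integrand_measurable)
  finally show ?thesis .
qed

text \<open>Both the length of a cell and the weight of the discrete inner product.\<close>

definition "rd = (b - a) / real (num_pts n)"

lemma rd_pos: "0 < rd" unfolding rd_def using ab d_pos by simp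

lemma S_cell:
  assumes "l \<in> I" "t \<in> cell l"
  shows "(S (z l) - S' t)\<^sup>2 \<le> L\<^sup>2 * rd\<^sup>2"
proof -
  have t: "t \<in> {a..b}" using cell_sub assms by blast
  have l: "z l - z (l - 1) = rd" using zpt_Suc[of "l - 1"] assms unfolding rd_def by simp
  have "\<bar>S (z l) - S t\<bar> \<le> L * \<bar>z l - t\<bar>" using assms t by (intro S_lipschitz zpt_mem) auto
  also have "\<dots> \<le> L * rd" using cell_bounds[of l t] assms L l by (intro mult_left_mono) auto
  finally have "\<bar>S (z l) - S t\<bar>\<^sup>2 \<le> (L * rd)\<^sup>2" by (intro power_mono) auto
  then show ?thesis using t by (simp add: S'_def power_mult_distrib)
qed

definition "dErr \<mu>0 \<phi> w y = rd * (\<Sum>l\<in>I. (S_lam_pt a b \<mu>0 n \<phi> w y l - S (z l))\<^sup>2)"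
  for \<mu>0 :: real and \<phi> :: "nat \<Rightarrow> real \<Rightarrow> real" and w y :: "nat \<Rightarrow> real"

lemma nn_integral_cell_const: "1 \<le> l \<Longrightarrow> 0 \<le> c \<Longrightarrow> (\<integral>\<^sup>+ t. ennreal c * indicator (cell l) t \<partial>lborel) = ennreal (rd * c)"
  by (simp add: nn_integral_cmult_indicator emeasure_cell mult.commute ennreal_mult' rd_def[symmetric])

lemma total_cells: "(\<Sum>l\<in>I. rd * c) = (b - a) * c"
  unfolding rd_def using d_pos by simp

text \<open>\<open>S\<close> varies by at most \<open>L * rd\<close> over a cell, and
  \<open>rd\<^sup>2\<close> is of order \<open>1 / n\<close>; once the cross term is split with
  weight \<delta>, the discretisation fits into the remainder.\<close>

lemma err_upper:
  assumes \<delta>: "0 < \<delta>"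
  shows "err \<mu>0 \<phi> w y \<le> ennreal ((1 + \<delta>) * dErr \<mu>0 \<phi> w y + (1 + 1 / \<delta>) * (L\<^sup>2 * rd\<^sup>2 * (b - a)))"
proof -
  let ?p = "S_lam_pt a b \<mu>0 n \<phi> w y"
  let ?c = "\<lambda>l. (1 + \<delta>) * (?p l - S (z l))\<^sup>2 + (1 + 1 / \<delta>) * (L\<^sup>2 * rd\<^sup>2)"
  have c0: "0 \<le> ?c l" for l using \<delta> by simp
  have "err \<mu>0 \<phi> w y \<le> (\<Sum>l\<in>I. ennreal (rd * ?c l))"
    unfolding err_cells
  proof (rule sum_mono)
    fix l assume l: "l \<in> I"
    have "(\<integral>\<^sup>+ t. ennreal ((?p l - S' t)\<^sup>2) * indicator (cell l) t \<partial>lborel) \<le> (\<integral>\<^sup>+ t. ennreal (?c l) * indicator (cell l) t \<partial>lborel)"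
    proof (rule nn_integral_mono)
      fix t
      have "(?p l - S' t)\<^sup>2 \<le> ?c l" if t: "t \<in> cell l"
      proof -
        have "(?p l - S' t)\<^sup>2 \<le> (1 + \<delta>) * (?p l - S (z l))\<^sup>2 + (1 + 1 / \<delta>) * (S (z l) - S' t)\<^sup>2"
          by (rule square_diff_le_weighted[OF \<delta>])
        also have "\<dots> \<le> ?c l" using S_cell[OF l t] \<delta> by (intro add_left_mono mult_left_mono) auto
        finally show ?thesis .
      qed
      then show "ennreal ((?p l - S' t)\<^sup>2) * indicator (cell l) t \<le> ennreal (?c l) * indicator (cell l) t"
        by (auto simp: indicator_def intro!: ennreal_leI)
    qed
    also have "\<dots> = ennreal (rd * ?c l)" using l by (intro nn_integral_cell_const c0) auto
    finally show "(\<integral>\<^sup>+ t. ennreal ((?p l - S' t)\<^sup>2) * indicator (cell l) t \<partial>lborel) \<le> ennreal (rd * ?c l)" .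
  qed
  also have "\<dots> = ennreal (\<Sum>l\<in>I. rd * ?c l)"
    using rd_pos c0 by (intro sum_ennreal) (auto intro!: mult_nonneg_nonneg)
  also have "(\<Sum>l\<in>I. rd * ?c l) = (1 + \<delta>) * dErr \<mu>0 \<phi> w y + (1 + 1 / \<delta>) * (L\<^sup>2 * rd\<^sup>2 * (b - a))"
  proof -
    have "(\<Sum>l\<in>I. rd * ?c l) = (\<Sum>l\<in>I. (1 + \<delta>) * (rd * (?p l - S (z l))\<^sup>2)) + (\<Sum>l\<in>I. rd * ((1 + 1 / \<delta>) * (L\<^sup>2 * rd\<^sup>2)))"
      by (simp only: distrib_left sum.distrib mult.left_commute)
    also have "\<dots> = (1 + \<delta>) * dErr \<mu>0 \<phi> w y + (b - a) * ((1 + 1 / \<delta>) * (L\<^sup>2 * rd\<^sup>2))"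
      unfolding total_cells dErr_def sum_distrib_left ..
    finally show ?thesis by (simp only: mult_ac)
  qed
  finally show ?thesis .
qed

lemma err_lower:
  assumes \<delta>: "0 < \<delta>"
  shows "ennreal (dErr \<mu>0 \<phi> w y) \<le> ennreal (1 + \<delta>) * err \<mu>0 \<phi> w y + ennreal ((1 + 1 / \<delta>) * (L\<^sup>2 * rd\<^sup>2 * (b - a)))"
proof -
  let ?p = "S_lam_pt a b \<mu>0 n \<phi> w y"
  let ?k = "(1 + 1 / \<delta>) * (L\<^sup>2 * rd\<^sup>2)"
  have k0: "0 \<le> ?k" using \<delta> by simp
  have "ennreal (dErr \<mu>0 \<phi> w y) = (\<Sum>l\<in>I. ennreal (rd * (?p l - S (z l))\<^sup>2))"
    unfolding dErr_def sum_distrib_left using rd_pos by (intro sum_ennreal[symmetric]) auto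
  also have "\<dots> \<le> (\<Sum>l\<in>I. ennreal (1 + \<delta>) * (\<integral>\<^sup>+ t. ennreal ((?p l - S' t)\<^sup>2) * indicator (cell l) t \<partial>lborel) + ennreal (rd * ?k))"
  proof (rule sum_mono)
    fix l assume l: "l \<in> I"
    have "ennreal (rd * (?p l - S (z l))\<^sup>2) = (\<integral>\<^sup>+ t. ennreal ((?p l - S (z l))\<^sup>2) * indicator (cell l) t \<partial>lborel)"
      using l by (intro nn_integral_cell_const[symmetric]) auto
    also have "\<dots> \<le> (\<integral>\<^sup>+ t. ennreal (1 + \<delta>) * (ennreal ((?p l - S' t)\<^sup>2) * indicator (cell l) t) + ennreal ?k * indicator (cell l) t \<partial>lborel)"
    proof (rule nn_integral_mono)
      fix t
      have "ennreal ((?p l - S (z l))\<^sup>2) \<le> ennreal (1 + \<delta>) * ennreal ((?p l - S' t)\<^sup>2) + ennreal ?k" if t: "t \<in> cell l"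
      proof -
        have "(?p l - S (z l))\<^sup>2 \<le> (1 + \<delta>) * (?p l - S' t)\<^sup>2 + (1 + 1 / \<delta>) * (S' t - S (z l))\<^sup>2"
          by (rule square_diff_le_weighted[OF \<delta>])
        also have "\<dots> \<le> (1 + \<delta>) * (?p l - S' t)\<^sup>2 + ?k"
          using S_cell[OF l t] \<delta> by (intro add_left_mono mult_left_mono) (auto simp: power2_commute)
        finally have "ennreal ((?p l - S (z l))\<^sup>2) \<le> ennreal ((1 + \<delta>) * (?p l - S' t)\<^sup>2 + ?k)" by (rule ennreal_leI)
        also have "\<dots> = ennreal (1 + \<delta>) * ennreal ((?p l - S' t)\<^sup>2) + ennreal ?k"
          using \<delta> k0 by (simp add: ennreal_plus ennreal_mult)
        finally show ?thesis .
      qed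
      then show "ennreal ((?p l - S (z l))\<^sup>2) * indicator (cell l) t \<le> ennreal (1 + \<delta>) * (ennreal ((?p l - S' t)\<^sup>2) * indicator (cell l) t) + ennreal ?k * indicator (cell l) t"
        by (auto simp: indicator_def)
    qed
    also have "\<dots> = ennreal (1 + \<delta>) * (\<integral>\<^sup>+ t. ennreal ((?p l - S' t)\<^sup>2) * indicator (cell l) t \<partial>lborel) + (\<integral>\<^sup>+ t. ennreal ?k * indicator (cell l) t \<partial>lborel)"
      proof (subst nn_integral_add)
      show "(\<lambda>t. ennreal (1 + \<delta>) * (ennreal ((?p l - S' t)\<^sup>2) * indicator (cell l) t)) \<in> borel_measurable lborel"
        by (intro borel_measurable_times_ennreal cell_integrand_measurable) simp
      show "(\<lambda>t. ennreal ?k * indicator (cell l) t) \<in> borel_measurable lborel"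
        using cell_measurable[of l] by (intro borel_measurable_times_ennreal borel_measurable_indicator) auto
    qed (simp only: nn_integral_cmult[OF cell_integrand_measurable])
    also have "(\<integral>\<^sup>+ t. ennreal ?k * indicator (cell l) t \<partial>lborel) = ennreal (rd * ?k)"
      using l by (intro nn_integral_cell_const k0) auto
    finally show "ennreal (rd * (?p l - S (z l))\<^sup>2) \<le> ennreal (1 + \<delta>) * (\<integral>\<^sup>+ t. ennreal ((?p l - S' t)\<^sup>2) * indicator (cell l) t \<partial>lborel) + ennreal (rd * ?k)" .
  qed
  also have "\<dots> = ennreal (1 + \<delta>) * err \<mu>0 \<phi> w y + ennreal (\<Sum>l\<in>I. rd * ?k)"
  proof -
    have "(\<Sum>l\<in>I. ennreal (rd * ?k)) = ennreal (\<Sum>l\<in>I. rd * ?k)"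
      using rd_pos k0 by (intro sum_ennreal) (auto intro!: mult_nonneg_nonneg)
    then show ?thesis unfolding err_cells sum.distrib sum_distrib_left by (simp only:)
  qed
  also have "(\<Sum>l\<in>I. rd * ?k) = (1 + 1 / \<delta>) * (L\<^sup>2 * rd\<^sup>2 * (b - a))"
    unfolding total_cells by (simp only: mult_ac)
  finally show ?thesis .
qed

end

section \<open>Remainder terms\<close>

lemma sum_square_diff: "(\<Sum>l\<in>J. (g l - f l)\<^sup>2) = (\<Sum>l\<in>J. (g l)\<^sup>2) - 2 * (\<Sum>l\<in>J. f l * g l) + (\<Sum>l\<in>J. (f l)\<^sup>2)"
  for f g :: "'a \<Rightarrow> real"
proof -
  have "(\<Sum>l\<in>J. (g l - f l)\<^sup>2) = (\<Sum>l\<in>J. (g l)\<^sup>2 - 2 * (f l * g l) + (f l)\<^sup>2)"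
    by (intro sum.cong refl) (simp add: power2_diff mult_ac)
  then show ?thesis by (simp only: sum.distrib sum_subtractf sum_distrib_left)
qed

locale ar_select = ar_seq a b y0 n p S vs \<epsilon> L \<mu>0
  for a b y0 :: real and n :: nat and p S :: "real \<Rightarrow> real" and vs \<epsilon> L \<mu>0 :: real +
  fixes \<phi> :: "nat \<Rightarrow> real \<Rightarrow> real"
  assumes orth: "orthonormal_system a b n \<phi>"
begin

section \<open>Fourier analysis on the grid\<close>

definition "fcoef f k = rd * (\<Sum>l\<in>I. f l * \<phi> k (z l))"

lemma rd_le: "rd \<le> 2 * (b - a) / sqrt (real n)"
proof -
  have "(b - a) * sqrt (real n) \<le> (b - a) * (2 * real (num_pts n))"
    using num_pts_bounds(3)[OF n] ab by (intro mult_left_mono) auto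
  then show ?thesis unfolding rd_def using d_pos n by (simp add: field_simps)
qed

lemma phi_orth: "k \<in> I \<Longrightarrow> k' \<in> I \<Longrightarrow> rd * (\<Sum>l\<in>I. \<phi> k (z l) * \<phi> k' (z l)) = of_bool (k = k')"
  using orth unfolding orthonormal_system_def rd_def by blast

lemma fcoef_combination:
  assumes k: "k \<in> I" shows "fcoef (\<lambda>l. \<Sum>i\<in>I. w i * \<phi> i (z l)) k = w k"
proof -
  have "fcoef (\<lambda>l. \<Sum>i\<in>I. w i * \<phi> i (z l)) k = rd * (\<Sum>l\<in>I. \<Sum>i\<in>I. w i * (\<phi> i (z l) * \<phi> k (z l)))"
    unfolding fcoef_def by (simp add: sum_distrib_right mult.assoc)
  also have "\<dots> = (\<Sum>i\<in>I. w i * (rd * (\<Sum>l\<in>I. \<phi> i (z l) * \<phi> k (z l))))"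
    by (subst sum.swap) (simp add: sum_distrib_left mult_ac)
  also have "\<dots> = (\<Sum>i\<in>I. w i * of_bool (i = k))"
    using k by (intro sum.cong refl arg_cong2[where f = "(*)"] phi_orth)
  also have "\<dots> = w k" using k by simp
  finally show ?thesis .
qed

lemma sum_mult_combination: "rd * (\<Sum>l\<in>I. f l * (\<Sum>i\<in>I. w i * \<phi> i (z l))) = (\<Sum>i\<in>I. w i * fcoef f i)"
proof -
  have "rd * (\<Sum>l\<in>I. f l * (\<Sum>i\<in>I. w i * \<phi> i (z l))) = (\<Sum>l\<in>I. \<Sum>i\<in>I. rd * (f l * (w i * \<phi> i (z l))))"
    by (simp add: sum_distrib_left)
  also have "\<dots> = (\<Sum>i\<in>I. w i * fcoef f i)"
    unfolding fcoef_def by (subst sum.swap) (simp add: sum_distrib_left mult_ac)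
  finally show ?thesis .
qed

lemma parseval: "rd * (\<Sum>l\<in>I. (\<Sum>i\<in>I. w i * \<phi> i (z l))\<^sup>2) = (\<Sum>i\<in>I. (w i)\<^sup>2)"
  unfolding power2_eq_square sum_mult_combination by (intro sum.cong refl arg_cong2[where f = "(*)"] fcoef_combination)

lemma error_expansion:
  "rd * (\<Sum>l\<in>I. ((\<Sum>i\<in>I. w i * \<phi> i (z l)) - f l)\<^sup>2) = (\<Sum>i\<in>I. (w i)\<^sup>2) - 2 * (\<Sum>i\<in>I. w i * fcoef f i) + rd * (\<Sum>l\<in>I. (f l)\<^sup>2)"
proof -
  have "rd * (\<Sum>l\<in>I. ((\<Sum>i\<in>I. w i * \<phi> i (z l)) - f l)\<^sup>2)
     = rd * (\<Sum>l\<in>I. (\<Sum>i\<in>I. w i * \<phi> i (z l))\<^sup>2) - 2 * (rd * (\<Sum>l\<in>I. f l * (\<Sum>i\<in>I. w i * \<phi> i (z l)))) + rd * (\<Sum>l\<in>I. (f l)\<^sup>2)"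
    unfolding sum_square_diff by (simp only: distrib_left right_diff_distrib mult.left_commute)
  then show ?thesis unfolding parseval sum_mult_combination .
qed

text \<open>The defect is the squared distance of \<open>f\<close> to its projection onto the
  system.\<close>

lemma bessel: "(\<Sum>k\<in>I. (fcoef f k)\<^sup>2) \<le> rd * (\<Sum>l\<in>I. (f l)\<^sup>2)"
proof -
  have "0 \<le> rd * (\<Sum>l\<in>I. ((\<Sum>i\<in>I. fcoef f i * \<phi> i (z l)) - f l)\<^sup>2)"
    using rd_pos by (intro mult_nonneg_nonneg sum_nonneg) auto
  then show ?thesis unfolding error_expansion by (simp add: power2_eq_square)
qed

text \<open>\<open>blk j\<close> is the unique \<open>l\<close> whose window contains \<open>j\<close>, and \<open>0\<close> if there is none.\<close>

definition "blk j = (if \<exists>l\<in>I. \<iota> l < j \<and> j \<le> k2 l then THE l. l \<in> I \<and> \<iota> l < j \<and> j \<le> k2 l else 0)"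

lemma window_unique: "l \<in> I \<Longrightarrow> l' \<in> I \<Longrightarrow> \<iota> l < j \<Longrightarrow> j \<le> k2 l \<Longrightarrow> \<iota> l' < j \<Longrightarrow> j \<le> k2 l' \<Longrightarrow> l = l'"
  using disjoint_windows[of l l'] disjoint_windows[of l' l] by (cases l l' rule: linorder_cases) auto

lemma blk_eq: "l \<in> I \<Longrightarrow> blk j = l \<longleftrightarrow> \<iota> l < j \<and> j \<le> k2 l"
proof -
  assume l: "l \<in> I"
  have 1: "blk j = l'" if "l' \<in> I" "\<iota> l' < j" "j \<le> k2 l'" for l'
    unfolding blk_def using that window_unique by (auto intro!: the_equality)
  show ?thesis
  proof
    assume b: "blk j = l"
    then have "\<exists>l\<in>I. \<iota> l < j \<and> j \<le> k2 l" using l unfolding blk_def by (auto split: if_splits)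
    then obtain l' where "l' \<in> I" "\<iota> l' < j" "j \<le> k2 l'" by blast
    with 1[OF this] b show "\<iota> l < j \<and> j \<le> k2 l" by simp
  qed (use 1 l in blast)
qed

lemma blk_mem: "blk j \<in> {0..num_pts n}"
proof (cases "\<exists>l\<in>I. \<iota> l < j \<and> j \<le> k2 l")
  case True
  then obtain l where "l \<in> I" "\<iota> l < j" "j \<le> k2 l" by blast
  then have "blk j = l" using blk_eq by blast
  then show ?thesis using \<open>l \<in> I\<close> by simp
next
  case False
  then have "blk j = 0" unfolding blk_def by (rule if_not_P)
  then show ?thesis by simp
qed

lemma block_sum:
  fixes h :: "nat \<Rightarrow> real"
  assumes "\<And>j. blk j = 0 \<Longrightarrow> h j = 0"
  shows "(\<Sum>j=1..n. h j) = (\<Sum>l\<in>I. \<Sum>j=\<iota> l + 1..k2 l. h j)"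
proof -
  have "(\<Sum>j=1..n. h j) = (\<Sum>l\<in>{0..num_pts n}. \<Sum>j\<in>{j \<in> {1..n}. blk j = l}. h j)"
    using blk_mem by (intro sum.group[symmetric]) blast+
  also have "{0..num_pts n} = insert 0 I" by auto
  also have "(\<Sum>l\<in>insert 0 I. \<Sum>j\<in>{j \<in> {1..n}. blk j = l}. h j) = (\<Sum>l\<in>I. \<Sum>j\<in>{j \<in> {1..n}. blk j = l}. h j)"
    using assms by simp
  also have "\<dots> = (\<Sum>l\<in>I. \<Sum>j=\<iota> l + 1..k2 l. h j)"
  proof (rule sum.cong[OF refl])
    fix l assume l: "l \<in> I"
    have "{j \<in> {1..n}. blk j = l} = {\<iota> l + 1..k2 l}"
    proof (intro set_eqI iffI)
      fix j assume "j \<in> {j \<in> {1..n}. blk j = l}"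
      then have "blk j = l" by blast
      then have "\<iota> l < j \<and> j \<le> k2 l" using blk_eq[OF l] by blast
      then show "j \<in> {\<iota> l + 1..k2 l}" by simp
    next
      fix j assume j: "j \<in> {\<iota> l + 1..k2 l}"
      then have "\<iota> l < j \<and> j \<le> k2 l" by simp
      then have "blk j = l" using blk_eq[OF l] by blast
      moreover have "j \<in> {1..n}" using window_subset[of l] l j by (meson atLeastAtMost_iff subsetD)
      ultimately show "j \<in> {j \<in> {1..n}. blk j = l}" by blast
    qed
    then show "(\<Sum>j\<in>{j \<in> {1..n}. blk j = l}. h j) = (\<Sum>j=\<iota> l + 1..k2 l. h j)" by simp
  qed
  finally show ?thesis .
qed

text \<open>Because the windows are disjoint, the weights of all sequential estimators can be glued
  to one predictable sequence in time. Every \<open>U k\<close> then becomes a single sum over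
  \<open>{1..n}\<close> with these weights and the deterministic coefficients
  \<open>\<psi> k\<close>.\<close>

definition "gwt j y = (if blk j = 0 then 0 else nwt (blk j) j y)"
definition "\<psi> k j = (if blk j = 0 then 0 else rd * \<phi> k (z (blk j)))"
definition "A = 8 / sqrt (real n)"

lemma A_pos: "0 < A" unfolding A_def using n by simp

lemma gwt_props:
  shows "predictable j (gwt j)" "\<bar>gwt j y\<bar> \<le> A * \<bar>y (j - 1)\<bar>"
proof -
  have b: "blk j \<in> I" "\<iota> (blk j) < j" "j \<le> k2 (blk j)" if "blk j \<noteq> 0"
  proof -
    show "blk j \<in> I" using blk_mem[of j] that by auto
    then show "\<iota> (blk j) < j" "j \<le> k2 (blk j)" using blk_eq by blast+
  qed
  show "predictable j (gwt j)"
  proof (cases "blk j = 0")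
    case True
    then have "gwt j = (\<lambda>_. 0)" unfolding gwt_def by auto
    then show ?thesis using predictable_const by simp
  next
    case False
    then have "gwt j = nwt (blk j) j" unfolding gwt_def by auto
    then show ?thesis using b[OF False] predictable_nwt[of "blk j" j] by auto
  qed
  show "\<bar>gwt j y\<bar> \<le> A * \<bar>y (j - 1)\<bar>"
    using b nwt_abs_le[of "blk j" j y] A_pos unfolding gwt_def A_def by (cases "blk j = 0") auto
qed

definition "u l y = (\<Sum>j=\<iota> l + 1..k2 l. nwt l j y * xi j y)"
definition "V l y = (\<Sum>j=\<iota> l + 1..k2 l. (nwt l j y)\<^sup>2)"
definition "U k y = fcoef (\<lambda>l. u l y) k"
text \<open>The predictable variance of \<open>U k\<close>, kept in a form that is exact off
  \<open>Gam\<close> as well, so that \<open>(U k y)\<^sup>2 - tV k y\<close> is a sum of martingale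
  differences on the whole space. On \<open>Gam\<close> it is \<open>rd\<close> times the
  \<open>s_var\<close> of the cost.\<close>

definition "tV k y = rd\<^sup>2 * (\<Sum>l\<in>I. V l y * (\<phi> k (z l))\<^sup>2)"

lemma in_window: "l \<in> I \<Longrightarrow> j \<in> {\<iota> l + 1..k2 l} \<Longrightarrow> blk j = l \<and> blk j \<noteq> 0"
  using blk_eq[of l j] by auto

lemma window_sum_cong:
  fixes f g :: "nat \<Rightarrow> nat \<Rightarrow> real"
  assumes "\<And>l j. blk j = l \<Longrightarrow> l \<noteq> 0 \<Longrightarrow> f l j = g l j"
  shows "(\<Sum>l\<in>I. \<Sum>j=\<iota> l + 1..k2 l. f l j) = (\<Sum>l\<in>I. \<Sum>j=\<iota> l + 1..k2 l. g l j)"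
proof (intro sum.cong[OF refl])
  fix l j assume "l \<in> I" "j \<in> {\<iota> l + 1..k2 l}"
  then have "blk j = l" "l \<noteq> 0" using in_window by blast+
  then show "f l j = g l j" by (rule assms)
qed

lemma U_eq: "U k y = (\<Sum>j=1..n. \<psi> k j * (gwt j y * xi j y))"
proof -
  have "(\<Sum>j=1..n. \<psi> k j * (gwt j y * xi j y)) = (\<Sum>l\<in>I. \<Sum>j=\<iota> l + 1..k2 l. \<psi> k j * (gwt j y * xi j y))"
    by (intro block_sum) (simp add: \<psi>_def)
  also have "\<dots> = (\<Sum>l\<in>I. \<Sum>j=\<iota> l + 1..k2 l. rd * \<phi> k (z l) * (nwt l j y * xi j y))"
    by (intro window_sum_cong) (simp add: \<psi>_def gwt_def)
  also have "\<dots> = U k y" unfolding U_def u_def fcoef_def by (simp add: sum_distrib_left sum_distrib_right mult_ac)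
  finally show ?thesis by simp
qed

lemma tV_eq: "tV k y = (\<Sum>j=1..n. (\<psi> k j)\<^sup>2 * (gwt j y)\<^sup>2)"
proof -
  have "(\<Sum>j=1..n. (\<psi> k j)\<^sup>2 * (gwt j y)\<^sup>2) = (\<Sum>l\<in>I. \<Sum>j=\<iota> l + 1..k2 l. (\<psi> k j)\<^sup>2 * (gwt j y)\<^sup>2)"
    by (intro block_sum) (simp add: \<psi>_def)
  also have "\<dots> = (\<Sum>l\<in>I. \<Sum>j=\<iota> l + 1..k2 l. (rd * \<phi> k (z l))\<^sup>2 * (nwt l j y)\<^sup>2)"
    by (intro window_sum_cong) (simp add: \<psi>_def gwt_def)
  also have "\<dots> = tV k y" unfolding tV_def V_def by (simp add: sum_distrib_left sum_distrib_right power_mult_distrib mult_ac)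
  finally show ?thesis by simp
qed

lemma window_sum_const_le:
  assumes "\<And>l. l \<in> I \<Longrightarrow> 0 \<le> f l"
  shows "(\<Sum>l\<in>I. \<Sum>j=\<iota> l + 1..k2 l. f l) \<le> 2 * sqrt (real n) * (\<Sum>l\<in>I. f l)"
  unfolding sum_distrib_left
proof (rule sum_mono)
  fix l assume l: "l \<in> I"
  have "real (card {\<iota> l + 1..k2 l}) \<le> 2 * sqrt (real n)"
    using window_card_le[of l] iota_less[of l] l by (simp add: of_nat_diff)
  then show "(\<Sum>j=\<iota> l + 1..k2 l. f l) \<le> 2 * sqrt (real n) * f l"
    using assms[OF l] by (simp add: mult_right_mono)
qed

definition "\<theta> k = fcoef (\<lambda>l. S (z l)) k"
definition "lin_rem w y = (\<Sum>k\<in>I. w k * \<theta> k * U k y)\<^sup>2 / (\<Sum>k\<in>I. (w k)\<^sup>2 * (\<theta> k)\<^sup>2)"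
text \<open>A deterministic floor for \<open>tV k\<close> on \<open>Gam\<close>, uniform in
  \<open>k\<close>. Normalising the quadratic form by it instead of by the random variances leaves
  only a second moment to be computed.\<close>

definition "t0 = rd * (eps_tilde n / (2 * sqrt (real n)))"
definition "quad_rem w y = (\<Sum>k\<in>I. w k * ((U k y)\<^sup>2 - tV k y))\<^sup>2 / (t0 * (\<Sum>k\<in>I. (w k)\<^sup>2))"

lemma t0_pos: "0 < t0" unfolding t0_def using rd_pos eps_tilde_bounds n by simp

lemma lin_rem_nonneg: "0 \<le> lin_rem w y" unfolding lin_rem_def by (intro divide_nonneg_nonneg sum_nonneg) auto
lemma quad_rem_nonneg: "0 \<le> quad_rem w y" unfolding quad_rem_def using t0_pos by (intro divide_nonneg_nonneg mult_nonneg_nonneg sum_nonneg) auto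

lemma moments_gwt: "moments (gwt j)" using gwt_props(1) predictable_moments by blast

lemma moments_U: "moments (\<lambda>y. U k y)"
  unfolding U_eq by (intro moments_sum moments_mult moments_const moments_gwt moments_xi)

lemma moments_tV: "moments (\<lambda>y. tV k y)"
  unfolding tV_eq by (intro moments_sum moments_mult moments_const moments_power moments_gwt)

lemma moments_lin_rem: "moments (\<lambda>y. lin_rem w y)"
  unfolding lin_rem_def divide_inverse by (intro moments_mult moments_power moments_sum moments_const moments_U)

lemma moments_quad_rem: "moments (\<lambda>y. quad_rem w y)"
  unfolding quad_rem_def divide_inverse by (intro moments_mult moments_power moments_sum moments_diff moments_const moments_U moments_tV)

text \<open>By Parseval the coefficients \<open>g j\<close> have total square at most
  \<open>2 * sqrt (real n) * (rd * D)\<close>, a bounded multiple of \<open>D\<close>, which cancels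
  the denominator. The gain is \<open>A\<^sup>2 = 64 / real n\<close>, and \<open>256\<close> is
  \<open>64 * 4\<close>.\<close>

lemma lin_rem_moment: "(\<integral>y. lin_rem w y \<partial>P) \<le> 256 * (b - a) * mart_const 1 * Cy 1 * vs\<^sup>2 / real n"
proof -
  define D where "D = (\<Sum>k\<in>I. (w k)\<^sup>2 * (\<theta> k)\<^sup>2)"
  define g where "g j = (\<Sum>k\<in>I. w k * \<theta> k * \<psi> k j)" for j
  define c where "c = mart_const 1 * Cy 1 * vs\<^sup>2"
  have c0: "0 \<le> c" unfolding c_def using mart_const_pos[of 1] Cy_pos[of 1] vs by simp
  have df1: "odd_double_fact 1 = 1" by (simp add: odd_double_fact_def)
  have D0: "0 \<le> D" unfolding D_def by (intro sum_nonneg) auto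
  have m: "(\<Sum>k\<in>I. w k * \<theta> k * U k y) = (\<Sum>j=1..n. g j * (gwt j y * xi j y))" for y
    unfolding U_eq g_def sum_distrib_left sum_distrib_right by (subst sum.swap) (simp add: mult_ac)
  have gs: "(\<Sum>j=1..n. (g j)\<^sup>2) \<le> 2 * sqrt (real n) * (rd * D)"
  proof -
    have "(\<Sum>j=1..n. (g j)\<^sup>2) = (\<Sum>l\<in>I. \<Sum>j=\<iota> l + 1..k2 l. (g j)\<^sup>2)"
      by (intro block_sum) (simp add: g_def \<psi>_def)
    also have "\<dots> = (\<Sum>l\<in>I. \<Sum>j=\<iota> l + 1..k2 l. rd\<^sup>2 * (\<Sum>k\<in>I. (w k * \<theta> k) * \<phi> k (z l))\<^sup>2)"
      unfolding power_mult_distrib[symmetric] g_def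
      by (intro window_sum_cong arg_cong[where f = "\<lambda>x. x\<^sup>2"]) (simp add: \<psi>_def sum_distrib_left mult_ac)
    also have "\<dots> \<le> 2 * sqrt (real n) * (\<Sum>l\<in>I. rd\<^sup>2 * (\<Sum>k\<in>I. (w k * \<theta> k) * \<phi> k (z l))\<^sup>2)"
      by (intro window_sum_const_le) simp
    also have "(\<Sum>l\<in>I. rd\<^sup>2 * (\<Sum>k\<in>I. (w k * \<theta> k) * \<phi> k (z l))\<^sup>2) = rd * (rd * (\<Sum>l\<in>I. (\<Sum>k\<in>I. (w k * \<theta> k) * \<phi> k (z l))\<^sup>2))"
      by (simp add: power2_eq_square sum_distrib_left mult.assoc)
    also have "\<dots> = rd * D" unfolding parseval D_def by (simp add: power_mult_distrib)
    finally show ?thesis .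
  qed
  have "(\<integral>y. (\<Sum>j=1..n. g j * (gwt j y * xi j y)) ^ (2 * 1) \<partial>P)
     \<le> mart_const 1 * (\<Sum>j=1..n. (g j)\<^sup>2) ^ 1 * (A ^ (2 * 1) * (Cy 1 * vs ^ 1) * (vs ^ 1 * odd_double_fact 1))"
    using A_pos by (intro linear_noise_moment gwt_props) auto
  also have "\<dots> = c * A\<^sup>2 * (\<Sum>j=1..n. (g j)\<^sup>2)" unfolding df1 c_def by (simp add: power2_eq_square mult_ac)
  also have "\<dots> \<le> c * A\<^sup>2 * (2 * sqrt (real n) * (rd * D))" by (intro mult_left_mono gs mult_nonneg_nonneg c0) auto
  also have "\<dots> \<le> c * A\<^sup>2 * (2 * sqrt (real n) * (2 * (b - a) / sqrt (real n) * D))"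
    using rd_le D0 c0 by (intro mult_left_mono mult_right_mono mult_nonneg_nonneg) auto
  also have "\<dots> = 256 * (b - a) * c / real n * D"
    unfolding A_def using n by (simp add: power_divide field_simps)
  finally have le: "(\<integral>y. (\<Sum>j=1..n. g j * (gwt j y * xi j y))\<^sup>2 \<partial>P) \<le> 256 * (b - a) * c / real n * D" by simp
  have r0: "0 \<le> 256 * (b - a) * c / real n" using c0 ab by simp
  have "(\<integral>y. lin_rem w y \<partial>P) = (\<integral>y. (\<Sum>j=1..n. g j * (gwt j y * xi j y))\<^sup>2 \<partial>P) / D"
    unfolding lin_rem_def m D_def[symmetric] by simp
  also have "\<dots> \<le> 256 * (b - a) * c / real n"
    using le D0 r0 by (cases "D = 0") (auto simp: divide_le_eq)
  finally show ?thesis unfolding c_def by (simp add: mult.assoc)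
qed

definition "quad_const = mart_const 1 * (Cy 2 * (10 + 12 * mart_const 2))"

lemma quad_const_pos: "0 < quad_const" unfolding quad_const_def using mart_const_pos[of 1] mart_const_pos[of 2] Cy_pos[of 2] by simp

text \<open>The kernel \<open>\<kappa>\<close> is constant on products of windows and zero
  elsewhere, so its squared Hilbert-Schmidt norm follows from Parseval: at most
  \<open>4 * real n * (rd\<^sup>2 * W)\<close>. With \<open>A ^ 4 = 4096 / (real n)\<^sup>2\<close>
  and \<open>rd\<^sup>2 / t0\<close> of order \<open>1 / eps_tilde n\<close>, the factor
  \<open>W\<close> cancels and \<open>1 / n\<close> remains up to a logarithm and powers of
  \<open>vs\<close>.\<close>

lemma quad_rem_moment: "(\<integral>y. quad_rem w y \<partial>P) \<le> 65536 * (b - a) * quad_const * vs ^ 4 / (eps_tilde n * real n)"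
proof -
  define W where "W = (\<Sum>k\<in>I. (w k)\<^sup>2)"
  define \<kappa> where "\<kappa> i j = (\<Sum>k\<in>I. w k * \<psi> k i * \<psi> k j)" for i j
  have W0: "0 \<le> W" unfolding W_def by (intro sum_nonneg) auto
  have q: "(\<Sum>k\<in>I. w k * ((U k y)\<^sup>2 - tV k y)) =
     (\<Sum>i=1..n. \<Sum>j=1..n. \<kappa> i j * (gwt i y * xi i y) * (gwt j y * xi j y)) - (\<Sum>j=1..n. \<kappa> j j * (gwt j y)\<^sup>2)" for y
  proof -
    have "(\<Sum>k\<in>I. w k * (U k y)\<^sup>2) = (\<Sum>k\<in>I. \<Sum>i=1..n. \<Sum>j=1..n. w k * \<psi> k i * \<psi> k j * (gwt i y * xi i y) * (gwt j y * xi j y))"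
    proof (intro sum.cong[OF refl])
      fix k
      have "(U k y)\<^sup>2 = (\<Sum>i=1..n. \<Sum>j=1..n. \<psi> k i * (gwt i y * xi i y) * (\<psi> k j * (gwt j y * xi j y)))"
        unfolding U_eq power2_eq_square by (rule sum_product)
      then show "w k * (U k y)\<^sup>2 = (\<Sum>i=1..n. \<Sum>j=1..n. w k * \<psi> k i * \<psi> k j * (gwt i y * xi i y) * (gwt j y * xi j y))"
        unfolding sum_distrib_left by (simp add: sum_distrib_left mult_ac)
    qed
    also have "\<dots> = (\<Sum>i=1..n. \<Sum>j=1..n. \<kappa> i j * (gwt i y * xi i y) * (gwt j y * xi j y))"
      unfolding \<kappa>_def sum_distrib_right
      by (subst sum.swap, intro sum.cong[OF refl], subst sum.swap) (rule refl)
    finally have 1: "(\<Sum>k\<in>I. w k * (U k y)\<^sup>2) = (\<Sum>i=1..n. \<Sum>j=1..n. \<kappa> i j * (gwt i y * xi i y) * (gwt j y * xi j y))" .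
    have 2: "(\<Sum>k\<in>I. w k * tV k y) = (\<Sum>j=1..n. \<kappa> j j * (gwt j y)\<^sup>2)"
      unfolding tV_eq \<kappa>_def sum_distrib_left sum_distrib_right
      by (subst sum.swap) (simp add: power2_eq_square mult_ac)
    show ?thesis using 1 2 by (simp add: right_diff_distrib sum_subtractf)
  qed
  define Kb where "Kb l m = rd\<^sup>2 * (\<Sum>k\<in>I. (w k * \<phi> k (z l)) * \<phi> k (z m))" for l m
  have \<kappa>Kb: "\<kappa> i j = Kb l m" if "l \<in> I" "m \<in> I" "i \<in> {\<iota> l + 1..k2 l}" "j \<in> {\<iota> m + 1..k2 m}" for i j l m
    unfolding \<kappa>_def Kb_def using in_window[OF that(1,3)] in_window[OF that(2,4)]
    by (simp add: \<psi>_def sum_distrib_left power2_eq_square mult_ac)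
  \<comment> \<open>Parseval in \<open>m\<close> for fixed \<open>l\<close>, then the normalisation
    of \<open>\<phi> k\<close> in \<open>l\<close>.\<close>
  have Kbs: "(\<Sum>l\<in>I. \<Sum>m\<in>I. (Kb l m)\<^sup>2) = rd\<^sup>2 * W"
  proof -
    have inner: "(\<Sum>m\<in>I. (Kb l m)\<^sup>2) = rd ^ 3 * (\<Sum>k\<in>I. (w k * \<phi> k (z l))\<^sup>2)" for l
    proof -
      have "(\<Sum>m\<in>I. (Kb l m)\<^sup>2) = rd ^ 3 * (rd * (\<Sum>m\<in>I. (\<Sum>k\<in>I. (w k * \<phi> k (z l)) * \<phi> k (z m))\<^sup>2))"
      proof -
        have "(rd\<^sup>2 * x)\<^sup>2 = rd ^ 3 * (rd * x\<^sup>2)" for x by (simp add: eval_nat_numeral mult_ac)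
        then show ?thesis unfolding Kb_def by (simp only: sum_distrib_left[of rd] sum_distrib_left[of "rd ^ 3"])
      qed
      then show ?thesis unfolding parseval .
    qed
    have "(\<Sum>l\<in>I. \<Sum>m\<in>I. (Kb l m)\<^sup>2) = (\<Sum>l\<in>I. \<Sum>k\<in>I. rd\<^sup>2 * ((w k)\<^sup>2 * (rd * (\<phi> k (z l) * \<phi> k (z l)))))"
      unfolding inner sum_distrib_left by (simp add: eval_nat_numeral mult_ac)
    also have "\<dots> = rd\<^sup>2 * (\<Sum>k\<in>I. (w k)\<^sup>2 * (rd * (\<Sum>l\<in>I. \<phi> k (z l) * \<phi> k (z l))))"
      by (subst sum.swap) (simp add: sum_distrib_left)
    also have "\<dots> = rd\<^sup>2 * W" unfolding W_def using phi_orth by (intro arg_cong2[where f = "(*)"] sum.cong refl) simp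
    finally show ?thesis .
  qed
  have \<kappa>s: "(\<Sum>i=1..n. \<Sum>j=1..n. (\<kappa> i j)\<^sup>2) \<le> 4 * real n * (rd\<^sup>2 * W)"
  proof -
    have z: "(\<kappa> i j)\<^sup>2 = 0" if "blk i = 0 \<or> blk j = 0" for i j using that unfolding \<kappa>_def \<psi>_def by auto
    have "(\<Sum>i=1..n. \<Sum>j=1..n. (\<kappa> i j)\<^sup>2) = (\<Sum>l\<in>I. \<Sum>i=\<iota> l + 1..k2 l. \<Sum>j=1..n. (\<kappa> i j)\<^sup>2)"
      using z by (intro block_sum sum.neutral ballI) blast
    also have "\<dots> = (\<Sum>l\<in>I. \<Sum>i=\<iota> l + 1..k2 l. \<Sum>m\<in>I. \<Sum>j=\<iota> m + 1..k2 m. (Kb l m)\<^sup>2)"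
    proof (rule sum.cong[OF refl], rule sum.cong[OF refl])
      fix l i assume l: "l \<in> I" "i \<in> {\<iota> l + 1..k2 l}"
      have "(\<Sum>j=1..n. (\<kappa> i j)\<^sup>2) = (\<Sum>m\<in>I. \<Sum>j=\<iota> m + 1..k2 m. (\<kappa> i j)\<^sup>2)" using z by (intro block_sum) blast
      also have "\<dots> = (\<Sum>m\<in>I. \<Sum>j=\<iota> m + 1..k2 m. (Kb l m)\<^sup>2)" using \<kappa>Kb[OF l(1) _ l(2)] by (intro sum.cong refl) auto
      finally show "(\<Sum>j=1..n. (\<kappa> i j)\<^sup>2) = (\<Sum>m\<in>I. \<Sum>j=\<iota> m + 1..k2 m. (Kb l m)\<^sup>2)" .
    qed
    also have "\<dots> \<le> 2 * sqrt (real n) * (\<Sum>l\<in>I. \<Sum>m\<in>I. \<Sum>j=\<iota> m + 1..k2 m. (Kb l m)\<^sup>2)"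
      by (intro window_sum_const_le sum_nonneg) auto
    also have "\<dots> \<le> 2 * sqrt (real n) * (\<Sum>l\<in>I. 2 * sqrt (real n) * (\<Sum>m\<in>I. (Kb l m)\<^sup>2))"
      by (intro mult_left_mono sum_mono window_sum_const_le) auto
    also have "\<dots> = 4 * real n * (\<Sum>l\<in>I. \<Sum>m\<in>I. (Kb l m)\<^sup>2)"
      by (simp add: mult.assoc[symmetric] flip: sum_distrib_left)
    finally show ?thesis unfolding Kbs .
  qed
  have sym: "\<kappa> i j = \<kappa> j i" for i j unfolding \<kappa>_def by (simp add: mult_ac)
  have "(\<integral>y. (\<Sum>k\<in>I. w k * ((U k y)\<^sup>2 - tV k y))\<^sup>2 \<partial>P) \<le> quad_const * A ^ 4 * vs ^ 4 * (\<Sum>i=1..n. \<Sum>j=1..n. (\<kappa> i j)\<^sup>2)"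
    unfolding q quad_const_def by (intro quadratic_noise_moment gwt_props A_pos sym)
  also have "\<dots> \<le> quad_const * A ^ 4 * vs ^ 4 * (4 * real n * (rd\<^sup>2 * W))"
    using quad_const_pos A_pos vs by (intro mult_left_mono \<kappa>s) auto
  also have "\<dots> = 16384 * quad_const * vs ^ 4 / real n * rd\<^sup>2 * W"
  proof -
    have "A ^ 4 = 4096 / (real n)\<^sup>2" unfolding A_def power_divide using n by (simp add: power4_eq_xxxx power2_eq_square)
    then show ?thesis using n by (simp add: field_simps power2_eq_square)
  qed
  finally have le: "(\<integral>y. (\<Sum>k\<in>I. w k * ((U k y)\<^sup>2 - tV k y))\<^sup>2 \<partial>P) \<le> 16384 * quad_const * vs ^ 4 / real n * rd\<^sup>2 * W" .
  have c0: "0 \<le> 16384 * quad_const * vs ^ 4 / real n" using quad_const_pos vs by simp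
  have "(\<integral>y. quad_rem w y \<partial>P) = (\<integral>y. (\<Sum>k\<in>I. w k * ((U k y)\<^sup>2 - tV k y))\<^sup>2 \<partial>P) / (t0 * W)"
    unfolding quad_rem_def W_def by simp
  also have "\<dots> \<le> 16384 * quad_const * vs ^ 4 / real n * rd\<^sup>2 * W / (t0 * W)"
    using le W0 t0_pos by (intro divide_right_mono) auto
  also have "\<dots> \<le> 16384 * quad_const * vs ^ 4 / real n * (rd\<^sup>2 / t0)"
  proof (cases "W = 0")
    case True
    have "0 \<le> 16384 * quad_const * vs ^ 4 / real n * (rd\<^sup>2 / t0)"
      using t0_pos by (intro mult_nonneg_nonneg[OF c0] divide_nonneg_pos) auto
    then show ?thesis using True by simp
  qed simp
  also have "rd\<^sup>2 / t0 = 2 * (rd * sqrt (real n)) / eps_tilde n"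
    unfolding t0_def using rd_pos by (simp add: power2_eq_square)
  also have "16384 * quad_const * vs ^ 4 / real n * (2 * (rd * sqrt (real n)) / eps_tilde n)
     \<le> 16384 * quad_const * vs ^ 4 / real n * (2 * (2 * (b - a)) / eps_tilde n)"
  proof (intro mult_left_mono c0 divide_right_mono)
    show "rd * sqrt (real n) \<le> 2 * (b - a)" using rd_le n by (simp add: field_simps)
  qed (use eps_tilde_bounds in auto)
  also have "\<dots> = 65536 * (b - a) * quad_const * vs ^ 4 / (eps_tilde n * real n)"
  proof -
    have "16384 * q * v / N * (2 * (2 * x) / e) = 65536 * x * q * v / (e * N)" for q v N x e :: real
      by (simp add: mult_ac)
    then show ?thesis .
  qed
  finally show ?thesis .
qed

end

section \<open>The bias of the sequential estimators, and the discrete oracle inequality\<close>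

context ar_select
begin

text \<open>Bounds the variation of \<open>S\<close> between the centre and any point of a window.
  Its square is of order \<open>1 / n\<close>.\<close>

definition "lip_h = L * bandw a b n"
text \<open>The truncation level \<open>T\<close> replaces a maximal inequality: a power of \<open>\<bar>y\<^sub>k\<bar>\<close> above \<open>T\<close> is absorbed by a
  much higher moment. It is later taken to be a small power of \<open>n\<close>.\<close>

definition "bias_bound m T y = 2 * lip_h\<^sup>2 + 2 * (1 + lip_h)\<^sup>2 * (64 / real n) * (T ^ 4 + (\<Sum>k\<le>n. y k ^ (4 * m) / T ^ (4 * m - 4)))"
  for m :: nat and T :: real and y :: "nat \<Rightarrow> real"
definition "bias l y = S_seq a b \<mu>0 n l y - S (z l) - u l y"

lemma lip_h_nonneg: "0 \<le> lip_h" unfolding lip_h_def bandw_def using L ab by simp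

lemma power4_le_truncated:
  fixes x T :: real
  assumes T: "0 < T" and m: "1 \<le> m"
  shows "x ^ 4 \<le> T ^ 4 + x ^ (4 * m) / T ^ (4 * m - 4)"
proof (cases "\<bar>x\<bar> \<le> T")
  case True
  then have "\<bar>x\<bar> ^ 4 \<le> T ^ 4" by (intro power_mono) auto
  moreover have "0 \<le> x ^ (4 * m) / T ^ (4 * m - 4)" using T by (simp add: power_mult)
  ultimately show ?thesis by (simp add: power_even_abs)
next
  case False
  have e: "x ^ (4 * m) = x ^ 4 * \<bar>x\<bar> ^ (4 * m - 4)"
  proof -
    have "\<bar>x\<bar> ^ (4 * m) = \<bar>x\<bar> ^ 4 * \<bar>x\<bar> ^ (4 * m - 4)"
      unfolding power_add[symmetric] using m by (intro arg_cong[where f = "power \<bar>x\<bar>"]) simp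
    moreover have "\<bar>x\<bar> ^ (4 * m) = x ^ (4 * m)" "\<bar>x\<bar> ^ 4 = x ^ 4" by (rule power_even_abs, simp)+
    ultimately show ?thesis by simp
  qed
  have "T ^ (4 * m - 4) \<le> \<bar>x\<bar> ^ (4 * m - 4)" using False T by (intro power_mono) auto
  then have "x ^ 4 * T ^ (4 * m - 4) \<le> x ^ (4 * m)" unfolding e by (intro mult_left_mono) auto
  then have "x ^ 4 \<le> x ^ (4 * m) / T ^ (4 * m - 4)" using T by (simp add: le_divide_eq)
  moreover have "0 \<le> T ^ 4" by simp
  ultimately show ?thesis by linarith
qed

text \<open>With the noise removed, the estimator is a sum of the values of \<open>S\<close> in the
  window with nonnegative weights \<open>cy j / H l y\<close> of total mass
  \<open>Sg / H l y\<close>. The bias thus consists of the variation of \<open>S\<close> and of the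
  excess mass over one, and the latter is at most \<open>B / H l y\<close> because \<open>B\<close>
  dominates every squared observation.\<close>

lemma bias_square_le:
  assumes l: "l \<in> I" and G: "Gam_l a b \<mu>0 n l y" and T: "0 < T" and m: "1 \<le> m"
  shows "(bias l y)\<^sup>2 \<le> bias_bound m T y"
proof -
  have l': "1 \<le> l" "l \<le> num_pts n" using l by auto
  define s where "s = S (z l)"
  define Q where "Q = T ^ 4 + (\<Sum>k\<le>n. y k ^ (4 * m) / T ^ (4 * m - 4))"
  define B where "B = sqrt Q"
  have p0: "0 \<le> x ^ (4 * m) / T ^ (4 * m - 4)" for x :: real using T by (simp add: power_mult)
  have Q0: "0 \<le> Q" unfolding Q_def by (intro add_nonneg_nonneg sum_nonneg p0) simp
  have yB: "(y k)\<^sup>2 \<le> B" if "k \<le> n" for k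
  proof -
    have "y k ^ 4 \<le> T ^ 4 + y k ^ (4 * m) / T ^ (4 * m - 4)" by (rule power4_le_truncated[OF T m])
    also have "\<dots> \<le> Q" unfolding Q_def using that by (intro add_left_mono member_le_sum p0) auto
    finally show ?thesis unfolding B_def by (intro real_le_rsqrt) (simp add: power2_eq_square power4_eq_xxxx)
  qed
  let ?H = "H l y" and ?W = "{\<iota> l + 1..k2 l}"
  have H0: "0 < ?H" by (rule H_bounds(1)[OF l'])
  define cy where "cy j = wt l j y * y (j - 1)" for j
  define Sg where "Sg = (\<Sum>j\<in>?W. cy j)"
  have Sg: "?H \<le> Sg" "Sg \<le> ?H + B"
  proof -
    have *: "(y (j - 1))\<^sup>2 \<le> B" if "j \<in> ?W" for j using that k_last_le[of l] by (intro yB) auto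
    show "?H \<le> Sg" "Sg \<le> ?H + B"
      unfolding Sg_def cy_def by (rule wt_excess[OF l' G *]; assumption)+
  qed
  have cy0: "0 \<le> cy j" for j unfolding cy_def by (rule wt_mult_nonneg[OF l' G])
  have near: "\<bar>Sj j - s\<bar> \<le> lip_h" if "j \<in> ?W" for j
    unfolding s_def lip_h_def using that k_last_le[of l] by (intro Sj_near l' Qw_one) auto
  have s1: "\<bar>s\<bar> \<le> 1" unfolding s_def using S_zpt_le[OF l'(2)] eps by simp
  have "(\<Sum>j\<in>?W. wt l j y * y j) = (\<Sum>j\<in>?W. Sj j * cy j) + (\<Sum>j\<in>?W. wt l j y * xi j y)"
    unfolding sum.distrib[symmetric] by (intro sum.cong refl) (simp add: cy_def xi_def algebra_simps)
  moreover have "u l y = 1 / ?H * (\<Sum>j\<in>?W. wt l j y * xi j y)"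
    unfolding u_def nwt_def sum_distrib_left by (intro sum.cong refl) simp
  ultimately have "bias l y = 1 / ?H * (\<Sum>j\<in>?W. Sj j * cy j) - s"
    unfolding bias_def S_seq_eq[OF l' G] s_def by (simp add: distrib_left)
  also have "(\<Sum>j\<in>?W. Sj j * cy j) = (\<Sum>j\<in>?W. (Sj j - s) * cy j) + s * Sg"
    unfolding Sg_def sum_distrib_left sum.distrib[symmetric] by (intro sum.cong refl) (simp add: algebra_simps)
  also have "1 / ?H * ((\<Sum>j\<in>?W. (Sj j - s) * cy j) + s * Sg) - s = 1 / ?H * (\<Sum>j\<in>?W. (Sj j - s) * cy j) + s * ((Sg - ?H) / ?H)"
    using H0 by (simp add: field_simps)
  finally have eq: "bias l y = 1 / ?H * (\<Sum>j\<in>?W. (Sj j - s) * cy j) + s * ((Sg - ?H) / ?H)" .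
  have "\<bar>bias l y\<bar> \<le> \<bar>1 / ?H * (\<Sum>j\<in>?W. (Sj j - s) * cy j)\<bar> + \<bar>s * ((Sg - ?H) / ?H)\<bar>"
    unfolding eq by (rule abs_triangle_ineq)
  also have "\<dots> \<le> 1 / ?H * (lip_h * Sg) + 1 * (B / ?H)"
  proof (rule add_mono)
    have "\<bar>\<Sum>j\<in>?W. (Sj j - s) * cy j\<bar> \<le> (\<Sum>j\<in>?W. \<bar>(Sj j - s) * cy j\<bar>)" by (rule sum_abs)
    also have "\<dots> \<le> (\<Sum>j\<in>?W. lip_h * cy j)"
      using near cy0 by (intro sum_mono) (simp add: abs_mult mult_right_mono)
    finally have "\<bar>\<Sum>j\<in>?W. (Sj j - s) * cy j\<bar> \<le> lip_h * Sg" unfolding Sg_def sum_distrib_left .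
    then show "\<bar>1 / ?H * (\<Sum>j\<in>?W. (Sj j - s) * cy j)\<bar> \<le> 1 / ?H * (lip_h * Sg)"
      unfolding abs_mult using H0 by (intro mult_mono) auto
    show "\<bar>s * ((Sg - ?H) / ?H)\<bar> \<le> 1 * (B / ?H)"
      unfolding abs_mult using Sg H0 s1 by (intro mult_mono) (auto simp: divide_right_mono)
  qed
  also have "\<dots> \<le> 1 / ?H * (lip_h * (?H + B)) + 1 * (B / ?H)"
    using Sg lip_h_nonneg H0 by (intro add_right_mono mult_left_mono) auto
  also have "\<dots> = lip_h + (1 + lip_h) * (1 / ?H * B)" using H0 by (simp add: field_simps)
  also have "\<dots> \<le> lip_h + (1 + lip_h) * (8 / sqrt (real n) * B)"
    using H_bounds(2)[OF l', of y] lip_h_nonneg Q0 unfolding B_def by (intro add_left_mono mult_left_mono mult_right_mono) auto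
  finally have "\<bar>bias l y\<bar> \<le> lip_h + (1 + lip_h) * (8 / sqrt (real n) * B)" .
  then have "(bias l y)\<^sup>2 \<le> (lip_h + (1 + lip_h) * (8 / sqrt (real n) * B))\<^sup>2" by (metis abs_ge_zero power2_abs power_mono)
  also have "\<dots> \<le> 2 * lip_h\<^sup>2 + 2 * ((1 + lip_h) * (8 / sqrt (real n) * B))\<^sup>2"
    using sum_squares_bound[of lip_h "(1 + lip_h) * (8 / sqrt (real n) * B)"] unfolding power2_sum by linarith
  also have "((1 + lip_h) * (8 / sqrt (real n) * B))\<^sup>2 = (1 + lip_h)\<^sup>2 * (64 / real n) * Q"
    unfolding power_mult_distrib power_divide B_def using Q0 by simp
  finally show ?thesis unfolding bias_bound_def Q_def by simp
qed

lemma moments_bias_bound: "moments (\<lambda>y. bias_bound m T y)"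
  unfolding bias_bound_def divide_inverse by (intro moments_add moments_mult moments_const moments_sum moments_power moments_y) auto

lemma bias_bound_nonneg: "0 < T \<Longrightarrow> 0 \<le> bias_bound m T y"
  unfolding bias_bound_def by (intro add_nonneg_nonneg mult_nonneg_nonneg sum_nonneg) (auto simp: power_mult)

lemma bias_bound_moment:
  assumes T: "0 < T" and m: "1 \<le> m"
  shows "(\<integral>y. bias_bound m T y \<partial>P) \<le> 2 * lip_h\<^sup>2 + 2 * (1 + lip_h)\<^sup>2 * (64 / real n) * (T ^ 4 + 2 * real n * (Cy (2 * m) * vs ^ (2 * m)) / T ^ (4 * m - 4))"
proof -
  let ?K = "Cy (2 * m) * vs ^ (2 * m)"
  have K0: "0 \<le> ?K" using Cy_pos[of "2 * m"] vs by simp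
  have i: "integrable P (\<lambda>y. y k ^ (4 * m) / T ^ (4 * m - 4))" if "k \<in> {..n}" for k
    unfolding divide_inverse using that by (intro moments_integrable moments_mult moments_power moments_const moments_y) auto
  have isum: "integrable P (\<lambda>y. \<Sum>k\<le>n. y k ^ (4 * m) / T ^ (4 * m - 4))"
    by (intro Bochner_Integration.integrable_sum i)
  have c0: "0 \<le> 2 * (1 + lip_h)\<^sup>2 * (64 / real n)" by simp
  have "(\<integral>y. bias_bound m T y \<partial>P) = 2 * lip_h\<^sup>2 + 2 * (1 + lip_h)\<^sup>2 * (64 / real n) * (T ^ 4 + (\<Sum>k\<le>n. (\<integral>y. y k ^ (4 * m) / T ^ (4 * m - 4) \<partial>P)))"
  proof -
    have "(\<integral>y. bias_bound m T y \<partial>P) = 2 * lip_h\<^sup>2 + 2 * (1 + lip_h)\<^sup>2 * (64 / real n) * (T ^ 4 + (\<integral>y. (\<Sum>k\<le>n. y k ^ (4 * m) / T ^ (4 * m - 4)) \<partial>P))"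
      unfolding bias_bound_def using isum P.prob_space by simp
    then show ?thesis by (simp only: Bochner_Integration.integral_sum[OF i])
  qed
  also have "\<dots> \<le> 2 * lip_h\<^sup>2 + 2 * (1 + lip_h)\<^sup>2 * (64 / real n) * (T ^ 4 + (\<Sum>k\<le>n. ?K / T ^ (4 * m - 4)))"
  proof (intro add_left_mono mult_left_mono[OF _ c0] sum_mono)
    fix k assume "k \<in> {..n}"
    then have "(\<integral>y. y k ^ (4 * m) \<partial>P) \<le> ?K" using y_moment[of k "2 * m"] m by simp
    then show "(\<integral>y. y k ^ (4 * m) / T ^ (4 * m - 4) \<partial>P) \<le> ?K / T ^ (4 * m - 4)"
      using T by (simp add: divide_right_mono)
  qed
  also have "(\<Sum>k\<le>n. ?K / T ^ (4 * m - 4)) = (real n + 1) * ?K / T ^ (4 * m - 4)" by simp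
  also have "2 * lip_h\<^sup>2 + 2 * (1 + lip_h)\<^sup>2 * (64 / real n) * (T ^ 4 + (real n + 1) * ?K / T ^ (4 * m - 4))
     \<le> 2 * lip_h\<^sup>2 + 2 * (1 + lip_h)\<^sup>2 * (64 / real n) * (T ^ 4 + 2 * real n * ?K / T ^ (4 * m - 4))"
    using K0 T n by (intro add_left_mono mult_left_mono[OF _ c0] divide_right_mono mult_right_mono) auto
  finally show ?thesis .
qed

lemma sig_square:
  assumes l: "l \<in> I" shows "(sig a b \<mu>0 n l y)\<^sup>2 = 1 / H l y"
proof -
  have "0 < H l y" using l by (intro H_bounds(1)) auto
  then have "1 / H l y = H l y powr (- 1 / 2 + - 1 / 2)" by (simp add: powr_minus_divide)
  also have "\<dots> = (sig a b \<mu>0 n l y)\<^sup>2" unfolding sig_def power2_eq_square by (rule powr_add)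
  finally show ?thesis ..
qed

lemma V_eq:
  assumes l: "l \<in> I" and G: "Gam_l a b \<mu>0 n l y"
  shows "V l y = 1 / H l y"
proof -
  have l': "1 \<le> l" "l \<le> num_pts n" using l by auto
  have H0: "0 < H l y" by (rule H_bounds(1)[OF l'])
  have "V l y = (\<Sum>j=\<iota> l + 1..k2 l. (wt l j y)\<^sup>2) / (H l y)\<^sup>2"
    unfolding V_def nwt_def by (simp add: power_divide sum_divide_distrib)
  also have "(\<Sum>j=\<iota> l + 1..k2 l. (wt l j y)\<^sup>2) = min (As l y (k2 l)) (H l y)"
    by (rule wt_sum_square[OF l'(1) H0 order_refl])
  also have "\<dots> = H l y"
    using order_trans[OF As_end[OF l' G] As_mono[of "k2 l - 1" "k2 l" l y]] by simp
  finally show ?thesis using H0 by (simp add: power2_eq_square)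
qed

abbreviation "Err \<equiv> dErr \<mu>0 \<phi>"

text \<open>On \<open>Gam\<close> the variances in the cost are the predictable ones, so cost and
  error take the shape required by \<open>oracle_inequality_pathwise\<close>. Bessel's inequality
  gives its hypothesis on \<open>Z\<close> and passes from the coefficients of the bias to its
  values at the centres.\<close>

lemma discrete_oracle:
  assumes G: "Gam a b \<mu>0 n y" and \<delta>: "0 < \<delta>" "\<delta> \<le> 1 / 12" and T: "0 < T" and m: "1 \<le> m"
    and v: "\<And>j. j \<in> I \<Longrightarrow> 0 \<le> v j \<and> v j \<le> 1" and v0: "\<And>j. j \<in> I \<Longrightarrow> 0 \<le> v0 j \<and> v0 j \<le> 1"
    and J: "cost a b \<mu>0 n \<phi> \<delta> y v \<le> cost a b \<mu>0 n \<phi> \<delta> y v0"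
  shows "Err v y \<le> (1 + 4 * \<delta>) / (1 - 6 * \<delta>) * Err v0 y
    + 70 / \<delta> * ((b - a) * bias_bound m T y + lin_rem (\<lambda>x. v x - v0 x) y + lin_rem (\<lambda>x. (v x - v0 x)\<^sup>2) y
       + lin_rem (\<lambda>x. v0 x * (1 - v0 x)) y + quad_rem v y + quad_rem v0 y + quad_rem (\<lambda>x. (v0 x)\<^sup>2) y)"
proof -
  define \<beta> where "\<beta> k = fcoef (\<lambda>l. bias l y) k" for k
  define t where "t k = rd * s_var a b \<mu>0 n \<phi> k y" for k
  define Z where "Z = rd * (\<Sum>l\<in>I. (S (z l))\<^sup>2)"
  have Gl: "Gam_l a b \<mu>0 n l y" if "l \<in> I" for l using G that unfolding Gam_def by blast
  have th: "theta_hat a b \<mu>0 n \<phi> k y = \<theta> k + U k y + \<beta> k" for k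
  proof -
    have "theta_hat a b \<mu>0 n \<phi> k y = fcoef (\<lambda>l. S_seq a b \<mu>0 n l y) k"
      unfolding theta_hat_def fcoef_def rd_def Yreg_def using G by simp
    also have "\<dots> = fcoef (\<lambda>l. S (z l) + u l y + bias l y) k"
      unfolding fcoef_def bias_def by (intro arg_cong2[where f = "(*)"] sum.cong refl) simp
    also have "\<dots> = \<theta> k + U k y + \<beta> k"
      unfolding \<theta>_def U_def \<beta>_def fcoef_def by (simp only: distrib_right sum.distrib distrib_left)
    finally show ?thesis .
  qed
  have t: "t k = tV k y" for k
  proof -
    have "t k = rd\<^sup>2 * (\<Sum>l\<in>I. (sig a b \<mu>0 n l y)\<^sup>2 * (\<phi> k (z l))\<^sup>2)"
      unfolding t_def s_var_def rd_def by (simp add: power2_eq_square)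
    also have "\<dots> = tV k y" unfolding tV_def using sig_square V_eq[OF _ Gl]
      by (intro arg_cong2[where f = "(*)"] sum.cong refl) simp
    finally show ?thesis .
  qed
  have tt0: "t0 \<le> t k" if k: "k \<in> I" for k
  proof -
    have "t0 = rd * (eps_tilde n / (2 * sqrt (real n)) * (rd * (\<Sum>l\<in>I. \<phi> k (z l) * \<phi> k (z l))))"
      unfolding t0_def phi_orth[OF k k] by simp
    also have "\<dots> = rd\<^sup>2 * (\<Sum>l\<in>I. eps_tilde n / (2 * sqrt (real n)) * (\<phi> k (z l))\<^sup>2)"
      by (simp only: power2_eq_square sum_distrib_left mult_ac)
    also have "\<dots> \<le> rd\<^sup>2 * (\<Sum>l\<in>I. V l y * (\<phi> k (z l))\<^sup>2)"
    proof (intro mult_left_mono sum_mono mult_right_mono)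
      fix l assume l: "l \<in> I"
      then show "eps_tilde n / (2 * sqrt (real n)) \<le> V l y"
        unfolding V_eq[OF l Gl[OF l]] by (intro H_bounds(3)) auto
    qed auto
    finally show ?thesis unfolding t tV_def .
  qed
  have Err: "Err w y = (\<Sum>j\<in>I. (w j)\<^sup>2 * (\<theta> j + U j y + \<beta> j)\<^sup>2) - 2 * (\<Sum>j\<in>I. w j * (\<theta> j + U j y + \<beta> j) * \<theta> j) + Z" for w
  proof -
    have "Err w y = rd * (\<Sum>l\<in>I. ((\<Sum>i\<in>I. (w i * (\<theta> i + U i y + \<beta> i)) * \<phi> i (z l)) - S (z l))\<^sup>2)"
      unfolding dErr_def S_lam_pt_def th using G by simp
    also have "\<dots> = (\<Sum>i\<in>I. (w i * (\<theta> i + U i y + \<beta> i))\<^sup>2) - 2 * (\<Sum>i\<in>I. w i * (\<theta> i + U i y + \<beta> i) * fcoef (\<lambda>l. S (z l)) i) + Z"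
      unfolding error_expansion Z_def ..
    finally show ?thesis unfolding \<theta>_def[symmetric] power_mult_distrib .
  qed
  have Jc: "cost a b \<mu>0 n \<phi> \<delta> y w = (\<Sum>j\<in>I. (w j)\<^sup>2 * (\<theta> j + U j y + \<beta> j)\<^sup>2)
      - 2 * (\<Sum>j\<in>I. w j * ((\<theta> j + U j y + \<beta> j)\<^sup>2 - t j)) + \<delta> * (\<Sum>j\<in>I. (w j)\<^sup>2 * t j)" for w
    unfolding cost_def th theta_tilde_def penalty_def t_def rd_def
    by (simp add: sum_distrib_left mult.left_commute)
  have "(\<Sum>j\<in>I. (\<beta> j)\<^sup>2) \<le> rd * (\<Sum>l\<in>I. (bias l y)\<^sup>2)" unfolding \<beta>_def by (rule bessel)
  also have "\<dots> \<le> rd * (\<Sum>l\<in>I. bias_bound m T y)"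
    using rd_pos Gl by (intro mult_left_mono sum_mono bias_square_le T m) auto
  also have "\<dots> = (b - a) * bias_bound m T y" unfolding rd_def using d_pos by simp
  finally have B: "(\<Sum>j\<in>I. (\<beta> j)\<^sup>2) \<le> (b - a) * bias_bound m T y" .
  have "Err v y \<le> (1 + 4 * \<delta>) / (1 - 6 * \<delta>) * Err v0 y
     + 70 / \<delta> * ((\<Sum>j\<in>I. (\<beta> j)\<^sup>2) + lin_rem (\<lambda>x. v x - v0 x) y + lin_rem (\<lambda>x. (v x - v0 x)\<^sup>2) y
       + lin_rem (\<lambda>x. v0 x * (1 - v0 x)) y + quad_rem v y + quad_rem v0 y + quad_rem (\<lambda>x. (v0 x)\<^sup>2) y)"
    unfolding Err lin_rem_def quad_rem_def t[symmetric]
  proof (rule oracle_inequality_pathwise)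
    show "(\<Sum>j\<in>I. (\<theta> j)\<^sup>2) \<le> Z" unfolding Z_def \<theta>_def by (rule bessel)
  qed (use v v0 t0_pos tt0 \<delta> J[unfolded Jc] in auto)
  also have "\<dots> \<le> (1 + 4 * \<delta>) / (1 - 6 * \<delta>) * Err v0 y
     + 70 / \<delta> * ((b - a) * bias_bound m T y + lin_rem (\<lambda>x. v x - v0 x) y + lin_rem (\<lambda>x. (v x - v0 x)\<^sup>2) y
       + lin_rem (\<lambda>x. v0 x * (1 - v0 x)) y + quad_rem v y + quad_rem v0 y + quad_rem (\<lambda>x. (v0 x)\<^sup>2) y)"
    using B \<delta> by (intro add_left_mono mult_left_mono add_right_mono) auto
  finally show ?thesis .
qed

end

section \<open>The oracle inequality for large and for small sample sizes\<close>

context ar_select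
begin

text \<open>The weights of \<open>lin_rem\<close> and \<open>quad_rem\<close> depend on the selected \<open>w\<close>; summing over \<open>\<Lambda>\<close> makes
  them deterministic, at the price of the factor \<open>\<nu>\<close> in the remainder.\<close>

definition "remainder \<Lambda> v0 m T y = (b - a) * bias_bound m T y
  + (\<Sum>w\<in>\<Lambda>. lin_rem (\<lambda>x. w x - v0 x) y + lin_rem (\<lambda>x. (w x - v0 x)\<^sup>2) y + quad_rem w y)
  + lin_rem (\<lambda>x. v0 x * (1 - v0 x)) y + quad_rem v0 y + quad_rem (\<lambda>x. (v0 x)\<^sup>2) y"

lemma remainder_nonneg: "0 < T \<Longrightarrow> 0 \<le> remainder \<Lambda> v0 m T y"
  unfolding remainder_def using ab by (intro add_nonneg_nonneg mult_nonneg_nonneg sum_nonneg bias_bound_nonneg lin_rem_nonneg quad_rem_nonneg) auto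

lemma moments_remainder: "moments (\<lambda>y. remainder \<Lambda> v0 m T y)"
  unfolding remainder_def by (intro moments_add moments_mult moments_const moments_sum moments_bias_bound moments_lin_rem moments_quad_rem)

lemma remainder_moment:
  assumes T: "0 < T" and m: "1 \<le> m"
  shows "(\<integral>y. remainder \<Lambda> v0 m T y \<partial>P) \<le>
    (b - a) * (2 * lip_h\<^sup>2 + 2 * (1 + lip_h)\<^sup>2 * (64 / real n) * (T ^ 4 + 2 * real n * (Cy (2 * m) * vs ^ (2 * m)) / T ^ (4 * m - 4)))
    + (2 * real (card \<Lambda>) + 1) * (256 * (b - a) * mart_const 1 * Cy 1 * vs\<^sup>2 / real n)
    + (real (card \<Lambda>) + 2) * (65536 * (b - a) * quad_const * vs ^ 4 / (eps_tilde n * real n))"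
proof -
  let ?M = "256 * (b - a) * mart_const 1 * Cy 1 * vs\<^sup>2 / real n"
  let ?N = "65536 * (b - a) * quad_const * vs ^ 4 / (eps_tilde n * real n)"
  note iM = moments_integrable[OF moments_lin_rem] and iN = moments_integrable[OF moments_quad_rem] and iB = moments_integrable[OF moments_bias_bound]
  define f where "f w = (\<integral>y. lin_rem (\<lambda>x. w x - v0 x) y \<partial>P) + (\<integral>y. lin_rem (\<lambda>x. (w x - v0 x)\<^sup>2) y \<partial>P) + (\<integral>y. quad_rem w y \<partial>P)" for w
  have s: "(\<integral>y. (\<Sum>w\<in>\<Lambda>. lin_rem (\<lambda>x. w x - v0 x) y + lin_rem (\<lambda>x. (w x - v0 x)\<^sup>2) y + quad_rem w y) \<partial>P) = (\<Sum>w\<in>\<Lambda>. f w)"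
    unfolding f_def
    by (subst Bochner_Integration.integral_sum) (simp_all add: iM iN)
  have "(\<integral>y. remainder \<Lambda> v0 m T y \<partial>P) = (b - a) * (\<integral>y. bias_bound m T y \<partial>P) + (\<Sum>w\<in>\<Lambda>. f w)
      + (\<integral>y. lin_rem (\<lambda>x. v0 x * (1 - v0 x)) y \<partial>P) + (\<integral>y. quad_rem v0 y \<partial>P) + (\<integral>y. quad_rem (\<lambda>x. (v0 x)\<^sup>2) y \<partial>P)"
    unfolding remainder_def s[symmetric] by (simp add: iM iN iB)
  also have "\<dots> \<le> (b - a) * (2 * lip_h\<^sup>2 + 2 * (1 + lip_h)\<^sup>2 * (64 / real n) * (T ^ 4 + 2 * real n * (Cy (2 * m) * vs ^ (2 * m)) / T ^ (4 * m - 4)))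
      + (\<Sum>w\<in>\<Lambda>. ?M + ?M + ?N) + ?M + ?N + ?N"
    unfolding f_def using ab by (intro add_mono sum_mono mult_left_mono lin_rem_moment quad_rem_moment bias_bound_moment[OF T m]) auto
  also have "(\<Sum>w\<in>\<Lambda>. ?M + ?M + ?N) = real (card \<Lambda>) * (?M + ?M + ?N)" by simp
  finally show ?thesis by (simp only: distrib_right distrib_left mult_2 mult_1 add_ac)
qed

text \<open>One factor \<open>1 + \<delta>\<close> comes from bounding the integrated error of
  \<open>v\<close> by the discrete one, the other from the way back for \<open>v0\<close>.\<close>

lemma pointwise_oracle:
  assumes \<delta>: "0 < \<delta>" "\<delta> \<le> 1 / 12" and T: "0 < T" and m: "1 \<le> m"
    and \<Lambda>: "finite \<Lambda>" "\<Lambda> \<subseteq> weight_cube n" and v: "v \<in> \<Lambda>" and v0: "v0 \<in> \<Lambda>"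
    and J: "cost a b \<mu>0 n \<phi> \<delta> y v \<le> cost a b \<mu>0 n \<phi> \<delta> y v0"
  shows "err \<mu>0 \<phi> v y \<le> ennreal ((1 + 4 * \<delta>) * (1 + \<delta>)\<^sup>2 / (1 - 6 * \<delta>)) * err \<mu>0 \<phi> v0 y
    + ennreal (1 / \<delta> * (8 * (L\<^sup>2 * rd\<^sup>2 * (b - a)) + 76 * remainder \<Lambda> v0 m T y))"
proof (cases "Gam a b \<mu>0 n y")
  case False
  \<comment> \<open>All estimators vanish here, so the errors agree and the probability of this event never matters.\<close>
  then have "S_lam_pt a b \<mu>0 n \<phi> w y l = 0" for w l unfolding S_lam_pt_def by simp
  then have "err \<mu>0 \<phi> v y = err \<mu>0 \<phi> v0 y" unfolding err_cells by simp
  also have "\<dots> = ennreal 1 * err \<mu>0 \<phi> v0 y" by simp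
  also have "\<dots> \<le> ennreal ((1 + 4 * \<delta>) * (1 + \<delta>)\<^sup>2 / (1 - 6 * \<delta>)) * err \<mu>0 \<phi> v0 y"
  proof (intro mult_right_mono ennreal_leI)
    have "1 * 1 \<le> (1 + 4 * \<delta>) * (1 + \<delta>)\<^sup>2" using \<delta> by (intro mult_mono) (auto simp: one_le_power)
    then show "1 \<le> (1 + 4 * \<delta>) * (1 + \<delta>)\<^sup>2 / (1 - 6 * \<delta>)" using \<delta> by (simp add: le_divide_eq)
  qed simp
  finally show ?thesis by (rule order_trans) simp
next
  case True
  define c where "c = (1 + 4 * \<delta>) / (1 - 6 * \<delta>)"
  define \<kappa> where "\<kappa> = L\<^sup>2 * rd\<^sup>2 * (b - a)"
  define Rm where "Rm = remainder \<Lambda> v0 m T y"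
  \<comment> \<open>The value \<open>8 / 3\<close> is attained at
    \<open>\<delta> = 1 / 12\<close>.\<close>
  have c: "0 \<le> c" "c \<le> 8 / 3" unfolding c_def using \<delta> by (auto simp: divide_le_eq)
  have \<kappa>0: "0 \<le> \<kappa>" unfolding \<kappa>_def using ab by simp
  have R0: "0 \<le> Rm" unfolding Rm_def by (rule remainder_nonneg[OF T])
  have cube: "0 \<le> w j \<and> w j \<le> 1" if "w \<in> \<Lambda>" "j \<in> I" for w j
    using that \<Lambda>(2) unfolding weight_cube_def PiE_def Pi_def by auto
  have "Err v y \<le> c * Err v0 y + 70 / \<delta> * ((b - a) * bias_bound m T y + lin_rem (\<lambda>x. v x - v0 x) y + lin_rem (\<lambda>x. (v x - v0 x)\<^sup>2) y
       + lin_rem (\<lambda>x. v0 x * (1 - v0 x)) y + quad_rem v y + quad_rem v0 y + quad_rem (\<lambda>x. (v0 x)\<^sup>2) y)"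
    unfolding c_def by (rule discrete_oracle[OF True \<delta> T m cube[OF v] cube[OF v0] J])
  also have "\<dots> \<le> c * Err v0 y + 70 / \<delta> * Rm"
  proof (intro add_left_mono mult_left_mono)
    have "lin_rem (\<lambda>x. v x - v0 x) y + lin_rem (\<lambda>x. (v x - v0 x)\<^sup>2) y + quad_rem v y
       \<le> (\<Sum>w\<in>\<Lambda>. lin_rem (\<lambda>x. w x - v0 x) y + lin_rem (\<lambda>x. (w x - v0 x)\<^sup>2) y + quad_rem w y)"
      by (rule member_le_sum[OF v _ \<Lambda>(1), of "\<lambda>w. lin_rem (\<lambda>x. w x - v0 x) y + lin_rem (\<lambda>x. (w x - v0 x)\<^sup>2) y + quad_rem w y"])
         (intro add_nonneg_nonneg lin_rem_nonneg quad_rem_nonneg)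
    then show "(b - a) * bias_bound m T y + lin_rem (\<lambda>x. v x - v0 x) y + lin_rem (\<lambda>x. (v x - v0 x)\<^sup>2) y
       + lin_rem (\<lambda>x. v0 x * (1 - v0 x)) y + quad_rem v y + quad_rem v0 y + quad_rem (\<lambda>x. (v0 x)\<^sup>2) y \<le> Rm"
      unfolding Rm_def remainder_def by linarith
  qed (use \<delta> in simp)
  finally have E: "Err v y \<le> c * Err v0 y + 70 / \<delta> * Rm" .
  have d1: "1 + 1 / \<delta> \<le> 2 / \<delta>" using \<delta> by (simp add: field_simps)
  have k2: "(1 + 1 / \<delta>) * \<kappa> \<le> 2 / \<delta> * \<kappa>" using d1 \<kappa>0 by (rule mult_right_mono)
  have E0: "0 \<le> Err w y" for w unfolding dErr_def using rd_pos by (intro mult_nonneg_nonneg sum_nonneg) auto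
  have e0: "0 \<le> 2 / \<delta> * \<kappa>" "0 \<le> 70 / \<delta> * Rm" using \<delta> \<kappa>0 R0 by auto
  have "err \<mu>0 \<phi> v y \<le> ennreal ((1 + \<delta>) * Err v y + (1 + 1 / \<delta>) * \<kappa>)"
    unfolding \<kappa>_def by (rule err_upper[OF \<delta>(1)])
  also have "\<dots> \<le> ennreal ((1 + \<delta>) * c * Err v0 y + ((1 + \<delta>) * (70 / \<delta> * Rm) + 2 / \<delta> * \<kappa>))"
  proof (rule ennreal_leI)
    have "(1 + \<delta>) * Err v y \<le> (1 + \<delta>) * (c * Err v0 y + 70 / \<delta> * Rm)" using E \<delta> by (intro mult_left_mono) auto
    then show "(1 + \<delta>) * Err v y + (1 + 1 / \<delta>) * \<kappa> \<le> (1 + \<delta>) * c * Err v0 y + ((1 + \<delta>) * (70 / \<delta> * Rm) + 2 / \<delta> * \<kappa>)"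
      using k2 by (simp add: distrib_left mult.assoc)
  qed
  also have "\<dots> = ennreal ((1 + \<delta>) * c) * ennreal (Err v0 y) + ennreal ((1 + \<delta>) * (70 / \<delta> * Rm) + 2 / \<delta> * \<kappa>)"
  proof -
    have "0 \<le> (1 + \<delta>) * c" using \<delta> c by simp
    moreover have "0 \<le> (1 + \<delta>) * (70 / \<delta> * Rm) + 2 / \<delta> * \<kappa>"
      using \<delta> by (intro add_nonneg_nonneg[OF mult_nonneg_nonneg[OF _ e0(2)] e0(1)]) simp
    ultimately show ?thesis
      using E0[of v0] by (simp only: ennreal_plus[OF mult_nonneg_nonneg] ennreal_mult)
  qed
  also have "\<dots> \<le> ennreal ((1 + \<delta>) * c) * (ennreal (1 + \<delta>) * err \<mu>0 \<phi> v0 y + ennreal (2 / \<delta> * \<kappa>)) + ennreal ((1 + \<delta>) * (70 / \<delta> * Rm) + 2 / \<delta> * \<kappa>)"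
  proof (intro add_right_mono mult_left_mono)
    have "ennreal (Err v0 y) \<le> ennreal (1 + \<delta>) * err \<mu>0 \<phi> v0 y + ennreal ((1 + 1 / \<delta>) * \<kappa>)"
      unfolding \<kappa>_def by (rule err_lower[OF \<delta>(1)])
    also have "\<dots> \<le> ennreal (1 + \<delta>) * err \<mu>0 \<phi> v0 y + ennreal (2 / \<delta> * \<kappa>)"
      using k2 by (intro add_left_mono ennreal_leI)
    finally show "ennreal (Err v0 y) \<le> ennreal (1 + \<delta>) * err \<mu>0 \<phi> v0 y + ennreal (2 / \<delta> * \<kappa>)" .
  qed simp
  also have "\<dots> = ennreal ((1 + \<delta>) * c) * ennreal (1 + \<delta>) * err \<mu>0 \<phi> v0 y + (ennreal ((1 + \<delta>) * c) * ennreal (2 / \<delta> * \<kappa>) + ennreal ((1 + \<delta>) * (70 / \<delta> * Rm) + 2 / \<delta> * \<kappa>))"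
    by (simp only: distrib_left mult.assoc add.assoc)
  also have "ennreal ((1 + \<delta>) * c) * ennreal (1 + \<delta>) = ennreal ((1 + 4 * \<delta>) * (1 + \<delta>)\<^sup>2 / (1 - 6 * \<delta>))"
  proof -
    have "ennreal ((1 + \<delta>) * c) * ennreal (1 + \<delta>) = ennreal ((1 + \<delta>) * c * (1 + \<delta>))"
      using \<delta> c by (intro ennreal_mult[symmetric]) auto
    also have "(1 + \<delta>) * c * (1 + \<delta>) = (1 + 4 * \<delta>) * (1 + \<delta>)\<^sup>2 / (1 - 6 * \<delta>)"
      unfolding c_def by (simp add: power2_eq_square mult_ac)
    finally show ?thesis .
  qed
  also have "ennreal ((1 + \<delta>) * c) * ennreal (2 / \<delta> * \<kappa>) + ennreal ((1 + \<delta>) * (70 / \<delta> * Rm) + 2 / \<delta> * \<kappa>)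
     = ennreal ((1 + \<delta>) * c * (2 / \<delta> * \<kappa>) + ((1 + \<delta>) * (70 / \<delta> * Rm) + 2 / \<delta> * \<kappa>))"
  proof (subst ennreal_mult[symmetric])
    show "0 \<le> (1 + \<delta>) * c" using \<delta> c by simp
    then have "0 \<le> (1 + \<delta>) * c * (2 / \<delta> * \<kappa>)" using e0(1) by (rule mult_nonneg_nonneg)
    moreover have "0 \<le> (1 + \<delta>) * (70 / \<delta> * Rm) + 2 / \<delta> * \<kappa>" using \<delta> by (intro add_nonneg_nonneg[OF mult_nonneg_nonneg[OF _ e0(2)] e0(1)]) simp
    ultimately show "ennreal ((1 + \<delta>) * c * (2 / \<delta> * \<kappa>)) + ennreal ((1 + \<delta>) * (70 / \<delta> * Rm) + 2 / \<delta> * \<kappa>)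
      = ennreal ((1 + \<delta>) * c * (2 / \<delta> * \<kappa>) + ((1 + \<delta>) * (70 / \<delta> * Rm) + 2 / \<delta> * \<kappa>))" by (rule ennreal_plus[symmetric])
  qed (rule e0(1))
  \<comment> \<open>The two discretisations contribute \<open>6 + 2\<close>, because
    \<open>(13 / 12) * (8 / 3) < 3\<close>; and \<open>70 * (13 / 12) < 76\<close>.\<close>
  also have "\<dots> \<le> ennreal (1 / \<delta> * (8 * \<kappa> + 76 * Rm))"
  proof (rule ennreal_leI)
    have "(1 + \<delta>) * c \<le> (13 / 12) * (8 / 3)" using \<delta> c by (intro mult_mono) auto
    then have 1: "(1 + \<delta>) * c * (2 / \<delta> * \<kappa>) \<le> 3 * (2 / \<delta> * \<kappa>)" using e0 by (intro mult_right_mono) auto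
    have 2: "(1 + \<delta>) * (70 / \<delta> * Rm) \<le> (76 / 70) * (70 / \<delta> * Rm)" using e0 \<delta> by (intro mult_right_mono) auto
    have "3 * (2 / \<delta> * \<kappa>) + ((76 / 70) * (70 / \<delta> * Rm) + 2 / \<delta> * \<kappa>) = 1 / \<delta> * (8 * \<kappa> + 76 * Rm)"
      using \<delta> by (simp add: field_simps)
    then show "(1 + \<delta>) * c * (2 / \<delta> * \<kappa>) + ((1 + \<delta>) * (70 / \<delta> * Rm) + 2 / \<delta> * \<kappa>) \<le> 1 / \<delta> * (8 * \<kappa> + 76 * Rm)"
      using 1 2 by linarith
  qed
  finally show ?thesis unfolding \<kappa>_def Rm_def by (simp add: add_left_mono)
qed

text \<open>The definition has a random summation range and a definite description; on
  \<open>Gam_l\<close> the form with \<open>wt\<close> has a fixed range and explicit measurable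
  weights.\<close>

lemma S_seq_Gam_measurable: "(\<lambda>y. S_seq a b \<mu>0 n l y) \<in> borel_measurable (obs_space n)" if l: "l \<in> I"
proof -
  have "S_seq a b \<mu>0 n l y = (if Gam_l a b \<mu>0 n l y then 1 / H l y * (\<Sum>j=\<iota> l + 1..k2 l. wt l j y * y j) else 0)" for y
    using S_seq_eq[of l y] l by (auto simp: S_seq_def)
  then show ?thesis by (simp only:) (unfold wt_def As_def, measurable)
qed

lemma S_lam_pt_measurable: "(\<lambda>y. S_lam_pt a b \<mu>0 n \<phi> w y l) \<in> borel_measurable (obs_space n)"
proof -
  have "(\<lambda>y. Yreg a b \<mu>0 n l' y) \<in> borel_measurable (obs_space n)" if "l' \<in> I" for l'
    unfolding Yreg_def of_bool_def using S_seq_Gam_measurable[OF that]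
    by (intro borel_measurable_times measurable_If borel_measurable_const) (auto simp flip: pred_def)
  then have "(\<lambda>y. theta_hat a b \<mu>0 n \<phi> j y) \<in> borel_measurable (obs_space n)" for j
    unfolding theta_hat_def by (intro borel_measurable_times borel_measurable_sum borel_measurable_const) auto
  then show ?thesis
    unfolding S_lam_pt_def of_bool_def
    by (intro borel_measurable_times borel_measurable_sum measurable_If borel_measurable_const) (auto simp flip: pred_def)
qed

lemma err_measurable: "(\<lambda>y. err \<mu>0 \<phi> w y) \<in> borel_measurable (obs_space n)"
  unfolding err_cells
proof (rule borel_measurable_sum)
  fix l
  have [measurable]: "cell l \<in> sets lborel" by simp
  have m1: "(\<lambda>x. S_lam_pt a b \<mu>0 n \<phi> w (fst x) l) \<in> borel_measurable (obs_space n \<Otimes>\<^sub>M lborel)"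
    by (rule measurable_compose[OF measurable_fst S_lam_pt_measurable])
  have m2: "(\<lambda>x. S' (snd x)) \<in> borel_measurable (obs_space n \<Otimes>\<^sub>M lborel)"
    by (rule measurable_compose[OF measurable_snd]) (simp add: S'_measurable)
  have m3: "(\<lambda>x. indicator (cell l) (snd x) :: ennreal) \<in> borel_measurable (obs_space n \<Otimes>\<^sub>M lborel)"
    by (rule measurable_compose[OF measurable_snd]) (simp add: borel_measurable_indicator)
  have "(\<lambda>x. ennreal ((S_lam_pt a b \<mu>0 n \<phi> w (fst x) l - S' (snd x))\<^sup>2) * indicator (cell l) (snd x)) \<in> borel_measurable (obs_space n \<Otimes>\<^sub>M lborel)"
    by (intro borel_measurable_times_ennreal measurable_compose[OF _ measurable_ennreal] borel_measurable_power borel_measurable_diff m1 m2 m3)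
  then show "(\<lambda>y. \<integral>\<^sup>+ t. ennreal ((S_lam_pt a b \<mu>0 n \<phi> w y l - S' t)\<^sup>2) * indicator (cell l) t \<partial>lborel) \<in> borel_measurable (obs_space n)"
    by (intro lborel.borel_measurable_nn_integral) (simp add: case_prod_unfold)
qed

lemma risk_oracle:
  assumes \<delta>: "0 < \<delta>" "\<delta> \<le> 1 / 12" and T: "0 < T" and m: "1 \<le> m"
    and \<Lambda>: "finite \<Lambda>" "\<Lambda> \<subseteq> weight_cube n" and v0: "v0 \<in> \<Lambda>"
    and min: "cost_minimiser a b \<mu>0 n \<phi> \<Lambda> \<delta> v"
  shows "(\<integral>\<^sup>+ y. err \<mu>0 \<phi> (v y) y \<partial>P) \<le> ennreal ((1 + 4 * \<delta>) * (1 + \<delta>)\<^sup>2 / (1 - 6 * \<delta>)) * (\<integral>\<^sup>+ y. err \<mu>0 \<phi> v0 y \<partial>P)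
    + ennreal (1 / \<delta> * (8 * (L\<^sup>2 * rd\<^sup>2 * (b - a)) + 76 * (\<integral>y. remainder \<Lambda> v0 m T y \<partial>P)))"
proof -
  let ?c = "ennreal ((1 + 4 * \<delta>) * (1 + \<delta>)\<^sup>2 / (1 - 6 * \<delta>))"
  let ?r = "\<lambda>y. 1 / \<delta> * (8 * (L\<^sup>2 * rd\<^sup>2 * (b - a)) + 76 * remainder \<Lambda> v0 m T y)"
  have ir: "integrable P ?r" by (intro moments_integrable moments_mult moments_add moments_const moments_remainder)
  have r0: "0 \<le> ?r y" for y using \<delta> ab remainder_nonneg[OF T] by (intro mult_nonneg_nonneg add_nonneg_nonneg) auto
  have "(\<integral>\<^sup>+ y. err \<mu>0 \<phi> (v y) y \<partial>P) \<le> (\<integral>\<^sup>+ y. ?c * err \<mu>0 \<phi> v0 y + ennreal (?r y) \<partial>P)"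
  proof (rule nn_integral_mono)
    fix y assume "y \<in> space P"
    then have "is_arg_min (cost a b \<mu>0 n \<phi> \<delta> y) (\<lambda>lam. lam \<in> \<Lambda>) (v y)"
      using min unfolding cost_minimiser_def by simp
    then have "v y \<in> \<Lambda>" "cost a b \<mu>0 n \<phi> \<delta> y (v y) \<le> cost a b \<mu>0 n \<phi> \<delta> y v0"
      using v0 unfolding is_arg_min_def by (auto simp: not_less)
    then show "err \<mu>0 \<phi> (v y) y \<le> ?c * err \<mu>0 \<phi> v0 y + ennreal (?r y)"
      by (intro pointwise_oracle \<delta> T m \<Lambda> v0)
  qed
  also have "\<dots> = ?c * (\<integral>\<^sup>+ y. err \<mu>0 \<phi> v0 y \<partial>P) + (\<integral>\<^sup>+ y. ennreal (?r y) \<partial>P)"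
  proof -
    have e: "err \<mu>0 \<phi> v0 \<in> borel_measurable P"
      using err_measurable[of v0] unfolding measurable_cong_sets[OF sets_P refl] .
    have r: "(\<lambda>y. ennreal (?r y)) \<in> borel_measurable P"
      using borel_measurable_integrable[OF ir] by (rule measurable_compose[OF _ measurable_ennreal])
    show ?thesis using e r by (subst nn_integral_add) (auto simp: nn_integral_cmult)
  qed
  also have "(\<integral>\<^sup>+ y. ennreal (?r y) \<partial>P) = ennreal (\<integral>y. ?r y \<partial>P)"
    using ir r0 by (intro nn_integral_eq_integral) auto
  also have "(\<integral>y. ?r y \<partial>P) = 1 / \<delta> * (8 * (L\<^sup>2 * rd\<^sup>2 * (b - a)) + 76 * (\<integral>y. remainder \<Lambda> v0 m T y \<partial>P))"
    using moments_integrable[OF moments_remainder] P.prob_space by simp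
  finally show ?thesis .
qed

end

section \<open>A finite risk bound for every sample size\<close>

locale ar_mid = ar_model a b y0 n p S vs \<epsilon> L + mid_windows a b n \<mu>0
  for a b y0 :: real and n :: nat and p S :: "real \<Rightarrow> real" and vs \<epsilon> L \<mu>0 :: real
begin

text \<open>Majorises all sequential estimators at once: the factor \<open>2\<close> is the bound on
  the inverse threshold from \<open>iota_less_of_pos\<close>, and each weight is at most the
  previous observation in modulus.\<close>

definition "crude y = 2 * (\<Sum>j=1..n. \<bar>y (j - 1)\<bar> * \<bar>y j\<bar>)" for y :: "nat \<Rightarrow> real"

lemma crude_nonneg: "0 \<le> crude y" unfolding crude_def by (intro mult_nonneg_nonneg sum_nonneg) auto

lemma Yreg_crude:
  assumes l: "1 \<le> l" "l \<le> num_pts n"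
  shows "\<bar>Yreg a b \<mu>0 n l y\<bar> \<le> crude y"
proof (cases "Gam a b \<mu>0 n y")
  case True
  then have G: "Gam_l a b \<mu>0 n l y" using l unfolding Gam_def by auto
  have H0: "0 < H l y" using G unfolding Gam_l_def by simp
  have "\<bar>S_seq a b \<mu>0 n l y\<bar> = 1 / H l y * \<bar>\<Sum>j=\<iota> l + 1..k2 l. wt l j y * y j\<bar>"
    unfolding S_seq_eq[OF l G] abs_mult using H0 by simp
  also have "\<dots> \<le> 2 * (\<Sum>j=\<iota> l + 1..k2 l. \<bar>y (j - 1)\<bar> * \<bar>y j\<bar>)"
  proof (rule mult_mono)
    show "1 / H l y \<le> 2" by (rule iota_less_of_pos(2)[OF H0])
    have "\<bar>\<Sum>j=\<iota> l + 1..k2 l. wt l j y * y j\<bar> \<le> (\<Sum>j=\<iota> l + 1..k2 l. \<bar>wt l j y * y j\<bar>)" by (rule sum_abs)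
    also have "\<dots> \<le> (\<Sum>j=\<iota> l + 1..k2 l. \<bar>y (j - 1)\<bar> * \<bar>y j\<bar>)"
      unfolding abs_mult using wt_abs_le[OF l(1)] by (intro sum_mono mult_right_mono) auto
    finally show "\<bar>\<Sum>j=\<iota> l + 1..k2 l. wt l j y * y j\<bar> \<le> (\<Sum>j=\<iota> l + 1..k2 l. \<bar>y (j - 1)\<bar> * \<bar>y j\<bar>)" .
  qed auto
  also have "\<dots> \<le> crude y"
    unfolding crude_def using k_last_le[of l] by (intro mult_left_mono sum_mono2) auto
  finally show ?thesis unfolding Yreg_def using True by simp
qed (simp add: Yreg_def crude_nonneg)

text \<open>Depends on the basis, and thus on \<open>n\<close>, in an uncontrolled way; it enters
  only a constant belonging to a single \<open>n\<close>.\<close>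

definition "phi_const \<phi> = (\<Sum>l\<in>I. \<Sum>j\<in>I. rd * (\<Sum>l'\<in>I. \<bar>\<phi> j (z l')\<bar>) * \<bar>\<phi> j (z l)\<bar>)"
  for \<phi> :: "nat \<Rightarrow> real \<Rightarrow> real"

lemma S_lam_pt_crude:
  assumes w: "w \<in> weight_cube n" and l: "l \<in> I"
  shows "\<bar>S_lam_pt a b \<mu>0 n \<phi> w y l\<bar> \<le> phi_const \<phi> * crude y"
proof -
  have th: "\<bar>theta_hat a b \<mu>0 n \<phi> j y\<bar> \<le> crude y * (rd * (\<Sum>l'\<in>I. \<bar>\<phi> j (z l')\<bar>))" for j
  proof -
    have "\<bar>theta_hat a b \<mu>0 n \<phi> j y\<bar> = rd * \<bar>\<Sum>l\<in>I. Yreg a b \<mu>0 n l y * \<phi> j (z l)\<bar>"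
      unfolding theta_hat_def rd_def[symmetric] abs_mult using rd_pos by simp
    also have "\<dots> \<le> rd * (\<Sum>l\<in>I. \<bar>Yreg a b \<mu>0 n l y * \<phi> j (z l)\<bar>)"
      using rd_pos by (intro mult_left_mono sum_abs) auto
    also have "\<dots> \<le> rd * (\<Sum>l\<in>I. crude y * \<bar>\<phi> j (z l)\<bar>)"
      unfolding abs_mult using rd_pos Yreg_crude by (intro mult_left_mono sum_mono mult_right_mono) auto
    finally show ?thesis by (simp only: sum_distrib_left[symmetric] mult.left_commute)
  qed
  have "\<bar>S_lam_pt a b \<mu>0 n \<phi> w y l\<bar> \<le> (\<Sum>j\<in>I. \<bar>w j * theta_hat a b \<mu>0 n \<phi> j y * \<phi> j (z l) * of_bool (Gam a b \<mu>0 n y)\<bar>)"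
    unfolding S_lam_pt_def by (rule sum_abs)
  also have "\<dots> \<le> (\<Sum>j\<in>I. (1 * (crude y * (rd * (\<Sum>l'\<in>I. \<bar>\<phi> j (z l')\<bar>))) * \<bar>\<phi> j (z l)\<bar>) * 1)"
  proof (rule sum_mono)
    fix j assume j: "j \<in> I"
    have "0 \<le> w j" "w j \<le> 1" using w j unfolding weight_cube_def PiE_def Pi_def by auto
    then show "\<bar>w j * theta_hat a b \<mu>0 n \<phi> j y * \<phi> j (z l) * of_bool (Gam a b \<mu>0 n y)\<bar>
       \<le> (1 * (crude y * (rd * (\<Sum>l'\<in>I. \<bar>\<phi> j (z l')\<bar>))) * \<bar>\<phi> j (z l)\<bar>) * 1"
      unfolding abs_mult using th crude_nonneg rd_pos
      by (intro mult_mono) (auto intro!: mult_nonneg_nonneg sum_nonneg)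
  qed
  also have "\<dots> = crude y * (\<Sum>j\<in>I. rd * (\<Sum>l'\<in>I. \<bar>\<phi> j (z l')\<bar>) * \<bar>\<phi> j (z l)\<bar>)"
    by (simp only: sum_distrib_left[of "crude y"] mult_1 mult_1_right mult.assoc)
  also have "\<dots> \<le> crude y * phi_const \<phi>"
    unfolding phi_const_def using rd_pos
    by (intro mult_left_mono crude_nonneg member_le_sum[OF l, of "\<lambda>l. \<Sum>j\<in>I. rd * (\<Sum>l'\<in>I. \<bar>\<phi> j (z l')\<bar>) * \<bar>\<phi> j (z l)\<bar>"])
       (auto intro!: sum_nonneg mult_nonneg_nonneg)
  finally show ?thesis by (simp only: mult.commute)
qed

lemma crude_square_le: "(crude y)\<^sup>2 \<le> 4 * real n * (\<Sum>j=1..n. y (j - 1) ^ 4 + y j ^ 4)"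
proof -
  have "(\<Sum>j=1..n. 1 * (\<bar>y (j - 1)\<bar> * \<bar>y j\<bar>))\<^sup>2 \<le> (\<Sum>j=1..n. 1\<^sup>2) * (\<Sum>j=1..n. (\<bar>y (j - 1)\<bar> * \<bar>y j\<bar>)\<^sup>2)"
    by (rule Cauchy_Schwarz_ineq_sum)
  also have "\<dots> \<le> real n * (\<Sum>j=1..n. y (j - 1) ^ 4 + y j ^ 4)"
  proof -
    have "(\<bar>y (j - 1)\<bar> * \<bar>y j\<bar>)\<^sup>2 \<le> y (j - 1) ^ 4 + y j ^ 4" for j
    proof -
      have "2 * ((y (j - 1))\<^sup>2 * (y j)\<^sup>2) \<le> ((y (j - 1))\<^sup>2)\<^sup>2 + ((y j)\<^sup>2)\<^sup>2"
        using sum_squares_bound[of "(y (j - 1))\<^sup>2" "(y j)\<^sup>2"] by simp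
      moreover have "0 \<le> (y (j - 1))\<^sup>2 * (y j)\<^sup>2" by simp
      moreover have "y (j - 1) ^ 4 = ((y (j - 1))\<^sup>2)\<^sup>2" "y j ^ 4 = ((y j)\<^sup>2)\<^sup>2" by simp_all
      ultimately show ?thesis unfolding power_mult_distrib power2_abs by linarith
    qed
    then show ?thesis by (auto intro!: mult_left_mono sum_mono)
  qed
  finally show ?thesis unfolding crude_def by (simp add: power_mult_distrib)
qed

definition "crude_bound \<phi> = 2 * (b - a) * (2 * (phi_const \<phi>)\<^sup>2 * (8 * (real n)\<^sup>2 * (Cy 2 * vs\<^sup>2)) + 2) + 2 * (L\<^sup>2 * rd\<^sup>2 * (b - a))"

text \<open>Finiteness and independence of \<open>S\<close> and \<open>p\<close> are what matters:
  the bound provides an admissible constant for each single \<open>n\<close>. It comes from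
  \<open>err_upper\<close> with \<open>\<delta> = 1\<close> and the fourth moments of the
  observations.\<close>

lemma crude_risk:
  assumes v: "\<And>y. y \<in> space (obs_space n) \<Longrightarrow> v y \<in> weight_cube n"
  shows "(\<integral>\<^sup>+ y. err \<mu>0 \<phi> (v y) y \<partial>P) \<le> ennreal (crude_bound \<phi>)"
proof -
  let ?q = "\<lambda>y :: nat \<Rightarrow> real. (\<Sum>j=1..n. y (j - 1) ^ 4 + y j ^ 4)"
  define g where "g x = 2 * (b - a) * (2 * (phi_const \<phi>)\<^sup>2 * (4 * real n * x) + 2) + 2 * (L\<^sup>2 * rd\<^sup>2 * (b - a))" for x
  let ?f = "\<lambda>y. g (?q y)"
  have g_mono: "g x \<le> g x'" if "x \<le> x'" for x x'
    unfolding g_def using ab that by (intro add_right_mono mult_left_mono) auto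
  have am: "moments (\<lambda>y. y (j - 1))" "moments (\<lambda>y. y j)" if "j \<in> {1..n}" for j
    using that by (auto intro!: moments_y)
  have amf: "moments ?f" unfolding g_def by (intro moments_add moments_mult moments_const moments_sum moments_power am)
  have q0: "0 \<le> ?q y" for y by (intro sum_nonneg add_nonneg_nonneg) auto
  have f0: "0 \<le> ?f y" for y
    using ab q0 unfolding g_def by (intro add_nonneg_nonneg mult_nonneg_nonneg) auto
  have "(\<integral>\<^sup>+ y. err \<mu>0 \<phi> (v y) y \<partial>P) \<le> (\<integral>\<^sup>+ y. ennreal (?f y) \<partial>P)"
  proof (rule nn_integral_mono)
    fix y assume "y \<in> space P"
    then have vy: "v y \<in> weight_cube n" using v by simp
    have "dErr \<mu>0 \<phi> (v y) y \<le> rd * (\<Sum>l\<in>I. 2 * (phi_const \<phi>)\<^sup>2 * (4 * real n * ?q y) + 2)"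
      unfolding dErr_def
    proof (intro mult_left_mono sum_mono)
      fix l assume l: "l \<in> I"
      let ?p = "S_lam_pt a b \<mu>0 n \<phi> (v y) y l"
      have "z l \<in> {a..b}" using l by (intro zpt_mem) auto
      then have "\<bar>S (z l)\<bar> \<le> 1 - \<epsilon>" using S unfolding smooth_class_def by blast
      then have s: "(S (z l))\<^sup>2 \<le> 1" using eps by (simp add: abs_square_le_1)
      have "?p\<^sup>2 \<le> (phi_const \<phi> * crude y)\<^sup>2"
        using S_lam_pt_crude[OF vy l, of \<phi> y] by (metis abs_ge_zero power2_abs power_mono)
      also have "\<dots> \<le> (phi_const \<phi>)\<^sup>2 * (4 * real n * ?q y)"
        unfolding power_mult_distrib by (intro mult_left_mono crude_square_le) auto
      finally have p: "?p\<^sup>2 \<le> (phi_const \<phi>)\<^sup>2 * (4 * real n * ?q y)" .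
      have "0 \<le> (?p + S (z l))\<^sup>2" by simp
      then have "(?p - S (z l))\<^sup>2 \<le> 2 * ?p\<^sup>2 + 2 * (S (z l))\<^sup>2"
        unfolding power2_sum power2_diff by linarith
      then show "(?p - S (z l))\<^sup>2 \<le> 2 * (phi_const \<phi>)\<^sup>2 * (4 * real n * ?q y) + 2"
        using p s by linarith
    qed (use rd_pos in simp)
    also have "\<dots> = (b - a) * (2 * (phi_const \<phi>)\<^sup>2 * (4 * real n * ?q y) + 2)"
      unfolding sum_distrib_left by (rule total_cells)
    finally have d: "dErr \<mu>0 \<phi> (v y) y \<le> (b - a) * (2 * (phi_const \<phi>)\<^sup>2 * (4 * real n * ?q y) + 2)" .
    have gen: "(1 + 1) * e + (1 + 1 / 1) * k \<le> 2 * (b - a) * X + 2 * k" if "e \<le> (b - a) * X" for e k X :: real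
      unfolding mult.assoc[of 2] using that by simp
    have "(1 + 1) * dErr \<mu>0 \<phi> (v y) y + (1 + 1 / 1) * (L\<^sup>2 * rd\<^sup>2 * (b - a)) \<le> ?f y"
      unfolding g_def by (rule gen[OF d])
    then show "err \<mu>0 \<phi> (v y) y \<le> ennreal (?f y)"
      using err_upper[of 1 \<mu>0 \<phi> "v y" y] by (meson ennreal_leI order_trans zero_less_one)
  qed
  also have "\<dots> = ennreal (\<integral>y. ?f y \<partial>P)"
    using moments_integrable[OF amf] f0 by (intro nn_integral_eq_integral) auto
  also have "(\<integral>y. ?f y \<partial>P) = g (\<integral>y. ?q y \<partial>P)"
  proof -
    have "moments ?q" by (intro moments_add moments_sum moments_power am)
    from moments_integrable[OF this] show ?thesis unfolding g_def using P.prob_space by simp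
  qed
  finally have main: "(\<integral>\<^sup>+ y. err \<mu>0 \<phi> (v y) y \<partial>P) \<le> ennreal (g (\<integral>y. ?q y \<partial>P))" .
  have "(\<integral>y. ?q y \<partial>P) = (\<Sum>j=1..n. (\<integral>y. y (j - 1) ^ 4 \<partial>P) + (\<integral>y. y j ^ 4 \<partial>P))"
  proof -
    have i: "integrable P (\<lambda>y. y (j - 1) ^ 4)" "integrable P (\<lambda>y. y j ^ 4)" if "j \<in> {1..n}" for j
      by (intro moments_integrable moments_power am[OF that])+
    have "(\<integral>y. ?q y \<partial>P) = (\<Sum>j=1..n. (\<integral>y. y (j - 1) ^ 4 + y j ^ 4 \<partial>P))"
      by (intro Bochner_Integration.integral_sum Bochner_Integration.integrable_add i)
    also have "\<dots> = (\<Sum>j=1..n. (\<integral>y. y (j - 1) ^ 4 \<partial>P) + (\<integral>y. y j ^ 4 \<partial>P))"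
      by (intro sum.cong refl Bochner_Integration.integral_add i)
    finally show ?thesis .
  qed
  also have "\<dots> \<le> (\<Sum>j=1..n. Cy 2 * vs\<^sup>2 + Cy 2 * vs\<^sup>2)"
  proof (intro sum_mono add_mono)
    fix j assume "j \<in> {1..n}"
    then show "(\<integral>y. y (j - 1) ^ 4 \<partial>P) \<le> Cy 2 * vs\<^sup>2" "(\<integral>y. y j ^ 4 \<partial>P) \<le> Cy 2 * vs\<^sup>2"
      using y_moment[of "j - 1" 2] y_moment[of j 2] by auto
  qed
  also have "\<dots> = real n * (2 * (Cy 2 * vs\<^sup>2))" by simp
  finally have "ennreal (g (\<integral>y. ?q y \<partial>P)) \<le> ennreal (g (real n * (2 * (Cy 2 * vs\<^sup>2))))"
    by (intro ennreal_leI g_mono)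
  also have "g (real n * (2 * (Cy 2 * vs\<^sup>2))) = crude_bound \<phi>"
    unfolding crude_bound_def g_def by (simp add: power2_eq_square)
  finally show ?thesis using main by (rule order_trans[rotated])
qed

end

section \<open>Scaling of the remainder\<close>

context ar_select
begin

text \<open>Free of \<open>S\<close>, \<open>p\<close>, \<open>n\<close> and \<Lambda>. The summands
  collect the discretisation, the bias, the linear and the quadratic forms; \<open>m\<close> will be
  tied to the exponent in the final growth bound.\<close>

definition "oracle_const m = 32 * L\<^sup>2 * (b - a) ^ 3
  + 76 * ((b - a) * (2 * (L * (b - a))\<^sup>2 + 128 * (1 + L * (b - a))\<^sup>2 * (1 + 2 * Cy (2 * m)))
    + 3 * (256 * (b - a) * mart_const 1 * Cy 1) + 3 * (65536 * (b - a) * quad_const))"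

text \<open>A single number \<open>x\<close> dominates \<open>vs\<close>, the cardinality and the
  logarithm, and is also the truncation level. The sixth power is dictated by the quadratic forms,
  which contribute the cardinality times \<open>vs ^ 4 / eps_tilde n\<close>.\<close>

lemma scaled_remainder_le:
  assumes m: "3 \<le> m" and x: "1 \<le> x" and vx: "vs \<le> x" and cx: "real (card \<Lambda>) \<le> x" and ex: "1 / eps_tilde n \<le> x"
    and nx: "real n \<le> x ^ (2 * m - 4)"
  shows "real n * (8 * (L\<^sup>2 * rd\<^sup>2 * (b - a)) + 76 * (\<integral>y. remainder \<Lambda> v0 m x y \<partial>P)) \<le> oracle_const m * x ^ 6"
proof -
  have n0: "0 < real n" using n by simp
  have ba: "0 < b - a" using ab by simp
  have pw: "1 \<le> x ^ k" for k using x by (rule one_le_power)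
  have x6: "x ^ k \<le> x ^ 6" if "k \<le> 6" for k using x that by (intro power_increasing) auto
  have sq: "(sqrt (real n))\<^sup>2 = real n" by simp
  have rd2: "real n * rd\<^sup>2 \<le> 4 * (b - a)\<^sup>2"
  proof -
    have "rd\<^sup>2 \<le> (2 * (b - a) / sqrt (real n))\<^sup>2" using rd_le rd_pos by (intro power_mono) auto
    also have "\<dots> = 4 * (b - a)\<^sup>2 / real n" by (simp only: power_divide power_mult_distrib sq) simp
    finally show ?thesis using n0 by (simp add: le_divide_eq mult.commute)
  qed
  have lip_h: "lip_h \<le> L * (b - a)" "real n * lip_h\<^sup>2 \<le> (L * (b - a))\<^sup>2"
  proof -
    have e: "lip_h = L * rd / 2" unfolding lip_h_def bandw_def rd_def by simp
    have "rd \<le> b - a" unfolding rd_def using ba num_pts_bounds(1)[OF n] by (simp add: divide_le_eq)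
    then have "L * rd \<le> L * (b - a)" using L by (intro mult_left_mono) auto
    moreover have "0 \<le> L * rd" using L rd_pos by simp
    ultimately show "lip_h \<le> L * (b - a)" unfolding e by linarith
    have "real n * lip_h\<^sup>2 = L\<^sup>2 * (real n * rd\<^sup>2) / 4" unfolding e by (simp add: power_divide power_mult_distrib)
    also have "\<dots> \<le> L\<^sup>2 * (4 * (b - a)\<^sup>2) / 4" using rd2 by (intro divide_right_mono mult_left_mono) auto
    finally show "real n * lip_h\<^sup>2 \<le> (L * (b - a))\<^sup>2" by (simp add: power_mult_distrib)
  qed
  let ?C = "Cy (2 * m)"
  have C0: "0 < ?C" by (rule Cy_pos)
  have v0: "0 \<le> vs" using vs by simp
  define B1 where "B1 = (b - a) * (2 * lip_h\<^sup>2 + 2 * (1 + lip_h)\<^sup>2 * (64 / real n) * (x ^ 4 + 2 * real n * (?C * vs ^ (2 * m)) / x ^ (4 * m - 4)))"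
  have b1: "real n * B1 \<le> (b - a) * (2 * (L * (b - a))\<^sup>2 + 128 * (1 + L * (b - a))\<^sup>2 * (1 + 2 * ?C)) * x ^ 6"
  proof -
    \<comment> \<open>The sum over \<open>n\<close> observations and the moment of order
      \<open>4 * m\<close> are compensated by the truncation: \<open>nx\<close> makes the exponents
      add up to \<open>(2 * m - 4) + 2 * m\<close>.\<close>
    have t: "real n * vs ^ (2 * m) / x ^ (4 * m - 4) \<le> 1"
    proof -
      have "real n * vs ^ (2 * m) \<le> x ^ (2 * m - 4) * x ^ (2 * m)" using nx vx v0 x by (intro mult_mono power_mono) auto
      also have "\<dots> = x ^ (4 * m - 4)" unfolding power_add[symmetric] using m by (intro arg_cong[where f = "power x"]) simp
      finally show ?thesis using pw[of "4 * m - 4"] by (simp add: divide_le_eq)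
    qed
    have q: "x ^ 4 + 2 * real n * (?C * vs ^ (2 * m)) / x ^ (4 * m - 4) \<le> (1 + 2 * ?C) * x ^ 6"
    proof -
      have "2 * real n * (?C * vs ^ (2 * m)) / x ^ (4 * m - 4) = 2 * ?C * (real n * vs ^ (2 * m) / x ^ (4 * m - 4))" by simp
      also have "\<dots> \<le> 2 * ?C * x ^ 6" using t pw[of 6] C0 by (intro mult_left_mono) auto
      finally show ?thesis using x6[of 4] by (simp add: distrib_right)
    qed
    have "real n * B1 = (b - a) * (2 * (real n * lip_h\<^sup>2) + 128 * (1 + lip_h)\<^sup>2 * (x ^ 4 + 2 * real n * (?C * vs ^ (2 * m)) / x ^ (4 * m - 4)))"
    proof -
      have "N * (c * (2 * r + 2 * s * (64 / N) * Q)) = c * (2 * (N * r) + 128 * s * Q)" if "0 < N" for N c r s Q :: real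
        using that by (simp add: field_simps)
      from this[OF n0] show ?thesis unfolding B1_def .
    qed
    also have "\<dots> \<le> (b - a) * (2 * ((L * (b - a))\<^sup>2 * x ^ 6) + 128 * (1 + L * (b - a))\<^sup>2 * ((1 + 2 * ?C) * x ^ 6))"
    proof -
      have "(L * (b - a))\<^sup>2 * 1 \<le> (L * (b - a))\<^sup>2 * x ^ 6" using pw[of 6] by (intro mult_left_mono) auto
      then have "2 * (real n * lip_h\<^sup>2) \<le> 2 * ((L * (b - a))\<^sup>2 * x ^ 6)" using lip_h(2) by linarith
      moreover have "128 * (1 + lip_h)\<^sup>2 \<le> 128 * (1 + L * (b - a))\<^sup>2" using lip_h(1) lip_h_nonneg by (intro mult_left_mono power_mono) auto
      then have "128 * (1 + lip_h)\<^sup>2 * (x ^ 4 + 2 * real n * (?C * vs ^ (2 * m)) / x ^ (4 * m - 4)) \<le> 128 * (1 + L * (b - a))\<^sup>2 * ((1 + 2 * ?C) * x ^ 6)"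
      proof (rule mult_mono[OF _ q])
        have "0 \<le> 2 * real n * (?C * vs ^ (2 * m)) / x ^ (4 * m - 4)" using C0 v0 x by simp
        then show "0 \<le> x ^ 4 + 2 * real n * (?C * vs ^ (2 * m)) / x ^ (4 * m - 4)" by simp
      qed simp
      ultimately show ?thesis using ba by (intro mult_left_mono add_mono) auto
    qed
    finally show ?thesis by (simp only: distrib_right distrib_left mult.assoc)
  qed
  define B2 where "B2 = (2 * real (card \<Lambda>) + 1) * (256 * (b - a) * mart_const 1 * Cy 1 * vs\<^sup>2 / real n)"
  have b2: "real n * B2 \<le> 3 * (256 * (b - a) * mart_const 1 * Cy 1) * x ^ 6"
  proof -
    have k0: "0 \<le> 256 * (b - a) * mart_const 1 * Cy 1" using ba mart_const_pos[of 1] Cy_pos[of 1] by simp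
    have "real n * B2 = (256 * (b - a) * mart_const 1 * Cy 1) * ((2 * real (card \<Lambda>) + 1) * vs\<^sup>2)"
      unfolding B2_def using n0 by simp
    also have "\<dots> \<le> (256 * (b - a) * mart_const 1 * Cy 1) * ((3 * x) * x\<^sup>2)"
      using cx x vx v0 k0 by (intro mult_left_mono mult_mono power_mono) auto
    also have "(3 * x) * x\<^sup>2 = 3 * x ^ 3" by (simp add: power2_eq_square power3_eq_cube)
    also have "(256 * (b - a) * mart_const 1 * Cy 1) * (3 * x ^ 3) \<le> (256 * (b - a) * mart_const 1 * Cy 1) * (3 * x ^ 6)"
      using x6[of 3] k0 by (intro mult_left_mono) auto
    finally show ?thesis by (simp only: mult_ac)
  qed
  define B3 where "B3 = (real (card \<Lambda>) + 2) * (65536 * (b - a) * quad_const * vs ^ 4 / (eps_tilde n * real n))"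
  have b3: "real n * B3 \<le> 3 * (65536 * (b - a) * quad_const) * x ^ 6"
  proof -
    have k0: "0 \<le> 65536 * (b - a) * quad_const" using ba quad_const_pos by simp
    have e: "0 < eps_tilde n" by (rule eps_tilde_bounds(1))
    have "real n * B3 = (65536 * (b - a) * quad_const) * ((real (card \<Lambda>) + 2) * (vs ^ 4 * (1 / eps_tilde n)))"
      unfolding B3_def using n0 by simp
    also have "\<dots> \<le> (65536 * (b - a) * quad_const) * ((3 * x) * (x ^ 4 * x))"
      using cx x vx v0 k0 e ex by (intro mult_left_mono mult_mono power_mono) auto
    also have "(3 * x) * (x ^ 4 * x) = 3 * x ^ 6" by (simp add: eval_nat_numeral)
    finally show ?thesis by (simp only: mult_ac)
  qed
  have a1: "real n * (8 * (L\<^sup>2 * rd\<^sup>2 * (b - a))) \<le> 32 * L\<^sup>2 * (b - a) ^ 3 * x ^ 6"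
  proof -
    have "real n * (8 * (L\<^sup>2 * rd\<^sup>2 * (b - a))) = 8 * L\<^sup>2 * (b - a) * (real n * rd\<^sup>2)" by (simp only: mult_ac)
    also have "\<dots> \<le> 8 * L\<^sup>2 * (b - a) * (4 * (b - a)\<^sup>2)" using rd2 ba by (intro mult_left_mono) auto
    also have "\<dots> = 32 * L\<^sup>2 * (b - a) ^ 3 * 1" by (simp add: power2_eq_square power3_eq_cube)
    also have "\<dots> \<le> 32 * L\<^sup>2 * (b - a) ^ 3 * x ^ 6" using pw[of 6] ba by (intro mult_left_mono) auto
    finally show ?thesis .
  qed
  have "(\<integral>y. remainder \<Lambda> v0 m x y \<partial>P) \<le> B1 + B2 + B3"
    unfolding B1_def B2_def B3_def using x m by (intro remainder_moment) auto
  then have "real n * (\<integral>y. remainder \<Lambda> v0 m x y \<partial>P) \<le> real n * (B1 + B2 + B3)" using n0 by (intro mult_left_mono) auto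
  also have "\<dots> = real n * B1 + real n * B2 + real n * B3" by (simp only: distrib_left)
  finally have r: "real n * (\<integral>y. remainder \<Lambda> v0 m x y \<partial>P) \<le> real n * B1 + real n * B2 + real n * B3" .
  have "real n * (8 * (L\<^sup>2 * rd\<^sup>2 * (b - a)) + 76 * (\<integral>y. remainder \<Lambda> v0 m x y \<partial>P))
     = real n * (8 * (L\<^sup>2 * rd\<^sup>2 * (b - a))) + 76 * (real n * (\<integral>y. remainder \<Lambda> v0 m x y \<partial>P))"
    by (simp only: distrib_left mult.left_commute)
  also have "\<dots> \<le> 32 * L\<^sup>2 * (b - a) ^ 3 * x ^ 6 + 76 * ((b - a) * (2 * (L * (b - a))\<^sup>2 + 128 * (1 + L * (b - a))\<^sup>2 * (1 + 2 * ?C)) * x ^ 6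
      + 3 * (256 * (b - a) * mart_const 1 * Cy 1) * x ^ 6 + 3 * (65536 * (b - a) * quad_const) * x ^ 6)"
    using a1 b1 b2 b3 r by (intro add_mono mult_left_mono) auto
  also have "\<dots> = oracle_const m * x ^ 6"
    unfolding oracle_const_def by (simp only: distrib_right[of _ _ "x ^ 6"] mult.assoc[of 76])
  finally show ?thesis .
qed

end

section \<open>Asymptotics and the choice of the constants\<close>

lemma eventually_large_windows:
  assumes "0 < \<mu>0" "\<mu>0 < 1"
  shows "eventually (\<lambda>n. 1 \<le> half_width n \<and> half_width n powr \<mu>0 + 2 \<le> half_width n / 2) sequentially"
proof -
  have "filterlim (\<lambda>n::nat. sqrt (real n) / 2) at_top sequentially" by real_asymp
  then have lim: "filterlim half_width at_top sequentially"
  proof (rule filterlim_at_top_mono)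
    show "eventually (\<lambda>n. sqrt (real n) / 2 \<le> half_width n) sequentially"
      using eventually_ge_at_top[of 1] by eventually_elim (rule half_width_bounds)
  qed
  have "((\<lambda>w::real. w powr (\<mu>0 - 1) + 2 / w) \<longlongrightarrow> 0 + 0) at_top"
    using assms by (intro tendsto_add tendsto_neg_powr filterlim_ident tendsto_divide_0[OF tendsto_const] filterlim_at_top_imp_at_infinity) auto
  then have "eventually (\<lambda>w::real. w powr (\<mu>0 - 1) + 2 / w < 1 / 2) at_top"
    by (rule order_tendstoD) simp
  then have "eventually (\<lambda>w::real. 1 \<le> w \<and> w powr \<mu>0 + 2 \<le> w / 2) at_top"
    using eventually_ge_at_top[of 1]
  proof eventually_elim
    case (elim w)
    have "w powr \<mu>0 + 2 = w * (w powr (\<mu>0 - 1) + 2 / w)"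
      using elim powr_mult_base[of w "\<mu>0 - 1"] by (simp add: distrib_left)
    also have "\<dots> \<le> w * (1 / 2)" using elim by (intro mult_left_mono) auto
    finally show ?case using elim by simp
  qed
  then show ?thesis using lim by (rule eventually_compose_filterlim)
qed

lemma eventually_le_powr:
  assumes "(\<lambda>n. f n / real n powr \<eta>) \<longlonglongrightarrow> 0"
  shows "eventually (\<lambda>n. f n \<le> real n powr \<eta>) sequentially"
proof -
  have "eventually (\<lambda>n. f n / real n powr \<eta> < 1) sequentially" using assms by (rule order_tendstoD) simp
  then show ?thesis using eventually_ge_at_top[of 1]
    by eventually_elim (simp add: divide_less_eq split: if_splits)
qed

lemma powr_quotient_tendsto_0: "0 < \<eta> \<Longrightarrow> (\<lambda>n::nat. real n powr \<gamma> / real n powr (\<gamma> + \<eta>)) \<longlonglongrightarrow> 0"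
proof -
  assume \<eta>: "0 < \<eta>"
  have "(\<lambda>n::nat. real n powr (- \<eta>)) \<longlonglongrightarrow> 0" using \<eta> by (intro tendsto_neg_powr filterlim_real_sequentially) auto
  then show ?thesis by (simp add: powr_diff[symmetric] )
qed

lemma eventually_log_le_powr: "0 < \<eta> \<Longrightarrow> eventually (\<lambda>n. 2 + ln (real n) \<le> real n powr \<eta>) sequentially"
proof (rule eventually_le_powr)
  assume "0 < \<eta>"
  then show "(\<lambda>n. (2 + ln (real n)) / real n powr \<eta>) \<longlonglongrightarrow> 0" by real_asymp
qed

text \<open>The asserted inequality at one \<open>n\<close> with a free constant \<open>c\<close>.
  Uniformity in \<open>S\<close>, \<delta> and the minimiser is kept inside, so that admissibility
  is a property of \<open>c\<close> alone and one can choose a least admissible constant.\<close>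

definition oracle_bound ::
  "real \<Rightarrow> real \<Rightarrow> real \<Rightarrow> real \<Rightarrow> real \<Rightarrow> real \<Rightarrow> real \<Rightarrow> (nat \<Rightarrow> real \<Rightarrow> real) \<Rightarrow> (nat \<Rightarrow> real) set \<Rightarrow> nat \<Rightarrow> real \<Rightarrow> bool" where
  "oracle_bound a b \<epsilon> L y0 \<mu>0 vs \<phi> \<Lambda> n c \<longleftrightarrow>
    (\<forall>S\<in>smooth_class a b \<epsilon> L. \<forall>\<delta>. 0 < \<delta> \<and> \<delta> \<le> 1 / 12 \<longrightarrow>
      (\<forall>lamhat. cost_minimiser a b \<mu>0 n \<phi> \<Lambda> \<delta> lamhat \<longrightarrow>
        robust_risk a b n y0 vs (\<lambda>y. S_lam a b \<mu>0 n \<phi> (lamhat y) y) S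
          \<le> ennreal ((1 + 4 * \<delta>) * (1 + \<delta>)\<^sup>2 / (1 - 6 * \<delta>)) *
              Min ((\<lambda>lam. robust_risk a b n y0 vs (S_lam a b \<mu>0 n \<phi> lam) S) ` \<Lambda>)
            + ennreal (c / (\<delta> * real n))))"

lemma oracle_bound_mono:
  assumes "oracle_bound a b \<epsilon> L y0 \<mu>0 vs \<phi> \<Lambda> n c" "c \<le> c'"
  shows "oracle_bound a b \<epsilon> L y0 \<mu>0 vs \<phi> \<Lambda> n c'"
  unfolding oracle_bound_def
proof (intro ballI allI impI)
  fix S \<delta> v assume S: "S \<in> smooth_class a b \<epsilon> L" and \<delta>: "0 < \<delta> \<and> \<delta> \<le> 1 / 12" and v: "cost_minimiser a b \<mu>0 n \<phi> \<Lambda> \<delta> v"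
  have "ennreal (c / (\<delta> * real n)) \<le> ennreal (c' / (\<delta> * real n))"
    using assms(2) \<delta> by (intro ennreal_leI divide_right_mono) auto
  then show "robust_risk a b n y0 vs (\<lambda>y. S_lam a b \<mu>0 n \<phi> (v y) y) S
          \<le> ennreal ((1 + 4 * \<delta>) * (1 + \<delta>)\<^sup>2 / (1 - 6 * \<delta>)) *
              Min ((\<lambda>lam. robust_risk a b n y0 vs (S_lam a b \<mu>0 n \<phi> lam) S) ` \<Lambda>)
            + ennreal (c' / (\<delta> * real n))"
    using assms(1) S \<delta> v unfolding oracle_bound_def by (meson add_left_mono order_trans)
qed

text \<open>A natural number is asked for because a least one then exists.\<close>

lemma oracle_bound_crude:
  assumes ab: "a < b" and eps: "0 < \<epsilon>" "\<epsilon> < 1" and L: "0 < L" and mu: "0 < \<mu>0" "\<mu>0 < 1"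
    and n: "3 \<le> n" and vs: "1 \<le> vs" and \<Lambda>: "\<Lambda> \<subseteq> weight_cube n"
  shows "\<exists>c::nat. oracle_bound a b \<epsilon> L y0 \<mu>0 vs \<phi> \<Lambda> n (real c)"
proof -
  define K where "K = ar_mid.crude_bound a b y0 n vs \<epsilon> L \<phi>"
  \<comment> \<open>The factor \<open>real n\<close> cancels the one in the denominator, and
    \<open>1 / \<delta> \<ge> 1\<close> does the rest; the oracle term is simply dropped.\<close>
  have "oracle_bound a b \<epsilon> L y0 \<mu>0 vs \<phi> \<Lambda> n (max K 0 * real n)"
    unfolding oracle_bound_def
  proof (intro ballI allI impI)
    fix S \<delta> v assume S: "S \<in> smooth_class a b \<epsilon> L" and \<delta>: "0 < \<delta> \<and> \<delta> \<le> 1 / 12" and v: "cost_minimiser a b \<mu>0 n \<phi> \<Lambda> \<delta> v"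
    have "robust_risk a b n y0 vs (\<lambda>y. S_lam a b \<mu>0 n \<phi> (v y) y) S \<le> ennreal K"
      unfolding robust_risk_def
    proof (rule SUP_least)
      fix p assume p: "p \<in> noise_densities vs"
      interpret ar_mid a b y0 n p S vs \<epsilon> L \<mu>0
        by unfold_locales (use ab eps L mu n vs S p in auto)
      have "v y \<in> weight_cube n" if "y \<in> space (obs_space n)" for y
        using v that \<Lambda> unfolding cost_minimiser_def is_arg_min_def by blast
      from crude_risk[of v \<phi>, OF this]
      show "(\<integral>\<^sup>+ y. (\<integral>\<^sup>+ t\<in>{a..b}. ennreal ((S_lam a b \<mu>0 n \<phi> (v y) y t - S t)\<^sup>2) \<partial>lborel) \<partial>ar_law a b n y0 p S) \<le> ennreal K"
        unfolding err_def K_def .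
    qed
    also have "\<dots> \<le> ennreal (max K 0 * real n / (\<delta> * real n))"
    proof (rule ennreal_leI)
      have "max K 0 * 1 \<le> max K 0 * (1 / \<delta>)" using \<delta> by (intro mult_left_mono) auto
      then show "K \<le> max K 0 * real n / (\<delta> * real n)" using n by simp
    qed
    finally show "robust_risk a b n y0 vs (\<lambda>y. S_lam a b \<mu>0 n \<phi> (v y) y) S
          \<le> ennreal ((1 + 4 * \<delta>) * (1 + \<delta>)\<^sup>2 / (1 - 6 * \<delta>)) *
              Min ((\<lambda>lam. robust_risk a b n y0 vs (S_lam a b \<mu>0 n \<phi> lam) S) ` \<Lambda>)
            + ennreal (max K 0 * real n / (\<delta> * real n))"
      by (rule order_trans) simp
  qed
  then show ?thesis by (meson oracle_bound_mono real_arch_simple)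
qed

lemma oracle_bound_large:
  assumes ab: "a < b" and eps: "0 < \<epsilon>" "\<epsilon> < 1" and L: "0 < L" and mu: "0 < \<mu>0" "\<mu>0 < 1"
    and n: "3 \<le> n" and vs: "1 \<le> vs" and \<Lambda>: "finite \<Lambda>" "\<Lambda> \<noteq> {}" "\<Lambda> \<subseteq> weight_cube n" and orth: "orthonormal_system a b n \<phi>"
    and hw: "1 \<le> half_width n" "half_width n powr \<mu>0 + 2 \<le> half_width n / 2"
    and m: "3 \<le> m" and x: "1 \<le> x" and vx: "vs \<le> x" and cx: "real (card \<Lambda>) \<le> x" and ex: "1 / eps_tilde n \<le> x"
    and nx: "real n \<le> x ^ (2 * m - 4)"
  shows "oracle_bound a b \<epsilon> L y0 \<mu>0 vs \<phi> \<Lambda> n (ar_select.oracle_const a b y0 \<epsilon> L m * x ^ 6)"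
  unfolding oracle_bound_def
proof (intro ballI allI impI)
  fix S \<delta> v assume S: "S \<in> smooth_class a b \<epsilon> L" and \<delta>: "0 < \<delta> \<and> \<delta> \<le> 1 / 12" and v: "cost_minimiser a b \<mu>0 n \<phi> \<Lambda> \<delta> v"
  let ?risk = "\<lambda>lam. robust_risk a b n y0 vs (S_lam a b \<mu>0 n \<phi> lam) S"
  let ?c = "ennreal ((1 + 4 * \<delta>) * (1 + \<delta>)\<^sup>2 / (1 - 6 * \<delta>))"
  \<comment> \<open>The comparison weight minimises the robust risk itself and is chosen before
    \<open>p\<close>; its risk under each \<open>p\<close> is then at most its robust risk.\<close>
  have "Min (?risk ` \<Lambda>) \<in> ?risk ` \<Lambda>" using \<Lambda> by (intro Min_in) auto
  then obtain v0 where v0: "v0 \<in> \<Lambda>" "Min (?risk ` \<Lambda>) = ?risk v0" by blast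
  show "robust_risk a b n y0 vs (\<lambda>y. S_lam a b \<mu>0 n \<phi> (v y) y) S
    \<le> ?c * Min (?risk ` \<Lambda>) + ennreal (ar_select.oracle_const a b y0 \<epsilon> L m * x ^ 6 / (\<delta> * real n))"
    unfolding v0(2) unfolding robust_risk_def[of _ _ _ _ _ "\<lambda>y. S_lam a b \<mu>0 n \<phi> (v y) y"]
  proof (rule SUP_least)
    fix p assume p: "p \<in> noise_densities vs"
    interpret ar_select a b y0 n p S vs \<epsilon> L \<mu>0 \<phi>
      by unfold_locales (use ab eps L mu n vs S p hw orth in auto)
    have n0: "0 < real n" using n by simp
    let ?r = "8 * (L\<^sup>2 * rd\<^sup>2 * (b - a)) + 76 * (\<integral>y. remainder \<Lambda> v0 m x y \<partial>P)"
    have "(\<integral>\<^sup>+ y. err \<mu>0 \<phi> (v y) y \<partial>P) \<le> ?c * (\<integral>\<^sup>+ y. err \<mu>0 \<phi> v0 y \<partial>P) + ennreal (1 / \<delta> * ?r)"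
      using \<delta> x m by (intro risk_oracle \<Lambda> v0 v) auto
    also have "\<dots> \<le> ?c * ?risk v0 + ennreal (oracle_const m * x ^ 6 / (\<delta> * real n))"
    proof (intro add_mono mult_left_mono ennreal_leI)
      show "(\<integral>\<^sup>+ y. err \<mu>0 \<phi> v0 y \<partial>P) \<le> ?risk v0"
        unfolding robust_risk_def err_def by (rule SUP_upper[OF p])
      have "real n * ?r \<le> oracle_const m * x ^ 6" by (rule scaled_remainder_le[OF m x vx cx ex nx])
      then have "?r \<le> oracle_const m * x ^ 6 / real n" using n0 by (simp add: le_divide_eq mult.commute)
      then have "1 / \<delta> * ?r \<le> 1 / \<delta> * (oracle_const m * x ^ 6 / real n)" using \<delta> by (intro mult_left_mono) auto
      then show "1 / \<delta> * ?r \<le> oracle_const m * x ^ 6 / (\<delta> * real n)" by simp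
    qed simp
    finally show "(\<integral>\<^sup>+ y. (\<integral>\<^sup>+ t\<in>{a..b}. ennreal ((S_lam a b \<mu>0 n \<phi> (v y) y t - S t)\<^sup>2) \<partial>lborel) \<partial>ar_law a b n y0 p S)
      \<le> ?c * ?risk v0 + ennreal (ar_select.oracle_const a b y0 \<epsilon> L m * x ^ 6 / (\<delta> * real n))"
      unfolding err_def .
  qed
qed

theorem theorem5p4:
  fixes a b \<epsilon> L y0 \<mu>0 :: real
    and vsig :: "nat \<Rightarrow> real"
    and \<phi> :: "nat \<Rightarrow> nat \<Rightarrow> real \<Rightarrow> real"
    and \<Lambda> :: "nat \<Rightarrow> (nat \<Rightarrow> real) set"
  assumes "a < b" and "0 < \<epsilon>" and "\<epsilon> < 1" and "0 < L"
    and "0 < \<mu>0" and "\<mu>0 < 1"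
    and "\<And>n. n \<ge> 3 \<Longrightarrow> 1 \<le> vsig n"
    and "\<And>n. n \<ge> 3 \<Longrightarrow> orthonormal_system a b n (\<phi> n)"
    and "\<And>n. n \<ge> 3 \<Longrightarrow> finite (\<Lambda> n) \<and> \<Lambda> n \<noteq> {} \<and> \<Lambda> n \<subseteq> weight_cube n"
    and "\<And>\<eta>. \<eta> > 0 \<Longrightarrow> (\<lambda>n. vsig n / real n powr \<eta>) \<longlonglongrightarrow> 0"
    and "\<And>\<eta>. \<eta> > 0 \<Longrightarrow> (\<lambda>n. real (card (\<Lambda> n)) / real n powr \<eta>) \<longlonglongrightarrow> 0"
  shows "\<exists>B :: nat \<Rightarrow> real.
     (\<forall>\<eta>>0. (\<lambda>n. B n / real n powr \<eta>) \<longlonglongrightarrow> 0) \<and>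
     (\<forall>n\<ge>3. \<forall>S\<in>smooth_class a b \<epsilon> L. \<forall>\<delta>. 0 < \<delta> \<and> \<delta> \<le> 1 / 12 \<longrightarrow>
        (\<forall>lamhat. cost_minimiser a b \<mu>0 n (\<phi> n) (\<Lambda> n) \<delta> lamhat \<longrightarrow>
           robust_risk a b n y0 (vsig n) (\<lambda>y. S_lam a b \<mu>0 n (\<phi> n) (lamhat y) y) S
             \<le> ennreal ((1 + 4 * \<delta>) * (1 + \<delta>)\<^sup>2 / (1 - 6 * \<delta>)) *
                 Min ((\<lambda>lam. robust_risk a b n y0 (vsig n) (S_lam a b \<mu>0 n (\<phi> n) lam) S) ` \<Lambda> n)
               + ennreal (B n / (\<delta> * real n))))"
proof -
  define Q where "Q n = oracle_bound a b \<epsilon> L y0 \<mu>0 (vsig n) (\<phi> n) (\<Lambda> n) n" for n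
  \<comment> \<open>\<open>B\<close> may not depend on \<open>\<eta>\<close>, but the bounds for large \<open>n\<close> do: taking the least admissible constant
    decouples the two.\<close>
  define B :: "nat \<Rightarrow> real" where "B n = real (LEAST c::nat. Q n (real c))" for n
  have Q_mono: "Q n c \<Longrightarrow> c \<le> c' \<Longrightarrow> Q n c'" for n c c' unfolding Q_def by (rule oracle_bound_mono)
  have B: "Q n (B n)" if "3 \<le> n" for n
  proof -
    have "\<exists>c::nat. Q n (real c)" unfolding Q_def using that assms by (intro oracle_bound_crude) auto
    then show ?thesis unfolding B_def by (rule LeastI_ex)
  qed
  have B_le: "B n \<le> c + 1" if "Q n c" "0 \<le> c" for n c
  proof -
    have "Q n (real (nat \<lceil>c\<rceil>))" using that(1) by (rule Q_mono) linarith
    then have "(LEAST c::nat. Q n (real c)) \<le> nat \<lceil>c\<rceil>" by (rule Least_le)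
    then have "B n \<le> real (nat \<lceil>c\<rceil>)" unfolding B_def by simp
    also have "\<dots> \<le> c + 1" using that(2) by linarith
    finally show ?thesis .
  qed
  have "(\<lambda>n. B n / real n powr \<eta>) \<longlonglongrightarrow> 0" if \<eta>: "0 < \<eta>" for \<eta>
  proof -
    \<comment> \<open>The bound grows like the sixth power of \<open>real n powr \<gamma>\<close>;
      dividing by the seventh leaves a negative power of \<open>n\<close>.\<close>
    define \<gamma> where "\<gamma> = \<eta> / 7"
    have \<gamma>: "0 < \<gamma>" using \<eta> unfolding \<gamma>_def by simp
    \<comment> \<open>Large enough for
      \<open>real n \<le> (real n powr \<gamma>) ^ (2 * m - 4)\<close>, and at least
      \<open>3\<close>.\<close>
    define m where "m = nat \<lceil>1 / \<gamma>\<rceil> + 3"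
    define C where "C = \<bar>ar_select.oracle_const a b y0 \<epsilon> L m\<bar>"
    have m3: "3 \<le> m" unfolding m_def by simp
    have m\<gamma>: "1 \<le> \<gamma> * real (2 * m - 4)"
    proof -
      have "1 / \<gamma> \<le> real (2 * m - 4)" unfolding m_def by (simp add: of_nat_diff) linarith
      moreover have "1 \<le> \<gamma> * r" if "1 / \<gamma> \<le> r" for r using that \<gamma> by (simp add: divide_le_eq mult.commute)
      ultimately show ?thesis by blast
    qed
    have "eventually (\<lambda>n. B n \<le> C * (real n powr \<gamma>) ^ 6 + 1) sequentially"
      using eventually_large_windows[OF assms(5,6)] eventually_le_powr[OF assms(10)[OF \<gamma>]]
        eventually_le_powr[OF assms(11)[OF \<gamma>]] eventually_log_le_powr[OF \<gamma>] eventually_ge_at_top[of 3]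
    proof eventually_elim
      case (elim n)
      have n1: "1 \<le> real n" using elim by simp
      have x1: "1 \<le> real n powr \<gamma>" using n1 \<gamma> by (intro ge_one_powr_ge_zero) auto
      have xp: "(real n powr \<gamma>) ^ k = real n powr (\<gamma> * real k)" for k
        using n1 by (simp add: powr_realpow[symmetric] powr_powr)
      have "real n powr 1 \<le> real n powr (\<gamma> * real (2 * m - 4))" by (rule powr_mono[OF m\<gamma> n1])
      also have "\<dots> = (real n powr \<gamma>) ^ (2 * m - 4)" by (rule xp[symmetric])
      finally have nx: "real n \<le> (real n powr \<gamma>) ^ (2 * m - 4)" using n1 by simp
      have ex: "1 / eps_tilde n \<le> real n powr \<gamma>" using elim unfolding eps_tilde_def by simp
      have "Q n (ar_select.oracle_const a b y0 \<epsilon> L m * (real n powr \<gamma>) ^ 6)"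
        unfolding Q_def using assms elim by (intro oracle_bound_large m3 x1 ex nx) auto
      then have "Q n (C * (real n powr \<gamma>) ^ 6)"
        by (rule Q_mono) (simp add: C_def mult_right_mono)
      then show ?case by (rule B_le) (simp add: C_def)
    qed
    then have up: "eventually (\<lambda>n. B n / real n powr \<eta> \<le> C * (real n powr (6 * \<gamma>) / real n powr (6 * \<gamma> + \<gamma>)) + real n powr 0 / real n powr (0 + \<eta>)) sequentially"
      using eventually_ge_at_top[of 1]
    proof eventually_elim
      case (elim n)
      have p: "(real n powr \<gamma>) ^ 6 = real n powr (6 * \<gamma>)"
        using elim by (simp add: powr_realpow[symmetric] powr_powr mult.commute)
      have e: "6 * \<gamma> + \<gamma> = \<eta>" unfolding \<gamma>_def by simp
      have "B n / real n powr \<eta> \<le> (C * real n powr (6 * \<gamma>) + 1) / real n powr \<eta>"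
        using elim(1) unfolding p by (intro divide_right_mono) auto
      then show ?case unfolding e using elim by (simp add: add_divide_distrib)
    qed
    have "(\<lambda>n. C * (real n powr (6 * \<gamma>) / real n powr (6 * \<gamma> + \<gamma>)) + real n powr 0 / real n powr (0 + \<eta>)) \<longlonglongrightarrow> C * 0 + 0"
      by (intro tendsto_add tendsto_mult tendsto_const powr_quotient_tendsto_0 \<gamma> \<eta>)
    then have lim: "(\<lambda>n. C * (real n powr (6 * \<gamma>) / real n powr (6 * \<gamma> + \<gamma>)) + real n powr 0 / real n powr (0 + \<eta>)) \<longlonglongrightarrow> 0" by simp
    show ?thesis
      by (rule tendsto_sandwich[OF _ up tendsto_const lim]) (simp add: B_def)
  qed
  moreover have "\<forall>n\<ge>3. oracle_bound a b \<epsilon> L y0 \<mu>0 (vsig n) (\<phi> n) (\<Lambda> n) n (B n)"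
    using B unfolding Q_def by blast
  ultimately show ?thesis unfolding oracle_bound_def by blast
qed

end
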